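(* There exists a function $c_3\colon(0,1)\to(0,\infty)$ such that the following holds. Let $0<\varepsilon<1$. For any (deterministic) sequence $(A_n)_{n\in\mathbb N}$ of real $3\times 3$ matrices with $\|A_n\|\le 1$ for all $n$, and for $j=1$ or $j=2$, the random variable $$\liminf_{n\to\infty}\frac 1n\log\frac{s_j(A_\varepsilon^{(n)})}{s_{j+1}(A_\varepsilon^{(n)})}$$ is almost surely constant, and the constant is at least $c_3(\varepsilon)$. Further, $c_3(\varepsilon)>\exp(-1/\varepsilon^{867})$ for all sufficiently small $\varepsilon>0$.
   Context: $\|M\|$ is the operator norm of a matrix $M$ induced by the Euclidean norm, and $s_1(M)\ge\dots\ge s_d(M)$ are the singular values of a $d\times d$ matrix $M$. $(\Xi_n)_{n\in\mathbb N}$ is a sequence of independent random $d\times d$ matrices (here $d=3$), each with mutually independent entries uniformly distributed on $[-1,1]$. Given a fixed sequence $(A_n)$, set $A_{n,\varepsilon}=A_n+\varepsilon\Xi_n$ and $A_\varepsilon^{(n)}=A_{n,\varepsilon}A_{n-1,\varepsilon}\cdots A_{1,\varepsilon}$. "Almost surely" refers to the randomness of $(\Xi_n)$. The quantity $c_3(\varepsilon)$ depends only on $\varepsilon$, not on the sequence $(A_n)$. *)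

theory Defs
  imports "HOL-Probability.Probability" "HOL-Computational_Algebra.Polynomial"
begin

definition charpoly :: "real^'n^'n \<Rightarrow> real poly"
  where "charpoly A = det (mat [:0, 1:] - (\<chi> i j. [:A $ i $ j:]))"

lemma poly_charpoly: "poly (charpoly A) x = det (mat x - A)"
  by (simp add: charpoly_def det_def poly_sum poly_prod mat_def if_distrib [of "\<lambda>p. poly p x"]
      cong: if_cong)

text \<open>
  The singular values of \<open>M\<close> are the square roots of the eigenvalues of \<open>transpose M ** M\<close>,
  repeated according to multiplicity and listed in decreasing order. That matrix is symmetric and
  positive semidefinite, so all roots of its characteristic polynomial are real and nonnegative
  and the list has length \<open>CARD('n)\<close>. Following the usual convention, \<open>singular_value j M\<close>
  counts \<open>j\<close> from \<open>1\<close>; it is unspecified outside \<open>1 \<le> j \<le> CARD('n)\<close>.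
\<close>

definition singular_values :: "real^'n^'n \<Rightarrow> real list"
  where "singular_values M =
    rev (sorted_list_of_multiset (image_mset sqrt (proots (charpoly (transpose M ** M)))))"

definition singular_value :: "nat \<Rightarrow> real^'n^'n \<Rightarrow> real"
  where "singular_value j M = singular_values M ! (j - 1)"

text \<open>Sequences of matrices are indexed by \<open>n \<ge> 1\<close>; the value at \<open>n = 0\<close> is never used.\<close>

definition iid_uniform_matrices :: "'w measure \<Rightarrow> (nat \<Rightarrow> 'w \<Rightarrow> real^'n^'n) \<Rightarrow> bool"
  where "iid_uniform_matrices M \<Xi> \<longleftrightarrow>
    prob_space.indep_vars M (\<lambda>_. borel) \<Xi> {1..} \<and>
    (\<forall>n\<ge>1. prob_space.indep_vars M (\<lambda>_. borel) (\<lambda>(i, j) \<omega>. \<Xi> n \<omega> $ i $ j) UNIV \<and>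
      (\<forall>i j. distr M lborel (\<lambda>\<omega>. \<Xi> n \<omega> $ i $ j) = uniform_measure lborel {-1..1}))"

fun perturbed_product ::
  "(nat \<Rightarrow> real^'n^'n) \<Rightarrow> real \<Rightarrow> (nat \<Rightarrow> real^'n^'n) \<Rightarrow> nat \<Rightarrow> real^'n^'n"
  where
    "perturbed_product A \<epsilon> X 0 = mat 1"
  | "perturbed_product A \<epsilon> X (Suc n) =
      (A (Suc n) + \<epsilon> *\<^sub>R X (Suc n)) ** perturbed_product A \<epsilon> X n"

end

theory Submission
  imports Defs
begin

text \<open>
  Let \<open>|K|\<close> be the Euclidean norm of a \<open>3 \<times> 3\<close> matrix \<open>K\<close> as a vector of nine entries, and
  \<open>cof K\<close> its cofactor matrix, which describes how \<open>K\<close> acts on cross products. Up to a factor \<open>3\<close>,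
  the ratio \<open>s\<^sub>1/s\<^sub>2\<close> of \<open>M\<close> is \<open>|K|\<^sup>2 / |cof K|\<close> for \<open>K = M\<close>, and \<open>s\<^sub>2/s\<^sub>3\<close> is the same
  expression for \<open>K = cof M\<close> (lemma \<open>singular_value_ratio\<close>). As \<open>cof\<close> is multiplicative, both gaps
  can be treated at once: one has a multiplicative map \<open>\<kappa>\<close>, the identity or \<open>cof\<close>, and has to show
  that \<open>|Kx \<times> Ky| / |Kx|\<^sup>2\<close> decays exponentially along the products \<open>K\<close> of the matrices
  \<open>\<kappa> (A\<^sub>n + \<epsilon> \<Xi>\<^sub>n)\<close>, for any two vectors \<open>x\<close>, \<open>y\<close> of the standard basis. This
  quantity is the derivative at the line of \<open>x\<close> of the map that \<open>K\<close> induces from the lines in the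
  plane of \<open>x\<close>, \<open>y\<close> to the lines in the image plane.

  The expectation of its square root is an iterated transfer operator
  \<open>T F (x, y) = E F (\<kappa> M x, \<kappa> M y)\<close>, applied to functions \<open>F\<close> of a line and a plane containing it
  that transform like half-densities on the projective line of each plane. For
  such functions the square integral over the projective line of a plane makes sense without any
  choice of coordinates, so a single matrix maps the half-densities on one plane isometrically to
  those on another one, and \<open>T\<close>, being an average, does not increase the largest square integral.
  It even contracts it by a factor \<open>1 - c \<epsilon>\<^sup>2\<close> independent of \<open>A\<close>: right multiplication by a matrix \<open>g\<close> of
  determinant \<open>1\<close> preserves Lebesgue measure, so the uniform distribution on a cube of side
  \<open>2 \<epsilon>\<close> contains, with weight \<open>1/512\<close>, the distribution of \<open>M g\<close> for \<open>M\<close> uniform on the cube of half the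
  size and \<open>g\<close> chosen at random among four area-preserving maps of the plane that are \<open>\<epsilon>\<close>-close to the
  identity. The average of these four maps acts on half-densities with norm less than \<open>1\<close>; Schur's
  test with the weight \<open>1/|x|\<close> reduces this to an elementary inequality. This is Furstenberg's
  argument for positivity of exponents, carried out factor by factor, so that it applies to every sequence
  \<open>A\<close>. The lemmas that carry it are \<open>fibre_stretch_average_le\<close>, \<open>transfer_split\<close> and \<open>fibre_transfer_le\<close>.

  The smoothness of the first factor turns the bound on square integrals into a pointwise one
  (\<open>transfer_square_le\<close>), so the expectations decay like \<open>(1 - c \<epsilon>\<^sup>2)\<^bsup>n/2\<^esup>\<close>, and summability gives the
  almost sure decay. The inferior limit is not affected by finitely many invertible factors, and
  hence is almost surely constant by Kolmogorov's zero-one law. The resulting bound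
  \<open>c\<^sub>3 \<epsilon> = \<epsilon>\<^sup>2 / 16384000\<close> is polynomial, much larger than \<open>exp (- 1 / \<epsilon>\<^bsup>867\<^esup>)\<close>.
\<close>

section \<open>The cofactor matrix\<close>

definition cof :: "real^3^3 \<Rightarrow> real^3^3"
  where "cof A = vector [cross3 (A $ 2) (A $ 3), cross3 (A $ 3) (A $ 1), cross3 (A $ 1) (A $ 2)]"

lemma cof_nth:
  "cof A $ 1 = cross3 (A $ 2) (A $ 3)" "cof A $ 2 = cross3 (A $ 3) (A $ 1)" "cof A $ 3 = cross3 (A $ 1) (A $ 2)"
  by (simp_all add: cof_def)

lemma cof_cross: "cof A *v cross3 x y = cross3 (A *v x) (A *v y)"
  by (simp add: vec_eq_iff forall_3 cof_nth cross3_def vector_def matrix_vector_mult_def sum_3 algebra_simps)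

lemma ex_cross3: "\<exists>x y. (z::real^3) = cross3 x y"
proof (cases "z = 0")
  case True
  then show ?thesis by (intro exI[of _ 0]) simp
next
  case False
  have "\<exists>y. y \<noteq> 0 \<and> z \<bullet> y = 0"
  proof (cases "z$1 = 0 \<and> z$2 = 0")
    case True
    then show ?thesis by (intro exI[of _ "axis 1 1"]) (auto simp: inner_vec_def sum_3 axis_def vec_eq_iff)
  next
    case False
    then show ?thesis by (intro exI[of _ "vector [- z$2, z$1, 0]"]) (auto simp: inner_vec_def sum_3 forall_3 vec_eq_iff)
  qed
  then obtain y where y: "y \<noteq> 0" "z \<bullet> y = 0" by blast
  have "cross3 (cross3 y z) y = (y \<bullet> y) *\<^sub>R z - (z \<bullet> y) *\<^sub>R y"
    by (simp add: cross3_simps forall_3)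
  then have "z = cross3 ((1 / (y \<bullet> y)) *\<^sub>R cross3 y z) y"
    using y by (simp add: cross_mult_left)
  then show ?thesis by blast
qed

text \<open>
  Every vector of \<open>\<real>\<^sup>3\<close> is a cross product, and on cross products \<open>cof A\<close> acts by
  transforming both factors with \<open>A\<close>; multiplicativity follows.
\<close>

lemma cof_mult: "cof (A ** B) = cof A ** cof B"
proof -
  have "cof (A ** B) *v z = (cof A ** cof B) *v z" for z
  proof -
    obtain x y where "z = cross3 x y" using ex_cross3 by blast
    then show ?thesis by (simp add: cof_cross flip: matrix_vector_mul_assoc)
  qed
  then show ?thesis by (simp add: matrix_eq)
qed

text \<open>
  This identity is why the second gap is the first gap of the cofactor matrix.
\<close>

lemma cof_cof: "cof (cof A) = det A *\<^sub>R A"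
  by (simp add: vec_eq_iff forall_3 cof_nth cross3_def vector_def det_3 algebra_simps)

lemma transpose_mult_cof: "transpose A ** cof A = det A *\<^sub>R mat 1"
  by (simp add: vec_eq_iff forall_3 cof_nth cross3_def vector_def det_3 matrix_matrix_mult_def transpose_def mat_def sum_3 algebra_simps)

lemma cof_mat1: "cof (mat 1) = mat 1"
  by (simp add: vec_eq_iff forall_3 cof_nth cross3_def vector_def mat_def)

lemma cof_nonzero: "det A \<noteq> 0 \<Longrightarrow> cof A \<noteq> 0"
  using transpose_mult_cof[of A] by (auto simp: matrix_matrix_mult_def vec_eq_iff forall_3 sum_3 mat_def)

lemma norm_matrix_vector_mult_le: "norm (A *v x) \<le> norm A * norm (x::real^'n)"
proof -
  have "norm (A *v x) \<le> norm (\<chi> i. norm (A $ i) * norm x)"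
    by (rule norm_le_componentwise_cart) (simp add: matrix_vector_mul_component Cauchy_Schwarz_ineq2)
  also have "\<dots> = norm A * norm x"
    by (simp add: norm_vec_def L2_set_def power_mult_distrib flip: sum_distrib_right) (simp add: real_sqrt_mult sum_nonneg)
  finally show ?thesis .
qed

lemma norm_matrix_mult_le: "norm (A ** B) \<le> norm A * norm (B :: real^'n^'n)"
proof -
  have row: "norm ((A ** B) $ i) \<le> norm (A $ i) * norm B" for i
  proof -
    have "(A ** B) $ i = transpose B *v (A $ i)"
      by (simp add: vec_eq_iff matrix_matrix_mult_def matrix_vector_mult_def transpose_def mult.commute)
    moreover have "norm (transpose B) = norm B"
      by (simp add: norm_vec_def L2_set_def transpose_def sum_nonneg) (subst sum.swap, simp)
    ultimately show ?thesis
      using norm_matrix_vector_mult_le[of "transpose B" "A $ i"] by (simp add: mult.commute)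
  qed
  have "norm (A ** B) \<le> norm (\<chi> i. norm (A $ i) * norm B)"
    by (rule norm_le_componentwise_cart) (simp add: row)
  also have "\<dots> = norm A * norm B"
    by (simp add: norm_vec_def L2_set_def power_mult_distrib flip: sum_distrib_right) (simp add: real_sqrt_mult sum_nonneg)
  finally show ?thesis .
qed

section \<open>Lebesgue integration on the space of matrices\<close>

lemma borel_measurable_vec_component [measurable]:
  "(\<lambda>x :: 'a::{second_countable_topology, real_normed_vector}^'n. x $ i) \<in> borel_measurable borel"
  by (intro borel_measurable_continuous_onI continuous_intros)

lemma nn_integral_lborel_shift:
  fixes f :: "'a::euclidean_space \<Rightarrow> ennreal"
  assumes [measurable]: "f \<in> borel_measurable borel"
  shows "(\<integral>\<^sup>+x. f (a + x) \<partial>lborel) = (\<integral>\<^sup>+x. f x \<partial>lborel)"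
proof -
  have "(\<integral>\<^sup>+x. f x \<partial>lborel) = (\<integral>\<^sup>+x. f x \<partial>distr lborel borel ((+) a))"
    by (simp add: lborel_distr_plus)
  also have "\<dots> = (\<integral>\<^sup>+x. f (a + x) \<partial>lborel)"
    by (subst nn_integral_distr) auto
  finally show ?thesis ..
qed

lemma nn_integral_lborel_affine:
  fixes f :: "'a::euclidean_space \<Rightarrow> ennreal"
  assumes [measurable]: "f \<in> borel_measurable borel" and c: "c \<noteq> 0"
  shows "(\<integral>\<^sup>+x. f x \<partial>lborel) = ennreal (\<bar>c\<bar> ^ DIM('a)) * (\<integral>\<^sup>+x. f (t + c *\<^sub>R x) \<partial>lborel)"
  by (subst lborel_affine[OF c, of t])
     (simp add: nn_integral_density nn_integral_distr nn_integral_cmult)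

lemma nn_integral_lborel_reflect:
  fixes f :: "'a::euclidean_space \<Rightarrow> ennreal"
  assumes [measurable]: "f \<in> borel_measurable borel"
  shows "(\<integral>\<^sup>+x. f (a - x) \<partial>lborel) = (\<integral>\<^sup>+x. f x \<partial>lborel)"
  using nn_integral_lborel_affine[OF assms, of "-1" a] by simp

text \<open>
  Both sides are translation invariant measures of \<open>f\<close>, so they agree up to a constant \<open>c\<close>
  by the double integral that proves uniqueness of Haar measure. Applying the involution twice
  gives \<open>c\<^sup>2 = 1\<close>.
\<close>

lemma nn_integral_lborel_linear_involution:
  fixes f :: "'a::euclidean_space \<Rightarrow> ennreal"
  assumes [measurable]: "f \<in> borel_measurable borel"
    and K: "linear K" "\<And>x. K (K x) = x"
  shows "(\<integral>\<^sup>+x. f (K x) \<partial>lborel) = (\<integral>\<^sup>+x. f x \<partial>lborel)"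
proof -
  have Km [measurable]: "K \<in> borel_measurable borel"
    using K(1) by (intro borel_measurable_continuous_onI linear_continuous_on) (simp add: linear_conv_bounded_linear)
  \<comment> \<open>A test function with integral \<open>1\<close>, to fix the constant.\<close>
  define b :: "'a \<Rightarrow> ennreal" where "b = indicator (box 0 One)"
  have [measurable]: "b \<in> borel_measurable borel" by (simp add: b_def)
  have b1: "(\<integral>\<^sup>+x. b x \<partial>lborel) = 1"
    by (simp add: b_def emeasure_lborel_box_eq)
  have *: "(\<integral>\<^sup>+x. g (K x) \<partial>lborel) = (\<integral>\<^sup>+x. b (K x) \<partial>lborel) * (\<integral>\<^sup>+x. g x \<partial>lborel)"
    if [measurable]: "g \<in> borel_measurable borel" for g :: "'a \<Rightarrow> ennreal"
  proof -
    have "(\<integral>\<^sup>+x. g (K x) \<partial>lborel) = (\<integral>\<^sup>+x. (\<integral>\<^sup>+y. g (K x) * b (K x + y) \<partial>lborel) \<partial>lborel)"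
      by (simp add: nn_integral_cmult nn_integral_lborel_shift b1)
    also have "\<dots> = (\<integral>\<^sup>+y. (\<integral>\<^sup>+x. g (K x) * b (K x + y) \<partial>lborel) \<partial>lborel)"
      by (rule lborel_pair.Fubini') simp
    also have "\<dots> = (\<integral>\<^sup>+y. (\<integral>\<^sup>+x. g (K x - y) * b (K x) \<partial>lborel) \<partial>lborel)"
    proof (rule nn_integral_cong)
      fix y
      have "(\<integral>\<^sup>+x. g (K (- K y + x)) * b (K (- K y + x) + y) \<partial>lborel) = (\<integral>\<^sup>+x. g (K x) * b (K x + y) \<partial>lborel)"
        by (rule nn_integral_lborel_shift) simp
      then show "(\<integral>\<^sup>+x. g (K x) * b (K x + y) \<partial>lborel) = (\<integral>\<^sup>+x. g (K x - y) * b (K x) \<partial>lborel)"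
        by (simp add: linear_diff[OF K(1)] K(2))
    qed
    also have "\<dots> = (\<integral>\<^sup>+x. (\<integral>\<^sup>+y. g (K x - y) * b (K x) \<partial>lborel) \<partial>lborel)"
      by (rule lborel_pair.Fubini') simp
    also have "\<dots> = (\<integral>\<^sup>+x. b (K x) \<partial>lborel) * (\<integral>\<^sup>+x. g x \<partial>lborel)"
      by (simp add: nn_integral_multc nn_integral_lborel_reflect mult.commute nn_integral_cmult)
    finally show ?thesis .
  qed
  define c where "c = (\<integral>\<^sup>+x. b (K x) \<partial>lborel)"
  have "c * c = 1"
    using *[of "\<lambda>x. b (K x)"] K(2) by (simp add: c_def b1)
  then have "c = 1"
  proof (cases c)
    case (real r)
    then have "r * r = 1"
      using \<open>c * c = 1\<close> by (simp add: ennreal_eq_1 flip: ennreal_mult)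
    then show ?thesis
      using real by (simp add: square_eq_1_iff)
  qed (use \<open>c * c = 1\<close> in \<open>simp add: ennreal_top_mult\<close>)
  then show ?thesis using *[of f] by (simp add: c_def)
qed

text \<open>
  Substitution of \<open>- 1 / t\<close>, which is increasing on each half-line, on compact intervals that
  exhaust the two half-lines.
\<close>

lemma nn_integral_neg_inverse:
  fixes f :: "real \<Rightarrow> ennreal"
  assumes [measurable]: "f \<in> borel_measurable borel"
  shows "(\<integral>\<^sup>+t. f (- 1 / t) * ennreal (1 / t\<^sup>2) \<partial>lborel) = (\<integral>\<^sup>+t. f t \<partial>lborel)"
proof -
  define I where "I n = {1 / real (Suc n)..real (Suc n)}" for n
  define J where "J n = {- real (Suc n)..- 1 / real (Suc n)}" for n
  let ?S = "\<lambda>n. indicator (I n \<union> J n) :: real \<Rightarrow> ennreal"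
  have sub: "(\<integral>\<^sup>+x. f x * indicator {-1/a..-1/b} x \<partial>lborel)
      = (\<integral>\<^sup>+t. f (- 1 / t) * ennreal (1 / t\<^sup>2) * indicator {a..b} t \<partial>lborel)"
    if "a < b" "0 < a \<or> b < 0" for a b :: real
  proof (rule nn_integral_substitution_aux[of f a b "\<lambda>t. -1/t" "\<lambda>t. 1/t\<^sup>2"])
    fix x assume "x \<in> {a..b}"
    then have "x \<noteq> 0" using that by auto
    then show "((\<lambda>t. - 1 / t) has_real_derivative 1 / x\<^sup>2) (at x)"
      by (auto intro!: derivative_eq_intros simp: power2_eq_square field_simps)
  next
    show "continuous_on {a..b} (\<lambda>t. 1 / t\<^sup>2)"
      using that by (intro continuous_intros) auto
  qed (use that in auto)
  have disj: "I n \<inter> J n = {}" for n by (auto simp: I_def J_def field_simps)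
  have eqn: "(\<integral>\<^sup>+x. f x * ?S (Suc n) x \<partial>lborel)
      = (\<integral>\<^sup>+t. f (- 1 / t) * ennreal (1 / t\<^sup>2) * ?S (Suc n) t \<partial>lborel)" for n
  proof -
    have 1: "f x * ?S (Suc n) x = f x * indicator (I (Suc n)) x + f x * indicator (J (Suc n)) x" for f :: "real \<Rightarrow> ennreal" and x
    proof -
      have "x \<in> I (Suc n) \<Longrightarrow> x \<notin> J (Suc n)"
        using disj[of "Suc n"] by blast
      then show ?thesis
        by (cases "x \<in> I (Suc n)"; cases "x \<in> J (Suc n)") simp_all
    qed
    have [measurable]: "I n \<in> sets borel" "J n \<in> sets borel" for n by (simp_all add: I_def J_def)
    define N where "N = real (Suc (Suc n))"
    have N: "1 < N" "1 / N < N" by (simp_all add: N_def divide_less_eq less_1_mult)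
    have IJ: "I (Suc n) = {1 / N..N}" "J (Suc n) = {- N..- 1 / N}" by (simp_all add: I_def J_def N_def)
    have "(\<integral>\<^sup>+x. f x * indicator (J (Suc n)) x \<partial>lborel)
      = (\<integral>\<^sup>+t. f (- 1 / t) * ennreal (1 / t\<^sup>2) * indicator (I (Suc n)) t \<partial>lborel)"
      using sub[OF N(2)] N(1) unfolding IJ by simp
    moreover have "(\<integral>\<^sup>+x. f x * indicator (I (Suc n)) x \<partial>lborel)
      = (\<integral>\<^sup>+t. f (- 1 / t) * ennreal (1 / t\<^sup>2) * indicator (J (Suc n)) t \<partial>lborel)"
      using sub[of "- N" "- 1 / N"] N unfolding IJ by simp
    moreover have "(\<integral>\<^sup>+x. g x * ?S (Suc n) x \<partial>lborel)
      = (\<integral>\<^sup>+x. g x * indicator (I (Suc n)) x \<partial>lborel) + (\<integral>\<^sup>+x. g x * indicator (J (Suc n)) x \<partial>lborel)"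
      if [measurable]: "g \<in> borel_measurable borel" for g
      unfolding 1 by (rule nn_integral_add) simp_all
    ultimately show ?thesis
      by (simp add: add.commute)
  qed
  have lim: "(\<integral>\<^sup>+x. g x \<partial>lborel) = (SUP n. \<integral>\<^sup>+x. g x * ?S (Suc n) x \<partial>lborel)"
    if [measurable]: "g \<in> borel_measurable borel" for g :: "real \<Rightarrow> ennreal"
  proof -
    have [measurable]: "I n \<in> sets borel" "J n \<in> sets borel" for n by (simp_all add: I_def J_def)
    have sub: "I n \<subseteq> I (Suc n)" "J n \<subseteq> J (Suc n)" for n
      by (auto simp: I_def J_def field_simps)
    have mono: "incseq (\<lambda>n x. g x * ?S (Suc n) x)"
      using sub by (intro incseq_SucI le_funI mult_left_mono) (auto simp: indicator_def split: if_splits)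
    have pt: "(SUP n. g x * ?S (Suc n) x) = g x" if "x \<noteq> 0" for x
    proof -
      obtain n where n: "real n \<ge> max \<bar>x\<bar> (1 / \<bar>x\<bar>)" using real_arch_simple by blast
      have "x \<in> I (Suc n) \<union> J (Suc n)"
        using n \<open>x \<noteq> 0\<close> by (cases "x > 0") (auto simp: I_def J_def field_simps)
      then have "g x \<le> (SUP n. g x * ?S (Suc n) x)"
        by (intro SUP_upper2[of n]) auto
      moreover have "(SUP n. g x * ?S (Suc n) x) \<le> g x"
        by (intro SUP_least) (auto simp: indicator_def)
      ultimately show ?thesis by (rule antisym[rotated])
    qed
    have "(\<integral>\<^sup>+x. g x \<partial>lborel) = (\<integral>\<^sup>+x. (SUP n. g x * ?S (Suc n) x) \<partial>lborel)"
      by (rule nn_integral_cong_AE) (use AE_lborel_singleton[of 0] in \<open>eventually_elim, simp add: pt\<close>)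
    also have "\<dots> = (SUP n. \<integral>\<^sup>+x. g x * ?S (Suc n) x \<partial>lborel)"
      by (rule nn_integral_monotone_convergence_SUP[OF mono]) simp
    finally show ?thesis .
  qed
  show ?thesis
    by (subst (1 2) lim) (simp_all add: eqn)
qed

lemma nn_integral_square_le:
  assumes "f \<in> borel_measurable M"
  shows "(\<integral>\<^sup>+x. f x \<partial>M)\<^sup>2 \<le> emeasure M (space M) * (\<integral>\<^sup>+x. (f x)\<^sup>2 \<partial>M)"
  using Cauchy_Schwarz_nn_integral[OF assms, of "\<lambda>_. 1"] by (simp add: mult.commute)

definition cube :: "real^3^3 \<Rightarrow> real \<Rightarrow> (real^3^3) set"
  where "cube A r = {M. \<forall>i j. \<bar>M $ i $ j - A $ i $ j\<bar> \<le> r}"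

lemma cbox_vec_vec: "cbox l u = {M :: real^'n^'m. \<forall>i j. l $ i $ j \<le> M $ i $ j \<and> M $ i $ j \<le> u $ i $ j}"
  by (auto simp: interval_cbox[symmetric] less_eq_vec_def)

lemma cube_eq_cbox: "cube A r = cbox (\<chi> i j. A $ i $ j - r) (\<chi> i j. A $ i $ j + r)"
  by (auto simp: cube_def cbox_vec_vec abs_le_iff field_simps)

lemma prod_Basis_vec_vec:
  "(\<Prod>b\<in>(Basis :: (real^'n^'m) set). f b) = (\<Prod>(i, j)\<in>UNIV. f (axis i (axis j 1)))"
proof -
  have "(Basis :: (real^'n^'m) set) = (\<lambda>(i, j). axis i (axis j 1)) ` UNIV"
    by (auto simp: Basis_vec_def image_iff)
  moreover have "inj (\<lambda>(i, j). axis i (axis j 1) :: real^'n^'m)"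
    by (auto simp: inj_on_def axis_eq_axis)
  ultimately have "(\<Prod>b\<in>Basis. f b) = (\<Prod>p\<in>UNIV. f ((\<lambda>(i, j). axis i (axis j 1)) p))"
    by (metis prod.reindex_cong)
  then show ?thesis by (simp add: case_prod_unfold)
qed

lemma emeasure_lborel_cbox_vec_vec:
  fixes l u :: "real^'n^'m"
  shows "emeasure lborel (cbox l u) = (\<Prod>(i, j)\<in>UNIV. emeasure lborel {l $ i $ j..u $ i $ j})"
proof (cases "\<forall>i j. l $ i $ j \<le> u $ i $ j")
  case True
  have "emeasure lborel (cbox l u) = ennreal (\<Prod>b\<in>Basis. (u - l) \<bullet> b)"
    using True by (intro emeasure_lborel_cbox) (auto simp: Basis_vec_def inner_axis)
  also have "\<dots> = (\<Prod>(i, j)\<in>UNIV. ennreal (u $ i $ j - l $ i $ j))"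
    using True by (subst prod_Basis_vec_vec) (simp add: inner_axis case_prod_unfold prod_ennreal)
  finally show ?thesis using True by simp
next
  case False
  then have "cbox l u = {}" by (auto simp: cbox_vec_vec) (meson order_trans)
  moreover have "(\<Prod>(i, j)\<in>UNIV. emeasure lborel {l $ i $ j..u $ i $ j}) = 0"
  proof (rule prod_zero)
    from False obtain i j where "{l $ i $ j..u $ i $ j} = {}" by auto
    then have "emeasure lborel {l $ i $ j..u $ i $ j} = 0" by (metis emeasure_empty)
    then show "\<exists>p\<in>UNIV. (case p of (i, j) \<Rightarrow> emeasure lborel {l $ i $ j..u $ i $ j}) = 0"
      by auto
  qed simp
  ultimately show ?thesis by simp
qed

lemma emeasure_cube: "0 \<le> r \<Longrightarrow> emeasure lborel (cube A r) = ennreal ((2 * r) ^ 9)"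
  unfolding cube_eq_cbox emeasure_lborel_cbox_vec_vec by (simp add: case_prod_unfold ennreal_power)

lemma sets_cube [measurable]: "cube A r \<in> sets borel"
  by (simp add: cube_eq_cbox)

text \<open>
  The two measures agree on boxes, where both are products over the nine entries.
\<close>

lemma distr_uniform_entries:
  fixes X :: "'w \<Rightarrow> real^3^3"
  assumes "prob_space M"
    and rv: "X \<in> borel_measurable M"
    and ind: "prob_space.indep_vars M (\<lambda>_. borel) (\<lambda>(i, j) \<omega>. X \<omega> $ i $ j) UNIV"
    and unif: "\<And>i j. distr M lborel (\<lambda>\<omega>. X \<omega> $ i $ j) = uniform_measure lborel {-1..1}"
  shows "distr M borel X = uniform_measure lborel (cube 0 1)"
proof (rule measure_eqI_generator_eq)
  interpret prob_space M by fact
  let ?E = "range (\<lambda>(a, b). {a..b} :: (real^3^3) set)"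
  show "Int_stable ?E"
  proof (rule Int_stableI)
    fix A B assume "A \<in> ?E" "B \<in> ?E"
    then obtain a b c d where "A = cbox a b" "B = cbox c d" by (auto simp: interval_cbox)
    then have "A \<inter> B \<in> range (\<lambda>(a, b). cbox a b)"
      by (auto simp: Int_interval intro!: image_eqI[of _ _ "(p, q)" for p q])
    then show "A \<inter> B \<in> ?E" by (simp add: interval_cbox)
  qed
  show "?E \<subseteq> Pow UNIV" by simp
  show "sets (distr M borel X) = sigma_sets UNIV ?E" "sets (uniform_measure lborel (cube 0 1)) = sigma_sets UNIV ?E"
    by (simp_all add: borel_eq_atLeastAtMost)
  let ?A = "\<lambda>n::nat. {- (real n *\<^sub>R One) .. (real n *\<^sub>R One)} :: (real^3^3) set"
  show "range ?A \<subseteq> ?E" by auto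
  show "(\<Union>i. ?A i) = UNIV"
  proof -
    have "\<exists>n::nat. x \<in> ?A n" for x :: "real^3^3"
    proof -
      obtain n where n: "norm x \<le> real n" using real_arch_simple by blast
      have "\<bar>x \<bullet> b\<bar> \<le> real n" if "b \<in> Basis" for b
        using Basis_le_norm[OF that, of x] n by linarith
      then have "x \<in> ?A n" by (auto simp: interval_cbox mem_box abs_le_iff minus_le_iff)
      then show ?thesis ..
    qed
    then show ?thesis by auto
  qed
  interpret D: prob_space "distr M borel X" using rv by (rule prob_space_distr)
  show "emeasure (distr M borel X) (?A i) \<noteq> \<infinity>" for i
    using D.emeasure_finite by simp
  fix B assume "B \<in> ?E"
  then obtain l u where B: "B = {l..u}" by auto
  have ent: "prob ((\<lambda>\<omega>. X \<omega> $ i $ j) -` {a..b} \<inter> space M) = emeasure lborel ({-1..1} \<inter> {a..b}) / 2" for i j and a b :: real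
  proof -
    have "emeasure (distr M lborel (\<lambda>\<omega>. X \<omega> $ i $ j)) {a..b} = emeasure M ((\<lambda>\<omega>. X \<omega> $ i $ j) -` {a..b} \<inter> space M)"
      using rv by (subst emeasure_distr) auto
    then show ?thesis
      unfolding unif by (simp add: emeasure_eq_measure)
  qed
  let ?l = "\<chi> i j. max (-1) (l $ i $ j)" and ?u = "\<chi> i j. min 1 (u $ i $ j)"
  have "emeasure (distr M borel X) B = emeasure M (X -` {l..u} \<inter> space M)"
    using rv by (simp add: emeasure_distr B)
  also have "X -` {l..u} \<inter> space M = (\<Inter>p\<in>UNIV. (case p of (i, j) \<Rightarrow> \<lambda>\<omega>. X \<omega> $ i $ j) -` {l $ fst p $ snd p..u $ fst p $ snd p} \<inter> space M)"
    by (auto simp: less_eq_vec_def)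
  also have "emeasure M \<dots> = ennreal (\<Prod>p\<in>UNIV. prob ((case p of (i, j) \<Rightarrow> \<lambda>\<omega>. X \<omega> $ i $ j) -` {l $ fst p $ snd p..u $ fst p $ snd p} \<inter> space M))"
    unfolding emeasure_eq_measure by (subst indep_varsD_finite[OF ind]) auto
  also have "\<dots> = (\<Prod>(i,j)\<in>UNIV. emeasure lborel ({-1..1} \<inter> {l $ i $ j..u $ i $ j}) / 2)"
    by (simp add: prod_ennreal[symmetric] case_prod_unfold ent del: Int_atLeastAtMost)
  also have "\<dots> = (\<Prod>(i,j)\<in>UNIV. emeasure lborel {?l $ i $ j..?u $ i $ j}) / 2 ^ 9"
    by (simp add: divide_ennreal_def prod.distrib case_prod_unfold flip: ennreal_inverse_power del: power_numeral)
  also have "\<dots> = emeasure lborel (cube 0 1 \<inter> B) / 2 ^ 9"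
  proof -
    have "cube 0 1 \<inter> B = cbox ?l ?u"
      by (auto simp: B interval_cbox cbox_vec_vec cube_eq_cbox)
    then show ?thesis by (simp add: emeasure_lborel_cbox_vec_vec)
  qed
  also have "\<dots> = emeasure (uniform_measure lborel (cube 0 1)) B"
    by (simp add: B emeasure_cube)
  finally show "emeasure (distr M borel X) B = emeasure (uniform_measure lborel (cube 0 1)) B" .
qed

section \<open>Half-densities on the lines of a plane\<close>

lemma borel_measurable_matrix_vector_mult [measurable]:
  "(\<lambda>x. A *v x) \<in> borel_measurable borel" for A :: "real^'n^'m"
  by (intro borel_measurable_continuous_onI continuous_intros)

text \<open>
  A function of the flag formed by the line of \<open>x\<close> and the plane of \<open>x\<close>, \<open>y\<close>, up to the factor
  by which a half-density on the projective line of that plane changes when the basis changes.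
  The value \<open>0\<close> on dependent pairs makes singular matrices harmless.
\<close>

definition flag_density :: "(real^3 \<Rightarrow> real^3 \<Rightarrow> ennreal) \<Rightarrow> bool"
  where "flag_density F \<longleftrightarrow>
    (\<lambda>p. F (fst p) (snd p)) \<in> borel_measurable (borel \<Otimes>\<^sub>M borel) \<and>
    (\<forall>a b c x y. a \<noteq> 0 \<longrightarrow> c \<noteq> 0 \<longrightarrow> F (a *\<^sub>R x) (b *\<^sub>R x + c *\<^sub>R y) = ennreal (sqrt \<bar>c / a\<bar>) * F x y) \<and>
    (\<forall>x y. cross3 x y = 0 \<longrightarrow> F x y = 0)"

text \<open>
  In the affine chart \<open>t \<mapsto> u + t v\<close> of the lines in the plane of \<open>u\<close>, \<open>v\<close>, this is the integral of the
  square of the half-density \<open>F\<close>. The next lemmas show that it depends on the plane only.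
\<close>

definition fibre_energy :: "(real^3 \<Rightarrow> real^3 \<Rightarrow> ennreal) \<Rightarrow> real^3 \<Rightarrow> real^3 \<Rightarrow> ennreal"
  where "fibre_energy F u v = (\<integral>\<^sup>+t. (F (u + t *\<^sub>R v) v)\<^sup>2 \<partial>lborel)"

lemma flag_density_measurable:
  assumes "flag_density F" and [measurable]: "f \<in> borel_measurable M" "g \<in> borel_measurable M"
  shows "(\<lambda>x. F (f x) (g x)) \<in> borel_measurable M"
proof -
  have F: "(\<lambda>p. F (fst p) (snd p)) \<in> borel_measurable (borel \<Otimes>\<^sub>M borel)"
    using assms(1) by (simp add: flag_density_def)
  have "(\<lambda>x. (f x, g x)) \<in> M \<rightarrow>\<^sub>M borel \<Otimes>\<^sub>M borel" by measurable
  from measurable_compose[OF this F] show ?thesis by simp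
qed

lemma flag_density_homogeneous:
  "flag_density F \<Longrightarrow> a \<noteq> 0 \<Longrightarrow> c \<noteq> 0 \<Longrightarrow> F (a *\<^sub>R x) (b *\<^sub>R x + c *\<^sub>R y) = ennreal (sqrt \<bar>c / a\<bar>) * F x y"
  by (simp add: flag_density_def)

lemma flag_density_scale:
  assumes "flag_density F" "a \<noteq> 0" "c \<noteq> 0"
  shows "F (a *\<^sub>R x) (c *\<^sub>R y) = ennreal (sqrt \<bar>c / a\<bar>) * F x y"
  using flag_density_homogeneous[OF assms, of x 0 y] by simp

lemma flag_density_dependent: "flag_density F \<Longrightarrow> cross3 x y = 0 \<Longrightarrow> F x y = 0"
  by (simp add: flag_density_def)

lemma fibre_dependent:
  assumes "flag_density F" "cross3 u v = 0"
  shows "fibre_energy F u v = 0"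
proof -
  have "F (u + t *\<^sub>R v) v = 0" for t
    using assms(2) by (intro flag_density_dependent[OF assms(1)]) (simp add: cross_add_left cross_mult_left)
  then show ?thesis by (simp add: fibre_energy_def)
qed

lemma fibre_shear_left:
  assumes "flag_density F"
  shows "fibre_energy F (u + s *\<^sub>R v) v = fibre_energy F u v"
proof -
  have [measurable]: "(\<lambda>t. F (u + t *\<^sub>R v) v) \<in> borel_measurable borel"
    by (rule flag_density_measurable[OF assms]) simp_all
  show ?thesis
    using nn_integral_lborel_shift[of "\<lambda>t. (F (u + t *\<^sub>R v) v)\<^sup>2" s]
    by (simp add: fibre_energy_def scaleR_add_left add.assoc)
qed

lemma ennreal_sqrt_power2: "0 \<le> r \<Longrightarrow> (ennreal (sqrt r))\<^sup>2 = ennreal r"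
  by (simp add: ennreal_power)

lemma fibre_scale:
  assumes F: "flag_density F" and ac: "a \<noteq> 0" "c \<noteq> 0"
  shows "fibre_energy F (a *\<^sub>R u) (c *\<^sub>R v) = fibre_energy F u v"
proof -
  have [measurable]: "(\<lambda>t. F (u + t *\<^sub>R v) v) \<in> borel_measurable borel"
    by (rule flag_density_measurable[OF F]) simp_all
  have "F (a *\<^sub>R u + t *\<^sub>R (c *\<^sub>R v)) (c *\<^sub>R v) = ennreal (sqrt \<bar>c / a\<bar>) * F (u + (0 + (c / a) *\<^sub>R t) *\<^sub>R v) v" for t
    using flag_density_scale[OF F ac, of "u + (c / a * t) *\<^sub>R v" v] ac
    by (simp add: scaleR_add_right mult.commute)
  then have "fibre_energy F (a *\<^sub>R u) (c *\<^sub>R v) = ennreal \<bar>c / a\<bar> * (\<integral>\<^sup>+t. (F (u + (0 + (c / a) *\<^sub>R t) *\<^sub>R v) v)\<^sup>2 \<partial>lborel)"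
    unfolding fibre_energy_def by (simp add: power_mult_distrib ennreal_sqrt_power2 nn_integral_cmult)
  also have "\<dots> = fibre_energy F u v"
    using nn_integral_lborel_affine[of "\<lambda>t. (F (u + t *\<^sub>R v) v)\<^sup>2" "c / a" 0] ac
    by (simp add: fibre_energy_def)
  finally show ?thesis .
qed

text \<open>
  The change of chart from \<open>u + t v\<close> to \<open>v + s u\<close> is \<open>s = 1 / t\<close>; the factor \<open>1 / t\<^sup>2\<close> from the
  substitution is what the homogeneity of \<open>F\<close> produces.
\<close>

lemma fibre_swap:
  assumes F: "flag_density F"
  shows "fibre_energy F v u = fibre_energy F u v"
proof -
  have [measurable]: "(\<lambda>t. F (x + t *\<^sub>R y) y) \<in> borel_measurable borel" for x y
    by (rule flag_density_measurable[OF F]) simp_all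
  have *: "(F (v + (- 1 / t) *\<^sub>R u) u)\<^sup>2 * ennreal (1 / t\<^sup>2) = (F (u + t *\<^sub>R (- v)) (- v))\<^sup>2" if "t \<noteq> 0" for t
  proof -
    have 1: "u + t *\<^sub>R (- v) = (- t) *\<^sub>R (v + (- 1 / t) *\<^sub>R u)"
      using that by (simp add: algebra_simps)
    have 2: "- v = (- 1) *\<^sub>R (v + (- 1 / t) *\<^sub>R u) + (- 1 / t) *\<^sub>R u"
      by (simp add: algebra_simps)
    have "F (u + t *\<^sub>R (- v)) (- v) = ennreal (sqrt \<bar>(- 1 / t) / (- t)\<bar>) * F (v + (- 1 / t) *\<^sub>R u) u"
      unfolding 1 by (subst 2, rule flag_density_homogeneous[OF F]) (use that in auto)
    moreover have "\<bar>(- 1 / t) / (- t)\<bar> = 1 / t\<^sup>2"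
      by (simp add: power2_eq_square)
    ultimately show ?thesis
      by (simp only: power_mult_distrib ennreal_sqrt_power2 zero_le_divide_1_iff zero_le_power2 mult.commute)
  qed
  have "fibre_energy F v u = (\<integral>\<^sup>+t. (F (v + (- 1 / t) *\<^sub>R u) u)\<^sup>2 * ennreal (1 / t\<^sup>2) \<partial>lborel)"
    using nn_integral_neg_inverse[of "\<lambda>t. (F (v + t *\<^sub>R u) u)\<^sup>2"] by (simp add: fibre_energy_def)
  also have "\<dots> = fibre_energy F u (- v)"
    unfolding fibre_energy_def
    by (rule nn_integral_cong_AE, rule eventually_mono[OF AE_lborel_singleton[of 0]]) (rule *)
  also have "\<dots> = fibre_energy F u v"
    using fibre_scale[OF F, of 1 "-1" u v] by simp
  finally show ?thesis .
qed

lemma fibre_shear_right: "flag_density F \<Longrightarrow> fibre_energy F u (v + s *\<^sub>R u) = fibre_energy F u v"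
  by (metis fibre_swap fibre_shear_left)

lemma fibre_add_diff:
  assumes F: "flag_density F"
  shows "fibre_energy F (u + v) (u - v) = fibre_energy F u v"
proof -
  have "fibre_energy F (u + v) (u - v) = fibre_energy F (u + v) ((-2) *\<^sub>R v)"
    using fibre_shear_right[OF F, of "u + v" "(-2) *\<^sub>R v" 1] by (simp add: scaleR_2 algebra_simps)
  also have "\<dots> = fibre_energy F (u + v) v"
    using fibre_scale[OF F, of 1 "-2" "u + v" v] by simp
  also have "\<dots> = fibre_energy F u v"
    using fibre_shear_left[OF F, of u 1 v] by simp
  finally show ?thesis .
qed

section \<open>Stretches of a plane\<close>

definition orthonormal :: "real^3 \<Rightarrow> real^3 \<Rightarrow> bool"
  where "orthonormal u v \<longleftrightarrow> norm u = 1 \<and> norm v = 1 \<and> u \<bullet> v = 0"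

lemma orthonormal_inner:
  assumes "orthonormal u v"
  shows "u \<bullet> u = 1" "v \<bullet> v = 1" "u \<bullet> v = 0" "v \<bullet> u = 0"
  using assms by (simp_all add: orthonormal_def dot_square_norm inner_commute)

lemma norm_orthonormal_combination:
  assumes "orthonormal u v"
  shows "norm (a *\<^sub>R u + b *\<^sub>R v) = sqrt (a\<^sup>2 + b\<^sup>2)"
  unfolding norm_eq_sqrt_inner
  by (simp add: inner_add_left inner_add_right orthonormal_inner[OF assms] power2_eq_square)

lemma orthonormal_basis_of_plane:
  assumes "cross3 u v \<noteq> 0"
  obtains p q where "orthonormal p q" "\<And>F. flag_density F \<Longrightarrow> fibre_energy F u v = fibre_energy F p q"
proof -
  have v: "v \<noteq> 0" using assms by auto
  define s where "s = - (u \<bullet> v) / (v \<bullet> v)"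
  define w where "w = u + s *\<^sub>R v"
  have w: "w \<noteq> 0"
  proof
    assume "w = 0"
    then have "cross3 w v = 0" by simp
    with assms show False by (simp add: w_def cross_add_left cross_mult_left)
  qed
  have "w \<bullet> v = 0" using v by (simp add: w_def s_def inner_add_left inner_diff_left)
  then have on: "orthonormal ((1 / norm w) *\<^sub>R w) ((1 / norm v) *\<^sub>R v)"
    using v w by (simp add: orthonormal_def)
  have "fibre_energy F u v = fibre_energy F ((1 / norm w) *\<^sub>R w) ((1 / norm v) *\<^sub>R v)" if F: "flag_density F" for F
    using fibre_scale[OF F, of "1 / norm w" "1 / norm v" w v] fibre_shear_left[OF F, of u s v] v w
    by (simp add: w_def)
  with on that show ?thesis by blast
qed

definition outer :: "real^3 \<Rightarrow> real^3 \<Rightarrow> real^3^3"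
  where "outer a b = (\<chi> i j. a $ i * b $ j)"

lemma outer_mult: "outer a b *v x = (b \<bullet> x) *\<^sub>R a"
  by (simp add: outer_def matrix_vector_mult_def vec_eq_iff inner_vec_def sum_distrib_left mult_ac)

text \<open>
  For orthonormal \<open>u\<close>, \<open>v\<close>: multiply \<open>u\<close> by \<open>l\<close>, \<open>v\<close> by \<open>1 / l\<close>, and fix the normal of their plane.
\<close>

definition stretch :: "real \<Rightarrow> real^3 \<Rightarrow> real^3 \<Rightarrow> real^3^3"
  where "stretch l u v = mat 1 + (l - 1) *\<^sub>R outer u u + (1 / l - 1) *\<^sub>R outer v v"

lemma stretch_mult: "stretch l u v *v x = x + ((l - 1) * (u \<bullet> x)) *\<^sub>R u + ((1 / l - 1) * (v \<bullet> x)) *\<^sub>R v"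
  by (simp add: stretch_def matrix_vector_mult_add_rdistrib scaleR_matrix_vector_assoc[symmetric] outer_mult)

lemma stretch_combination:
  assumes "orthonormal u v"
  shows "stretch l u v *v (a *\<^sub>R u + b *\<^sub>R v) = (l * a) *\<^sub>R u + (b / l) *\<^sub>R v"
  unfolding stretch_mult by (simp add: inner_add_right orthonormal_inner[OF assms] algebra_simps)

lemma stretch_inverse:
  assumes "orthonormal u v" "l \<noteq> 0"
  shows "stretch l v u ** stretch l u v = mat 1"
proof -
  have "stretch l v u *v (stretch l u v *v x) = x" for x
  proof -
    have 1: "(1 / l - 1) * (l * c) = - ((l - 1) * c)" "(l - 1) * (c / l) = - ((1 / l - 1) * c)" for c
      using assms(2) by (simp_all add: field_simps)
    have 2: "u \<bullet> (stretch l u v *v x) = l * (u \<bullet> x)" "v \<bullet> (stretch l u v *v x) = (v \<bullet> x) / l"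
      by (simp_all add: stretch_mult inner_add_right inner_diff_right orthonormal_inner[OF assms(1)] field_simps)
    show ?thesis
      unfolding stretch_mult[of l v u] 2 1 by (simp add: stretch_mult)
  qed
  then show ?thesis by (simp add: matrix_eq flip: matrix_vector_mul_assoc)
qed

lemma orthonormal_commute: "orthonormal u v \<Longrightarrow> orthonormal v u"
  by (simp add: orthonormal_def inner_commute)

definition diag_plus :: "real^3 \<Rightarrow> real^3 \<Rightarrow> real^3"
  where "diag_plus u v = (1 / sqrt 2) *\<^sub>R (u + v)"
definition diag_minus :: "real^3 \<Rightarrow> real^3 \<Rightarrow> real^3"
  where "diag_minus u v = (1 / sqrt 2) *\<^sub>R (u - v)"

lemma orthonormal_diag:
  assumes "orthonormal u v"
  shows "orthonormal (diag_plus u v) (diag_minus u v)"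
  using norm_orthonormal_combination[OF assms, of 1 1] norm_orthonormal_combination[OF assms, of 1 "-1"]
  by (simp add: orthonormal_def diag_plus_def diag_minus_def inner_add_left inner_diff_right orthonormal_inner[OF assms])

text \<open>
  The stretches along the two axes and the two diagonals of the basis \<open>u\<close>, \<open>v\<close>. The set is
  closed under inverses, and its four directions are equally spaced modulo \<open>\<pi>\<close>, which is what makes the
  sum in \<open>sum_inverse_sqrt_le\<close> independent of the direction to leading order.
\<close>

definition stretches :: "real \<Rightarrow> real^3 \<Rightarrow> real^3 \<Rightarrow> nat \<Rightarrow> real^3^3"
  where "stretches l u v i =
    (if i = 0 then stretch l u v else if i = 1 then stretch l v u
     else if i = 2 then stretch l (diag_plus u v) (diag_minus u v)
     else stretch l (diag_minus u v) (diag_plus u v))"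

text \<open>
  The index of the inverse stretch.
\<close>

definition opposite :: "nat \<Rightarrow> nat"
  where "opposite i = (if i = 0 then 1 else if i = 1 then 0 else if i = 2 then 3 else 2)"

lemma less_4_cases: "i < 4 \<Longrightarrow> i = 0 \<or> i = 1 \<or> i = 2 \<or> i = (3::nat)"
  by auto

lemma sum_less_4: "(\<Sum>i<4. f i) = f 0 + f 1 + f 2 + (f (3::nat) :: 'a::comm_monoid_add)"
  by (simp add: eval_nat_numeral add_ac)

lemma sum_opposite: "(\<Sum>i<4. f (opposite i)) = (\<Sum>i<4. f i :: 'a::comm_monoid_add)"
  by (simp add: sum_less_4 opposite_def add_ac)

lemma stretches_opposite:
  assumes "orthonormal u v" "l \<noteq> 0" "i < 4"
  shows "stretches l u v (opposite i) ** stretches l u v i = mat 1"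
  using less_4_cases[OF assms(3)] stretch_inverse[OF assms(1,2)] stretch_inverse[OF orthonormal_commute[OF assms(1)] assms(2)]
    stretch_inverse[OF orthonormal_diag[OF assms(1)] assms(2)] stretch_inverse[OF orthonormal_commute[OF orthonormal_diag[OF assms(1)]] assms(2)]
  by (auto simp: opposite_def stretches_def)

lemma fibre_diag:
  assumes F: "flag_density F"
  shows "fibre_energy F (A *v diag_plus u v) (A *v diag_minus u v) = fibre_energy F (A *v u) (A *v v)"
  using fibre_scale[OF F, of "1 / sqrt 2" "1 / sqrt 2" "A *v u + A *v v" "A *v u - A *v v"]
  by (simp add: diag_plus_def diag_minus_def matrix_vector_mult_scaleR fibre_add_diff[OF F]
      matrix_vector_right_distrib matrix_vector_mult_diff_distrib)

lemma fibre_stretch: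
  assumes F: "flag_density F" and on: "orthonormal u v" and l: "l \<noteq> 0"
  shows "fibre_energy F (stretch l u v *v u) (stretch l u v *v v) = fibre_energy F u v"
  using fibre_scale[OF F l, of "1 / l" u v] l stretch_combination[OF on, of l 1 0] stretch_combination[OF on, of l 0 1]
  by simp

lemma fibre_stretches:
  assumes F: "flag_density F" and on: "orthonormal u v" and l: "l \<noteq> 0" and i: "i < 4"
  shows "fibre_energy F (stretches l u v i *v u) (stretches l u v i *v v) = fibre_energy F u v"
proof -
  note on' = orthonormal_diag[OF on]
  have "fibre_energy F (stretch l v u *v u) (stretch l v u *v v) = fibre_energy F u v"
    using fibre_stretch[OF F orthonormal_commute[OF on] l] by (metis fibre_swap[OF F])
  moreover have "fibre_energy F (stretch l (diag_plus u v) (diag_minus u v) *v u) (stretch l (diag_plus u v) (diag_minus u v) *v v) = fibre_energy F u v"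
    using fibre_stretch[OF F on' l] fibre_diag[OF F] fibre_diag[OF F, of "mat 1"] by simp
  moreover have "fibre_energy F (stretch l (diag_minus u v) (diag_plus u v) *v u) (stretch l (diag_minus u v) (diag_plus u v) *v v) = fibre_energy F u v"
    using fibre_stretch[OF F orthonormal_commute[OF on'] l] fibre_diag[OF F] fibre_diag[OF F, of "mat 1"]
    by (simp add: fibre_swap[OF F, of "_ *v diag_minus u v"] fibre_swap[OF F, of "diag_minus u v"])
  ultimately show ?thesis
    using less_4_cases[OF i] fibre_stretch[OF F on l] by (auto simp: stretches_def)
qed

text \<open>
  The Taylor polynomial of order two has the coefficient \<open>3/8\<close>; the slightly larger \<open>2/5\<close> absorbs
  the remainder near \<open>1\<close>.
\<close>

lemma inverse_sqrt_le_quadratic: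
  assumes "93/100 \<le> y"
  shows "1 / sqrt y \<le> 1 - (y - 1) / 2 + 2/5 * (y - 1)\<^sup>2"
proof -
  define e where "e = sqrt y - 1"
  have "241/250 \<le> sqrt y" using assms by (intro real_le_rsqrt) (simp add: power2_eq_square)
  then have e: "- (9/250) \<le> e" by (simp add: e_def)
  have "sqrt y = 1 + e" by (simp add: e_def)
  then have y: "y = (1 + e)\<^sup>2" 
    using real_sqrt_pow2[of y] assms by simp
  have "0 \<le> e\<^sup>2 * (1/10 + 27/10 * e + 2 * e\<^sup>2 + 2/5 * e ^ 3)"
  proof (intro mult_nonneg_nonneg)
    have "2/5 * e ^ 3 + 2 * e\<^sup>2 = e\<^sup>2 * (2 + 2/5 * e)" by (simp add: power2_eq_square power3_eq_cube algebra_simps)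
    moreover have "\<dots> \<ge> 0" using e by (intro mult_nonneg_nonneg) auto
    ultimately show "0 \<le> 1/10 + 27/10 * e + 2 * e\<^sup>2 + 2/5 * e ^ 3" using e by linarith
  qed simp
  also have "\<dots> = (1 + e) * (1 - (y - 1) / 2 + 2/5 * (y - 1)\<^sup>2) - 1"
    unfolding y by (simp add: power2_eq_square power3_eq_cube field_simps)
  finally show ?thesis
    using e \<open>sqrt y = 1 + e\<close> by (simp add: divide_le_eq mult.commute)
qed

text \<open>
  The squared lengths of the four images of a unit vector are \<open>C \<plusminus> S z\<close> and \<open>C \<plusminus> S w\<close>, where
  \<open>C\<^sup>2 - S\<^sup>2 = 1\<close> and \<open>(z, w)\<close> is the unit vector with the doubled angle. The terms linear in \<open>S\<close>
  cancel, and \<open>z\<^sup>2 + w\<^sup>2 = 1\<close> removes the angle from the quadratic ones, leaving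
  a saving proportional to \<open>C - 1\<close>.
\<close>

lemma sum_inverse_sqrt_le:
  fixes l a b :: real
  assumes d: "0 < d" "d \<le> 1 / 40" and l: "l = 1 + d" and ab: "a\<^sup>2 + b\<^sup>2 = 1"
  defines "p \<equiv> (a + b) / sqrt 2" and "q \<equiv> (a - b) / sqrt 2"
  shows "1 / sqrt ((l * a)\<^sup>2 + (b / l)\<^sup>2) + 1 / sqrt ((l * b)\<^sup>2 + (a / l)\<^sup>2)
    + 1 / sqrt ((l * p)\<^sup>2 + (q / l)\<^sup>2) + 1 / sqrt ((l * q)\<^sup>2 + (p / l)\<^sup>2) \<le> 4 * (1 - d\<^sup>2 / 10)"
proof -
  define m where "m = l\<^sup>2"
  define C where "C = (m + 1 / m) / 2"
  define S where "S = (m - 1 / m) / 2"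
  have m: "1 + 2 * d \<le> m" "m \<le> 53/50" 
    using d mult_mono[of d "1/40" d "1/40"] by (simp_all add: m_def l power2_eq_square algebra_simps)
  then have m0: "0 < m" using d by linarith
  define z where "z = a\<^sup>2 - b\<^sup>2"
  define w where "w = 2 * a * b"
  have zw: "z\<^sup>2 + w\<^sup>2 = 1"
  proof -
    have "z\<^sup>2 + w\<^sup>2 = (a\<^sup>2 + b\<^sup>2)\<^sup>2" by (simp add: z_def w_def power2_eq_square algebra_simps)
    then show ?thesis by (simp add: ab)
  qed
  have CS: "S\<^sup>2 = (C - 1) * (C + 1)" using m0
    by (simp add: C_def S_def power2_eq_square field_simps)
  have C1: "C - 1 = (m - 1)\<^sup>2 / (2 * m)" using m0 by (simp add: C_def power2_eq_square field_simps)
  have C1_le: "C - 1 \<le> 1/100"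
  proof -
    have "(m - 1)\<^sup>2 \<le> (3/50)\<^sup>2" using m d by (intro power_mono) auto
    then show ?thesis unfolding C1 using m d m0 by (simp add: divide_le_eq power2_eq_square)
  qed
  have C1_ge: "8/5 * d\<^sup>2 \<le> C - 1"
  proof -
    have "(2 * d)\<^sup>2 \<le> (m - 1)\<^sup>2" using m d by (intro power_mono) auto
    then have "4 * d\<^sup>2 \<le> (m - 1)\<^sup>2" by (simp add: power_mult_distrib)
    moreover have "d\<^sup>2 * m \<le> d\<^sup>2 * (53 / 50)" using m by (intro mult_left_mono) auto
    ultimately have "8/5 * d\<^sup>2 * (2 * m) \<le> (m - 1)\<^sup>2"
      using zero_le_power2[of d] by linarith
    then show ?thesis unfolding C1 using m0 by (simp only: le_divide_eq) simp
  qed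
  have pq: "p\<^sup>2 = (1 + w) / 2" "q\<^sup>2 = (1 - w) / 2" and ab2: "a\<^sup>2 = (1 + z) / 2" "b\<^sup>2 = (1 - z) / 2"
    using ab by (simp_all add: p_def q_def w_def z_def power_divide power2_sum power2_diff field_simps)
  have y: "(l * a)\<^sup>2 + (b / l)\<^sup>2 = C + S * z" "(l * b)\<^sup>2 + (a / l)\<^sup>2 = C - S * z"
    "(l * p)\<^sup>2 + (q / l)\<^sup>2 = C + S * w" "(l * q)\<^sup>2 + (p / l)\<^sup>2 = C - S * w"
    using m0 unfolding power_mult_distrib power_divide pq ab2 m_def[symmetric] C_def S_def
    by (simp_all add: field_simps)
  have lower: "93/100 \<le> C + S * t" if "\<bar>t\<bar> \<le> 1" for t
  proof -
    have S0: "0 \<le> S" unfolding S_def using m d m0 by (simp add: divide_le_eq) (smt (verit) mult_le_cancel_right1 mult_less_cancel_right1)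
    have "S * (- 1) \<le> S * t" using S0 that by (intro mult_left_mono) auto
    moreover have "C - S = 1 / m" by (simp add: C_def S_def field_simps)
    moreover have "93/100 \<le> 1 / m" using m m0 by (simp add: le_divide_eq)
    ultimately show ?thesis by linarith
  qed
  have "\<bar>z\<bar> \<le> 1" "\<bar>w\<bar> \<le> 1" using zw by (simp_all add: abs_square_le_1[symmetric]) (smt (verit) zero_le_power2)+
  note y4 = this lower[of z] lower[of "- z"] lower[of w] lower[of "- w"]
  have "1 / sqrt (C + S * z) + 1 / sqrt (C - S * z) + 1 / sqrt (C + S * w) + 1 / sqrt (C - S * w)
    \<le> 4 - 2 * (C - 1) + 2/5 * (4 * (C - 1)\<^sup>2 + 2 * S\<^sup>2 * (z\<^sup>2 + w\<^sup>2))"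
  proof -
    let ?f = "\<lambda>y. 1 - (y - 1) / 2 + 2/5 * (y - 1)\<^sup>2"
    have "1 / sqrt (C + S * z) + 1 / sqrt (C - S * z) + 1 / sqrt (C + S * w) + 1 / sqrt (C - S * w)
      \<le> ?f (C + S * z) + ?f (C - S * z) + ?f (C + S * w) + ?f (C - S * w)"
      using y4 by (intro add_mono inverse_sqrt_le_quadratic) auto
    also have "\<dots> = 4 - 2 * (C - 1) + 2/5 * (4 * (C - 1)\<^sup>2 + 2 * S\<^sup>2 * (z\<^sup>2 + w\<^sup>2))"
      by (simp add: power2_eq_square algebra_simps add_divide_distrib diff_divide_distrib)
    finally show ?thesis .
  qed
  also have "\<dots> = 4 - (C - 1) * (2/5 - 12/5 * (C - 1))"
    unfolding zw CS by (simp add: power2_eq_square field_simps)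
  also have "\<dots> \<le> 4 - (8/5 * d\<^sup>2) * (3/10)"
  proof -
    have "0 \<le> C - 1" unfolding C1 using m0 by simp
    then show ?thesis
      using C1_ge C1_le by (intro diff_left_mono mult_mono) auto
  qed
  also have "\<dots> \<le> 4 * (1 - d\<^sup>2 / 10)" by simp
  finally show ?thesis unfolding y .
qed

lemma stretches_weight_le:
  assumes on: "orthonormal u v" and d: "0 < d" "d \<le> 1 / 40"
    and x: "x = a *\<^sub>R u + b *\<^sub>R v" "x \<noteq> 0"
  shows "(\<Sum>i<4. 1 / norm (stretches (1 + d) u v i *v x)) \<le> 4 * (1 - d\<^sup>2 / 10) / norm x"
proof -
  define l where "l = 1 + d"
  define n where "n = norm x"
  have n: "0 < n" using x by (simp add: n_def)
  define a' b' where "a' = a / n" and "b' = b / n"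
  define y where "y = (1 / n) *\<^sub>R x"
  have y: "y = a' *\<^sub>R u + b' *\<^sub>R v"
    by (simp add: y_def x a'_def b'_def scaleR_add_right)
  have "norm y = 1" using n by (simp add: y_def n_def)
  note y1 = this
  then have ab: "a'\<^sup>2 + b'\<^sup>2 = 1"
    unfolding y norm_orthonormal_combination[OF on] by simp
  have xy: "x = n *\<^sub>R y" using n by (simp add: y_def)
  define p q where "p = (a' + b') / sqrt 2" and "q = (a' - b') / sqrt 2"
  have y': "y = p *\<^sub>R diag_plus u v + q *\<^sub>R diag_minus u v"
  proof -
    have pq: "p * (1 / sqrt 2) = (a' + b') / 2" "q * (1 / sqrt 2) = (a' - b') / 2"
      by (simp_all add: p_def q_def)
    show ?thesis
      unfolding y diag_plus_def diag_minus_def scaleR_scaleR pq by (simp add: vec_eq_iff field_simps)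
  qed
  note on' = orthonormal_diag[OF on]
  have st: "norm (stretch l e f *v y) = sqrt ((l * s)\<^sup>2 + (t / l)\<^sup>2)"
    if "orthonormal e f" "y = s *\<^sub>R e + t *\<^sub>R f" for e f s t
    unfolding that(2) stretch_combination[OF that(1)] norm_orthonormal_combination[OF that(1)] ..
  have "(\<Sum>i<4. 1 / norm (stretches l u v i *v y)) \<le> 4 * (1 - d\<^sup>2 / 10)"
    using sum_inverse_sqrt_le[OF d l_def ab] st[OF on y] st[OF on' y']
      st[OF orthonormal_commute[OF on], of b' a'] st[OF orthonormal_commute[OF on'], of q p]
    by (simp add: sum_less_4 stretches_def p_def[symmetric] q_def[symmetric] y[symmetric] y'[symmetric] add.commute[of _ "_ *\<^sub>R u"] add.commute[of _ "_ *\<^sub>R diag_plus u v"])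
  then have "(\<Sum>i<4. 1 / norm (stretches l u v i *v y)) / n \<le> 4 * (1 - d\<^sup>2 / 10) / n"
    using n by (intro divide_right_mono) auto
  then show ?thesis
    using n by (simp add: xy matrix_vector_mult_scaleR sum_divide_distrib l_def mult.commute y_def[symmetric]) (simp add: n_def y1)
qed

section \<open>Averaging over four stretches\<close>

lemma sum_power2_le_ennreal:
  fixes f g :: "nat \<Rightarrow> ennreal"
  shows "(\<Sum>i<n. f i * g i)\<^sup>2 \<le> (\<Sum>i<n. (f i)\<^sup>2) * (\<Sum>i<n. (g i)\<^sup>2)"
  using Cauchy_Schwarz_nn_integral[of f "count_space {..<n}" g]
  by (simp add: nn_integral_count_space_finite)

text \<open>
  Schur's test. By Cauchy-Schwarz with weights \<open>|g\<^sub>i x|\<close>, the square of the average is at most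
  \<open>(1 - d\<^sup>2/10) / 4\<close> times the sum of the squares weighted by \<open>|g\<^sub>i x| / |x|\<close>. Each weighted square is
  the energy density of a half-density \<open>H\<^sub>i\<close> moved by \<open>g\<^sub>i\<close>, so that \<open>g\<^sub>i\<close> can be removed from the integral;
  the weight becomes \<open>|x| / |g\<^sub>i\<^sup>-\<^sup>1 x|\<close>, and summing these weights uses the same inequality again
  because the inverses are the same four maps.
\<close>

lemma fibre_stretch_average_le:
  assumes F: "flag_density F" and on: "orthonormal u v" and d: "0 < d" "d \<le> 1 / 40"
  defines "g \<equiv> stretches (1 + d) u v"
  shows "(\<integral>\<^sup>+t. ((\<Sum>i<4. F (g i *v (u + t *\<^sub>R v)) (g i *v v)) / 4)\<^sup>2 \<partial>lborel)
    \<le> ennreal ((1 - d\<^sup>2 / 10)\<^sup>2) * fibre_energy F u v"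
proof -
  define r where "r = 1 - d\<^sup>2 / 10"
  have "d\<^sup>2 \<le> (1/40)\<^sup>2" using d by (intro power_mono) auto
  then have r: "0 \<le> r" by (simp add: r_def power2_eq_square)
  define h where "h i = g (opposite i)" for i
  have l: "1 + d \<noteq> 0" using d by simp
  have hg: "h i *v (g i *v x) = x" if "i < 4" for i x
    using stretches_opposite[OF on l that] by (simp add: h_def g_def matrix_vector_mul_assoc)
  have gh: "g i *v (h i *v x) = x" if "i < 4" for i x
    using hg[OF that] by (metis matrix_left_right_inverse matrix_vector_mul_assoc matrix_vector_mul_lid matrix_eq)
  define x where "x t = u + t *\<^sub>R v" for t
  have x0: "x t \<noteq> 0" for t
    using norm_orthonormal_combination[OF on, of 1 t] by (auto simp: x_def add_nonneg_eq_0_iff)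
  have g0: "0 < norm (g i *v x t)" if "i < 4" for i t
    using hg[OF that, of "x t"] x0[of t] by (metis matrix_vector_mult_0_right zero_less_norm_iff)
  have h0: "0 < norm (h i *v x t)" if "i < 4" for i t
    using gh[OF that, of "x t"] x0[of t] by (metis matrix_vector_mult_0_right zero_less_norm_iff)
  have weight: "(\<Sum>i<4. 1 / norm (g i *v x t)) \<le> 4 * r / norm (x t)" for t
    using stretches_weight_le[OF on d, of "x t" 1 t] x0 by (simp add: g_def r_def x_def)
  define H where "H i y z = F y z * ennreal (sqrt (norm y / norm (h i *v y)))" for i y z
  have H: "flag_density (H i)" for i
    unfolding flag_density_def
  proof (intro conjI allI impI)
    have [measurable]: "(\<lambda>p. F (fst p) (snd p)) \<in> borel_measurable (borel \<Otimes>\<^sub>M borel)"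
      using F by (simp add: flag_density_def)
    show "(\<lambda>p. H i (fst p) (snd p)) \<in> borel_measurable (borel \<Otimes>\<^sub>M borel)"
      unfolding H_def by measurable
    fix a b c :: real and y z :: "real^3"
    show "H i y z = 0" if "cross3 y z = 0"
      using flag_density_dependent[OF F that] by (simp add: H_def)
    assume "a \<noteq> 0" "c \<noteq> 0"
    then show "H i (a *\<^sub>R y) (b *\<^sub>R y + c *\<^sub>R z) = ennreal (sqrt \<bar>c / a\<bar>) * H i y z"
      using flag_density_homogeneous[OF F, of a c y b z]
      by (simp add: H_def matrix_vector_mult_scaleR mult.assoc)
  qed
  have pointwise: "((\<Sum>i<4. F (g i *v x t) (g i *v v)) / 4)\<^sup>2
      \<le> ennreal (r / 4) * (\<Sum>i<4. (H i (g i *v x t) (g i *v v))\<^sup>2)" for t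
  proof -
    define a where "a i = F (g i *v x t) (g i *v v)" for i
    define w where "w i = norm (g i *v x t)" for i
    have w: "0 < w i" if "i < 4" for i using g0[OF that] by (simp add: w_def)
    have "(\<Sum>i<4. a i) = (\<Sum>i<4. (a i * ennreal (sqrt (w i))) * ennreal (sqrt (1 / w i)))"
    proof (intro sum.cong refl)
      fix i :: nat assume "i \<in> {..<4}"
      then have "0 < w i" using w by simp
      then have "ennreal (sqrt (w i)) * ennreal (sqrt (1 / w i)) = 1"
        by (simp add: real_sqrt_divide flip: ennreal_mult)
      then show "a i = a i * ennreal (sqrt (w i)) * ennreal (sqrt (1 / w i))"
        by (simp add: mult.assoc)
    qed
    also have "\<dots>\<^sup>2 \<le> (\<Sum>i<4. (a i * ennreal (sqrt (w i)))\<^sup>2) * (\<Sum>i<4. (ennreal (sqrt (1 / w i)))\<^sup>2)"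
      by (rule sum_power2_le_ennreal)
    also have "(\<Sum>i<4. (ennreal (sqrt (1 / w i)))\<^sup>2) = ennreal (\<Sum>i<4. 1 / w i)"
      using w by (subst sum_ennreal[symmetric]) (auto simp: ennreal_sqrt_power2 less_imp_le intro!: sum.cong)
    also have "\<dots> \<le> ennreal (4 * r / norm (x t))"
      using weight by (intro ennreal_leI) (simp add: w_def)
    also have "(\<Sum>i<4. (a i * ennreal (sqrt (w i)))\<^sup>2) * ennreal (4 * r / norm (x t))
      = ennreal (4 * r) * (\<Sum>i<4. (H i (g i *v x t) (g i *v v))\<^sup>2)"
    proof -
      have "(a i * ennreal (sqrt (w i)))\<^sup>2 * ennreal (4 * r / norm (x t))
        = ennreal (4 * r) * (H i (g i *v x t) (g i *v v))\<^sup>2" if "i < 4" for i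
      proof -
        have "ennreal (w i) * ennreal (4 * r / norm (x t)) = ennreal (4 * r) * ennreal (w i / norm (x t))"
          using w[OF that] r by (simp flip: ennreal_mult)
        then show ?thesis
          using w[OF that]
          by (simp add: H_def a_def hg[OF that] power_mult_distrib ennreal_sqrt_power2 mult.assoc mult.left_commute flip: w_def)
      qed
      then show ?thesis
        by (simp add: sum_distrib_right sum_distrib_left)
    qed
    finally have *: "(\<Sum>i<4. a i)\<^sup>2 \<le> ennreal (4 * r) * (\<Sum>i<4. (H i (g i *v x t) (g i *v v))\<^sup>2)"
      by (simp add: mult_left_mono)
    have "((\<Sum>i<4. a i) / 4)\<^sup>2 = ennreal (1 / 16) * (\<Sum>i<4. a i)\<^sup>2"
    proof -
      have "inverse (4::ennreal) = ennreal (1 / 4)"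
        by (metis divide_ennreal_def ennreal_numeral inverse_ennreal inverse_eq_divide zero_less_numeral)
      moreover have "(ennreal (1 / 4))\<^sup>2 = ennreal (1 / 16)"
        by (subst ennreal_power) (simp_all add: power2_eq_square)
      ultimately show ?thesis by (simp add: divide_ennreal_def power_mult_distrib mult.commute)
    qed
    also have "\<dots> \<le> ennreal (1 / 16) * (ennreal (4 * r) * (\<Sum>i<4. (H i (g i *v x t) (g i *v v))\<^sup>2))"
      using * by (rule mult_left_mono) simp
    also have "\<dots> = ennreal (r / 4) * (\<Sum>i<4. (H i (g i *v x t) (g i *v v))\<^sup>2)"
      using r by (simp add: mult.assoc[symmetric] flip: ennreal_mult)
    finally show ?thesis by (simp add: a_def)
  qed
  have [measurable]: "(\<lambda>t. H i (A *v x t) (A *v v)) \<in> borel_measurable borel" for i A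
    by (rule flag_density_measurable[OF H]) (simp_all add: x_def)
  have [measurable]: "(\<lambda>t. H i (x t) v) \<in> borel_measurable borel" for i
    by (rule flag_density_measurable[OF H]) (simp_all add: x_def)
  have [measurable]: "(\<lambda>t. F (x t) v) \<in> borel_measurable borel"
    by (rule flag_density_measurable[OF F]) (simp_all add: x_def)
  have "(\<integral>\<^sup>+t. ((\<Sum>i<4. F (g i *v x t) (g i *v v)) / 4)\<^sup>2 \<partial>lborel)
    \<le> (\<integral>\<^sup>+t. ennreal (r / 4) * (\<Sum>i<4. (H i (g i *v x t) (g i *v v))\<^sup>2) \<partial>lborel)"
    by (intro nn_integral_mono pointwise)
  also have "\<dots> = ennreal (r / 4) * (\<Sum>i<4. \<integral>\<^sup>+t. (H i (g i *v x t) (g i *v v))\<^sup>2 \<partial>lborel)"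
    by (simp add: nn_integral_cmult nn_integral_sum)
  also have "(\<Sum>i<4. \<integral>\<^sup>+t. (H i (g i *v x t) (g i *v v))\<^sup>2 \<partial>lborel) = (\<Sum>i<4. fibre_energy (H i) (g i *v u) (g i *v v))"
    by (simp add: fibre_energy_def x_def matrix_vector_right_distrib matrix_vector_mult_scaleR)
  also have "\<dots> = (\<Sum>i<4. fibre_energy (H i) u v)"
    unfolding g_def by (intro sum.cong refl fibre_stretches[OF H on l]) simp
  also have "\<dots> = (\<integral>\<^sup>+t. (\<Sum>i<4. (H i (x t) v)\<^sup>2) \<partial>lborel)"
    by (simp add: fibre_energy_def x_def[symmetric] nn_integral_sum)
  also have "\<dots> \<le> (\<integral>\<^sup>+t. ennreal (4 * r) * (F (x t) v)\<^sup>2 \<partial>lborel)"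
  proof (rule nn_integral_mono)
    fix t
    have "(\<Sum>i<4. (H i (x t) v)\<^sup>2) = (F (x t) v)\<^sup>2 * ennreal (\<Sum>i<4. norm (x t) / norm (h i *v x t))"
      by (simp add: H_def power_mult_distrib ennreal_sqrt_power2 sum_distrib_left flip: sum_ennreal)
    also have "\<dots> \<le> (F (x t) v)\<^sup>2 * ennreal (4 * r)"
    proof (intro mult_left_mono ennreal_leI)
      have "(\<Sum>i<4. norm (x t) / norm (h i *v x t)) = norm (x t) * (\<Sum>i<4. 1 / norm (g i *v x t))"
        unfolding h_def sum_opposite[of "\<lambda>i. norm (x t) / norm (g i *v x t)"] by (simp add: sum_distrib_left)
      also have "\<dots> \<le> 4 * r"
        using weight[of t] x0[of t] by (simp add: le_divide_eq mult.commute)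
      finally show "(\<Sum>i<4. norm (x t) / norm (h i *v x t)) \<le> 4 * r" .
    qed simp
    finally show "(\<Sum>i<4. (H i (x t) v)\<^sup>2) \<le> ennreal (4 * r) * (F (x t) v)\<^sup>2"
      by (simp add: mult.commute)
  qed
  also have "\<dots> = ennreal (4 * r) * fibre_energy F u v"
    by (simp add: nn_integral_cmult fibre_energy_def x_def[symmetric])
  also have "ennreal (r / 4) * (ennreal (4 * r) * fibre_energy F u v) = ennreal (r\<^sup>2) * fibre_energy F u v"
    using r by (simp add: mult.assoc[symmetric] power2_eq_square flip: ennreal_mult)
  finally show ?thesis
    by (simp add: x_def r_def mult_left_mono)
qed

section \<open>Right multiplication and cubes of matrices\<close>

lemma borel_measurable_matrix_vector_mult_joint [measurable (raw)]:
  fixes f :: "'a \<Rightarrow> real^'n^'m"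
  assumes "f \<in> borel_measurable M" "g \<in> borel_measurable M"
  shows "(\<lambda>x. f x *v g x) \<in> borel_measurable M"
proof -
  have "continuous_on UNIV (\<lambda>p :: (real^'n^'m) \<times> (real^'n). fst p *v snd p)"
    unfolding matrix_vector_mult_def by (intro continuous_intros)
  from borel_measurable_continuous_on[OF this measurable_Pair[OF assms, unfolded borel_prod]]
  show ?thesis by simp
qed

lemma borel_measurable_matrix_mult_joint [measurable (raw)]:
  fixes f :: "'a \<Rightarrow> real^'n^'m" and g :: "'a \<Rightarrow> real^'k^'n"
  assumes "f \<in> borel_measurable M" "g \<in> borel_measurable M"
  shows "(\<lambda>x. f x ** g x) \<in> borel_measurable M"
proof -
  have "continuous_on UNIV (\<lambda>p :: (real^'n^'m) \<times> (real^'k^'n). fst p ** snd p)"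
    unfolding matrix_matrix_mult_def by (intro continuous_intros)
  from borel_measurable_continuous_on[OF this measurable_Pair[OF assms, unfolded borel_prod]]
  show ?thesis by simp
qed

lemma borel_measurable_cof [measurable]: "cof \<in> borel_measurable borel"
proof (rule borel_measurable_continuous_onI)
  have *: "cof A = (\<chi> i. if i = 1 then cross3 (A $ 2) (A $ 3) else if i = 2 then cross3 (A $ 3) (A $ 1) else cross3 (A $ 1) (A $ 2))" for A
    by (simp add: vec_eq_iff forall_3 cof_nth)
  have "continuous_on UNIV (\<lambda>A :: real^3^3. if P then cross3 (A $ 2) (A $ 3) else if Q then cross3 (A $ 3) (A $ 1) else cross3 (A $ 1) (A $ 2))" for P Q
    by (cases P; cases Q) (auto intro!: continuous_on_cross continuous_intros)
  then show "continuous_on UNIV cof"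
    unfolding * by (intro continuous_on_vec_lambda)
qed

lemma linear_right_mult: "linear (\<lambda>M :: real^'n^'m. M ** (k :: real^'k^'n))"
  by (rule linearI) (simp_all add: matrix_matrix_mult_def vec_eq_iff algebra_simps sum.distrib sum_distrib_left)

text \<open>
  If \<open>k g k\<close> is inverse to \<open>g\<close> for an involution \<open>k\<close>, then \<open>g = k (k g)\<close> is a product of two involutions.
\<close>

lemma nn_integral_right_mult:
  fixes f :: "real^'n^'n \<Rightarrow> ennreal"
  assumes [measurable]: "f \<in> borel_measurable borel"
    and k: "k ** k = mat 1" "k ** g ** k ** g = mat 1"
  shows "(\<integral>\<^sup>+M. f (M ** g) \<partial>lborel) = (\<integral>\<^sup>+M. f M \<partial>lborel)"
proof -
  have "(\<integral>\<^sup>+M. f (M ** g) \<partial>lborel) = (\<integral>\<^sup>+M. f (M ** k ** (k ** g)) \<partial>lborel)"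
    using k(1) by (metis matrix_mul_assoc matrix_mul_rid)
  also have "\<dots> = (\<integral>\<^sup>+M. f (M ** (k ** g)) \<partial>lborel)"
    using k(1) by (intro nn_integral_lborel_linear_involution[of "\<lambda>M. f (M ** (k ** g))"] linear_right_mult)
      (simp_all flip: matrix_mul_assoc)
  also have "\<dots> = (\<integral>\<^sup>+M. f M \<partial>lborel)"
  proof (rule nn_integral_lborel_linear_involution[OF _ linear_right_mult])
    fix M
    show "M ** (k ** g) ** (k ** g) = M"
      using k(2) by (metis matrix_mul_assoc matrix_mul_rid)
  qed simp
  finally show ?thesis .
qed

text \<open>
  The reflection that exchanges the orthonormal vectors \<open>u\<close> and \<open>v\<close>; it conjugates a stretch to its inverse.
\<close>

definition swap_reflection :: "real^3 \<Rightarrow> real^3 \<Rightarrow> real^3^3"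
  where "swap_reflection u v = mat 1 - outer (u - v) (u - v)"

lemma swap_reflection_mult: "swap_reflection u v *v x = x - ((u - v) \<bullet> x) *\<^sub>R (u - v)"
  by (simp add: swap_reflection_def matrix_vector_mult_diff_rdistrib outer_mult)

lemma nn_integral_stretch:
  fixes f :: "real^3^3 \<Rightarrow> ennreal"
  assumes f: "f \<in> borel_measurable borel" and on: "orthonormal u v" and l: "l \<noteq> 0"
  shows "(\<integral>\<^sup>+M. f (M ** stretch l u v) \<partial>lborel) = (\<integral>\<^sup>+M. f M \<partial>lborel)"
proof (rule nn_integral_right_mult[OF f])
  let ?k = "swap_reflection u v"
  note on' = orthonormal_inner[OF on]
  have kk: "?k *v (?k *v x) = x" for x
    unfolding swap_reflection_mult by (simp add: inner_diff_left inner_diff_right on' algebra_simps)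
  have k: "?k *v (x + a *\<^sub>R u + b *\<^sub>R v) = ?k *v x + a *\<^sub>R v + b *\<^sub>R u" for x a b
    unfolding swap_reflection_mult by (simp add: inner_diff_left inner_diff_right inner_add_right on' algebra_simps)
  have uv: "u \<bullet> (?k *v x) = v \<bullet> x" "v \<bullet> (?k *v x) = u \<bullet> x" for x
    unfolding swap_reflection_mult by (simp_all add: inner_diff_left inner_diff_right on' algebra_simps)
  have "?k *v (stretch l u v *v x) = stretch l v u *v (?k *v x)" for x
    unfolding stretch_mult k uv ..
  then have "?k *v (stretch l u v *v (?k *v (stretch l u v *v x))) = x" for x
    using stretch_inverse[OF on l] by (simp add: kk matrix_vector_mul_assoc) (metis kk matrix_vector_mul_assoc matrix_vector_mul_lid)
  then show "?k ** stretch l u v ** ?k ** stretch l u v = mat 1"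
    by (simp add: matrix_eq flip: matrix_vector_mul_assoc)
  show "?k ** ?k = mat 1"
    by (simp add: matrix_eq kk flip: matrix_vector_mul_assoc)
qed

lemma nn_integral_stretches:
  fixes f :: "real^3^3 \<Rightarrow> ennreal"
  assumes f: "f \<in> borel_measurable borel" and on: "orthonormal u v" and l: "l \<noteq> 0"
  shows "(\<integral>\<^sup>+M. f (M ** stretches l u v i) \<partial>lborel) = (\<integral>\<^sup>+M. f M \<partial>lborel)"
  unfolding stretches_def
  using nn_integral_stretch[OF f on l] nn_integral_stretch[OF f orthonormal_commute[OF on] l]
    nn_integral_stretch[OF f orthonormal_diag[OF on] l] nn_integral_stretch[OF f orthonormal_commute[OF orthonormal_diag[OF on]] l]
  by simp

definition shear :: "real \<Rightarrow> real^3 \<Rightarrow> real^3 \<Rightarrow> real^3^3"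
  where "shear s p q = mat 1 + s *\<^sub>R outer p q"

lemma shear_mult: "shear s p q *v x = x + (s * (q \<bullet> x)) *\<^sub>R p"
  by (simp add: shear_def matrix_vector_mult_add_rdistrib scaleR_matrix_vector_assoc[symmetric] outer_mult)

lemma shear_inverse:
  assumes "orthonormal p q"
  shows "shear s p q ** shear (- s) p q = mat 1"
proof -
  have "shear s p q *v (shear (- s) p q *v x) = x" for x
    unfolding shear_mult by (simp add: inner_diff_right orthonormal_inner[OF assms] algebra_simps)
  then show ?thesis by (simp add: matrix_eq flip: matrix_vector_mul_assoc)
qed

lemma nn_integral_shear:
  fixes f :: "real^3^3 \<Rightarrow> ennreal"
  assumes f: "f \<in> borel_measurable borel" and on: "orthonormal p q"
  shows "(\<integral>\<^sup>+M. f (M ** shear s p q) \<partial>lborel) = (\<integral>\<^sup>+M. f M \<partial>lborel)"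
proof (rule nn_integral_right_mult[OF f])
  let ?k = "shear (- 2) q q"
  note on' = orthonormal_inner[OF on]
  have "?k *v (shear s p q *v (?k *v (shear s p q *v x))) = x" for x
    unfolding shear_mult by (simp add: inner_diff_right inner_add_right on' algebra_simps)
  then show "?k ** shear s p q ** ?k ** shear s p q = mat 1"
    by (simp add: matrix_eq flip: matrix_vector_mul_assoc)
  have "?k *v (?k *v x) = x" for x
    unfolding shear_mult by (simp add: inner_diff_right on' algebra_simps)
  then show "?k ** ?k = mat 1"
    by (simp add: matrix_eq flip: matrix_vector_mul_assoc)
qed

lemma orthonormal_component_le:
  assumes "orthonormal u v"
  shows "\<bar>u $ i\<bar> \<le> 1" "\<bar>v $ i\<bar> \<le> 1"
  using component_le_norm_cart[of u i] component_le_norm_cart[of v i] assms by (simp_all add: orthonormal_def)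

lemma abs_mult_le_1: "\<bar>a\<bar> \<le> 1 \<Longrightarrow> \<bar>b\<bar> \<le> (1::real) \<Longrightarrow> \<bar>a * b\<bar> \<le> 1"
  by (simp add: abs_mult mult_le_one)

lemma stretch_entry_le:
  assumes "orthonormal u v" "0 < d"
  shows "\<bar>(stretch (1 + d) u v - mat 1) $ i $ j\<bar> \<le> 2 * d"
proof -
  have "\<bar>d * (u $ i * u $ j)\<bar> \<le> d * 1"
    unfolding abs_mult[of d] using assms by (intro mult_mono abs_mult_le_1 orthonormal_component_le) auto
  moreover have "\<bar>(1 / (1 + d) - 1) * (v $ i * v $ j)\<bar> \<le> d * 1"
  proof -
    have "1 / (1 + d) - 1 = - (d / (1 + d))" using assms(2) by (simp add: field_simps)
    moreover have "d / (1 + d) \<le> d" using assms(2) by (simp add: divide_le_eq algebra_simps)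
    ultimately have "\<bar>1 / (1 + d) - 1\<bar> \<le> d" using assms(2) by simp
    then show ?thesis
      unfolding abs_mult[of "_ - _"] using assms by (intro mult_mono abs_mult_le_1 orthonormal_component_le[OF assms(1)]) auto
  qed
  moreover have "(stretch (1 + d) u v - mat 1) $ i $ j = d * (u $ i * u $ j) + (1 / (1 + d) - 1) * (v $ i * v $ j)"
    by (simp add: stretch_def outer_def)
  ultimately show ?thesis by linarith
qed

lemma stretches_entry_le:
  assumes "orthonormal u v" "0 < d"
  shows "\<bar>(stretches (1 + d) u v n - mat 1) $ i $ j\<bar> \<le> 2 * d"
  unfolding stretches_def
  using stretch_entry_le[OF assms] stretch_entry_le[OF orthonormal_commute[OF assms(1)] assms(2)]
    stretch_entry_le[OF orthonormal_diag[OF assms(1)] assms(2)]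
    stretch_entry_le[OF orthonormal_commute[OF orthonormal_diag[OF assms(1)]] assms(2)] by simp

lemma matrix_mult_entry_le:
  fixes A B :: "real^3^3"
  assumes "\<And>i j. \<bar>A $ i $ j\<bar> \<le> a" "\<And>i j. \<bar>B $ i $ j\<bar> \<le> b"
  shows "\<bar>(A ** B) $ i $ j\<bar> \<le> 3 * (a * b)"
proof -
  have "\<bar>A $ i $ k * B $ k $ j\<bar> \<le> a * b" for k
    unfolding abs_mult using assms(1)[of i k] by (intro mult_mono assms) (auto intro: order_trans[OF abs_ge_zero])
  from this[of 1] this[of 2] this[of 3] show ?thesis
    unfolding matrix_matrix_mult_def by (simp add: sum_3)
qed

text \<open>
  The entries of \<open>M\<close> are at most \<open>3/2\<close> and those of \<open>g - 1\<close> at most \<open>e/20\<close>, so \<open>M\<close> moves by at most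
  \<open>9e/40 < e/2\<close>. This is the reason for the step \<open>e/40\<close>.
\<close>

lemma cube_stretches:
  assumes on: "orthonormal u v" and e: "0 < e" "e < 1" and A: "\<And>i j. \<bar>A $ i $ j\<bar> \<le> 1"
    and M: "M \<in> cube A (e / 2)"
  shows "M ** stretches (1 + e / 40) u v n \<in> cube A e"
  unfolding cube_def
proof (intro CollectI allI)
  fix i j
  let ?g = "stretches (1 + e / 40) u v n"
  have Mij: "\<bar>M $ i $ j\<bar> \<le> 3 / 2" for i j
  proof -
    have "\<bar>M $ i $ j - A $ i $ j\<bar> \<le> e / 2" using M by (simp add: cube_def)
    then show ?thesis using A[of i j] e by linarith
  qed
  have "\<bar>(M ** (?g - mat 1)) $ i $ j\<bar> \<le> 3 * (3 / 2 * (2 * (e / 40)))"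
    using e by (intro matrix_mult_entry_le Mij stretches_entry_le[OF on]) auto
  moreover have "(M ** (?g - mat 1)) $ i $ j = (M ** ?g) $ i $ j - M $ i $ j"
    by (simp add: matrix_matrix_mult_def sum_subtractf algebra_simps mat_def if_distrib[of "\<lambda>x. _ * x"] cong: if_cong)
  moreover have "\<bar>M $ i $ j - A $ i $ j\<bar> \<le> e / 2" using M by (simp add: cube_def)
  ultimately show "\<bar>(M ** ?g) $ i $ j - A $ i $ j\<bar> \<le> e" using e by linarith
qed

lemma cube_shear:
  assumes on: "orthonormal p q" and e: "0 < e" "e < 1" and A: "\<And>i j. \<bar>A $ i $ j\<bar> \<le> 1"
    and s: "0 \<le> s" "s \<le> 1" and M: "M ** shear s p q \<in> cube A e"
  shows "M \<in> cube 0 12"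
  unfolding cube_def
proof (intro CollectI allI)
  fix i j
  have "M ** shear s p q ** shear (- s) p q = M"
    using shear_inverse[OF on] by (metis matrix_mul_assoc matrix_mul_rid)
  moreover have "\<bar>(M ** shear s p q ** shear (- s) p q) $ i $ j\<bar> \<le> 3 * (2 * 2)"
  proof (rule matrix_mult_entry_le)
    show "\<bar>(M ** shear s p q) $ i $ j\<bar> \<le> 2" for i j
    proof -
      have "\<bar>(M ** shear s p q) $ i $ j - A $ i $ j\<bar> \<le> e" using M by (simp add: cube_def)
      then show ?thesis using A[of i j] e by linarith
    qed
    show "\<bar>shear (- s) p q $ i $ j\<bar> \<le> 2" for i j
    proof -
      have "\<bar>s * (p $ i * q $ j)\<bar> \<le> 1"
        using s by (intro abs_mult_le_1 orthonormal_component_le[OF on]) auto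
      moreover have "\<bar>(mat 1 :: real^3^3) $ i $ j\<bar> \<le> 1" by (simp add: mat_def)
      moreover have "shear (- s) p q $ i $ j = mat 1 $ i $ j - s * (p $ i * q $ j)"
        by (simp add: shear_def outer_def)
      ultimately show ?thesis by linarith
    qed
  qed
  ultimately show "\<bar>M $ i $ j - 0 $ i $ j\<bar> \<le> 12" by simp
qed


section \<open>The transfer operator\<close>

text \<open>
  Cauchy-Schwarz for two terms with weights \<open>m\<close> and \<open>n\<close>.
\<close>

lemma square_sum_le_ennreal:
  fixes a b A B :: ennreal
  assumes a: "a\<^sup>2 \<le> ennreal m * A" and b: "b\<^sup>2 \<le> ennreal n * B"
    and mn: "0 \<le> m" "0 \<le> n" "m + n = 1"
  shows "(a + b)\<^sup>2 \<le> A + B"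
proof (cases "A = \<top> \<or> B = \<top>")
  case True
  then show ?thesis by auto
next
  case False
  then obtain \<alpha> \<beta> where \<alpha>\<beta>: "A = ennreal \<alpha>" "B = ennreal \<beta>" "0 \<le> \<alpha>" "0 \<le> \<beta>"
    by (metis ennreal_cases)
  have "a\<^sup>2 < \<top>" "b\<^sup>2 < \<top>"
    using a b mn \<alpha>\<beta> by (auto simp: ennreal_mult[symmetric] intro: le_less_trans)
  then obtain x y where xy: "a = ennreal x" "b = ennreal y" "0 \<le> x" "0 \<le> y"
  proof -
    have "a \<noteq> \<top>" "b \<noteq> \<top>"
      using \<open>a\<^sup>2 < \<top>\<close> \<open>b\<^sup>2 < \<top>\<close> by (auto simp: power2_eq_square)
    then show ?thesis using that by (metis ennreal_cases)
  qed
  have x: "x\<^sup>2 \<le> m * \<alpha>" and y: "y\<^sup>2 \<le> n * \<beta>"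
    using a b mn by (simp_all add: xy \<alpha>\<beta> ennreal_power flip: ennreal_mult)
  have "2 * (x * y) \<le> n * \<alpha> + m * \<beta>"
  proof (rule power2_le_imp_le)
    have "(2 * (x * y))\<^sup>2 = 4 * (x\<^sup>2 * y\<^sup>2)" by (simp add: power2_eq_square)
    also have "\<dots> \<le> 4 * ((m * \<alpha>) * (n * \<beta>))"
      using x y mn \<alpha>\<beta> by (intro mult_left_mono mult_mono) auto
    also have "\<dots> = (n * \<alpha> + m * \<beta>)\<^sup>2 - (n * \<alpha> - m * \<beta>)\<^sup>2"
      by (simp add: power2_eq_square algebra_simps)
    also have "\<dots> \<le> (n * \<alpha> + m * \<beta>)\<^sup>2" by simp
    finally show "(2 * (x * y))\<^sup>2 \<le> (n * \<alpha> + m * \<beta>)\<^sup>2" .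
  qed (use mn \<alpha>\<beta> in simp)
  then have "(x + y)\<^sup>2 \<le> (m + n) * \<alpha> + (m + n) * \<beta>"
    using x y by (simp add: power2_sum algebra_simps)
  then show ?thesis
    using mn xy \<alpha>\<beta> by (simp add: ennreal_power flip: ennreal_plus)
qed

text \<open>
  The common properties of the identity and of \<open>cof\<close> that the contraction argument uses: the map is
  multiplicative, it permutes the actions of the four stretches on their plane, and every shear of
  the plane is the image of a shear.
\<close>
locale matrix_action =
  fixes \<kappa> :: "real^3^3 \<Rightarrow> real^3^3"
  assumes measurable_action: "\<kappa> \<in> borel_measurable borel"
    and action_mult: "\<kappa> (A ** B) = \<kappa> A ** \<kappa> B"
    and action_stretches: "orthonormal u v \<Longrightarrow> l \<noteq> 0 \<Longrightarrow>
      (\<Sum>i<4. f (\<kappa> (stretches l u v i) *v (u + t *\<^sub>R v)) (\<kappa> (stretches l u v i) *v v) :: ennreal)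
      = (\<Sum>i<4. f (stretches l u v i *v (u + t *\<^sub>R v)) (stretches l u v i *v v))"
    and action_shear: "orthonormal u v \<Longrightarrow>
      \<exists>p q. orthonormal p q \<and> (\<forall>s. \<kappa> (shear s p q) *v u = u + s *\<^sub>R v \<and> \<kappa> (shear s p q) *v v = v)"
begin

definition transfer :: "real \<Rightarrow> real^3^3 \<Rightarrow> (real^3 \<Rightarrow> real^3 \<Rightarrow> ennreal) \<Rightarrow> real^3 \<Rightarrow> real^3 \<Rightarrow> ennreal"
  where "transfer e A F x y = (\<integral>\<^sup>+M. F (\<kappa> M *v x) (\<kappa> M *v y) \<partial>uniform_measure lborel (cube A e))"

lemma flag_density_matrix:
  assumes F: "flag_density F"
  shows "flag_density (\<lambda>x y. F (B *v x) (B *v y))"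
  unfolding flag_density_def
proof (intro conjI allI impI)
  show "(\<lambda>p. F (B *v fst p) (B *v snd p)) \<in> borel_measurable (borel \<Otimes>\<^sub>M borel)"
    by (rule flag_density_measurable[OF F]) simp_all
  fix a b c :: real and x y :: "real^3"
  show "F (B *v x) (B *v y) = 0" if "cross3 x y = 0"
    using that by (intro flag_density_dependent[OF F]) (simp flip: cof_cross)
  assume "a \<noteq> 0" "c \<noteq> 0"
  from flag_density_homogeneous[OF F this]
  show "F (B *v (a *\<^sub>R x)) (B *v (b *\<^sub>R x + c *\<^sub>R y)) = ennreal (sqrt \<bar>c / a\<bar>) * F (B *v x) (B *v y)"
    by (simp add: matrix_vector_mult_scaleR matrix_vector_right_distrib)
qed

lemma flag_density_transfer:
  assumes F: "flag_density F"
  shows "flag_density (transfer e A F)"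
  unfolding flag_density_def
proof (intro conjI allI impI)
  note [measurable] = measurable_action
  note FM = flag_density_matrix[OF F]
  have m: "(\<lambda>z. F (\<kappa> (snd z) *v fst (fst z)) (\<kappa> (snd z) *v snd (fst z))) \<in> borel_measurable ((borel \<Otimes>\<^sub>M borel) \<Otimes>\<^sub>M borel)"
    by (rule flag_density_measurable[OF F]) measurable
  have mm: "(\<lambda>M. F (\<kappa> M *v x) (\<kappa> M *v y)) \<in> borel_measurable borel" for x y
    by (rule flag_density_measurable[OF F]) measurable
  have ind: "(\<lambda>z. indicator (cube A e) (snd z) :: ennreal) \<in> borel_measurable ((borel \<Otimes>\<^sub>M borel) \<Otimes>\<^sub>M borel)"
    by measurable
  have eq: "transfer e A F x y = (\<integral>\<^sup>+M. F (\<kappa> M *v x) (\<kappa> M *v y) * indicator (cube A e) M \<partial>lborel) / emeasure lborel (cube A e)" for x y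
    unfolding transfer_def using mm[of x y] by (intro nn_integral_uniform_measure) simp_all
  have "(\<lambda>p. \<integral>\<^sup>+M. F (\<kappa> M *v fst p) (\<kappa> M *v snd p) * indicator (cube A e) M \<partial>lborel) \<in> borel_measurable (borel \<Otimes>\<^sub>M borel)"
  proof (rule sigma_finite_measure.borel_measurable_nn_integral)
    show "(\<lambda>(p, M). F (\<kappa> M *v fst p) (\<kappa> M *v snd p) * indicator (cube A e) M) \<in> borel_measurable ((borel \<Otimes>\<^sub>M borel) \<Otimes>\<^sub>M lborel)"
      using borel_measurable_times_ennreal[OF m ind]
      by (simp add: case_prod_unfold cong: measurable_cong_sets)
  qed (rule sigma_finite_lborel)
  then show "(\<lambda>p. transfer e A F (fst p) (snd p)) \<in> borel_measurable (borel \<Otimes>\<^sub>M borel)"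
    unfolding eq by measurable
  fix a b c :: real and x y :: "real^3"
  show "transfer e A F x y = 0" if "cross3 x y = 0"
    unfolding transfer_def by (simp add: flag_density_dependent[OF FM that])
  assume ac: "a \<noteq> 0" "c \<noteq> 0"
  show "transfer e A F (a *\<^sub>R x) (b *\<^sub>R x + c *\<^sub>R y) = ennreal (sqrt \<bar>c / a\<bar>) * transfer e A F x y"
    unfolding transfer_def flag_density_homogeneous[OF FM ac] using mm[of x y]
    by (intro nn_integral_cmult) simp
qed

text \<open>
  The uniform distribution on the cube dominates the average over \<open>i\<close> of the images under right
  multiplication by \<open>g i\<close> of the uniform distribution on the cube of half the size, taken with total mass \<open>1/512\<close>. Here
  \<open>\<mu>\<close> is what is left of it, and \<open>\<nu>\<close> is the part on the smaller cube.
\<close>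

lemma transfer_split:
  fixes A :: "real^3^3"
  assumes on: "orthonormal u v" and e: "0 < e" "e < 1" and A: "\<And>i j. \<bar>A $ i $ j\<bar> \<le> 1"
  defines "g \<equiv> stretches (1 + e / 40) u v"
  obtains \<mu> \<nu> :: "(real^3^3) measure" where
    "sets \<mu> = sets borel" "sets \<nu> = sets borel"
    "emeasure \<mu> UNIV = ennreal (511 / 512)" "emeasure \<nu> UNIV = ennreal (1 / 512)"
    "\<And>\<phi>. \<phi> \<in> borel_measurable borel \<Longrightarrow>
      (\<integral>\<^sup>+M. \<phi> M \<partial>uniform_measure lborel (cube A e)) = (\<integral>\<^sup>+M. \<phi> M \<partial>\<mu>) + (\<integral>\<^sup>+M. (\<Sum>i<4. \<phi> (M ** g i)) / 4 \<partial>\<nu>)"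
proof -
  define Q where "Q = cube A e"
  define Q' where "Q' = cube A (e / 2)"
  have [measurable]: "Q \<in> sets borel" "Q' \<in> sets borel" by (simp_all add: Q_def Q'_def)
  define V where "V = (2 * e) ^ 9"
  have V: "0 < V" using e by (simp add: V_def)
  have eQ: "emeasure lborel Q = ennreal V" and eQ': "emeasure lborel Q' = ennreal (V / 512)"
    using e by (simp_all add: Q_def Q'_def emeasure_cube V_def power_mult_distrib)
  have l: "1 + e / 40 \<noteq> 0" using e by simp
  have inv: "g (opposite i) ** g i = mat 1" if "i < 4" for i
    using stretches_opposite[OF on l that] by (simp add: g_def)
  have inv': "g i ** g (opposite i) = mat 1" if "i < 4" for i
    using inv[OF that] by (simp add: matrix_left_right_inverse)
  define hr where "hr M = (\<Sum>i<4. indicator Q' (M ** g (opposite i)) / 4 :: real)" for M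
  have [measurable]: "hr \<in> borel_measurable borel"
    unfolding hr_def by measurable
  have hr0: "0 \<le> hr M" for M by (simp add: hr_def sum_nonneg)
  have hrQ: "hr M \<le> indicator Q M" for M
  proof (cases "M \<in> Q")
    case True
    have "hr M \<le> (\<Sum>i<(4::nat). 1 / 4)"
      unfolding hr_def by (intro sum_mono divide_right_mono) (auto simp: indicator_def)
    then show ?thesis using True by simp
  next
    case False
    have "M ** g (opposite i) \<notin> Q'" if "i < 4" for i
    proof
      assume "M ** g (opposite i) \<in> Q'"
      then have "M ** g (opposite i) ** g i \<in> Q"
        unfolding Q_def Q'_def g_def by (rule cube_stretches[OF on e A])
      then show False using inv[OF that] False by (simp flip: matrix_mul_assoc)
    qed
    then have "hr M = 0" by (simp add: hr_def)
    then show ?thesis using False by simp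
  qed
  \<comment> \<open>The density of the part that is not captured by the smaller cube, up to normalization.\<close>
  define k where "k M = indicator Q M - hr M" for M
  have [measurable]: "k \<in> borel_measurable borel"
    unfolding k_def by measurable
  have k0: "0 \<le> k M" for M using hrQ by (simp add: k_def)
  have khr: "indicator Q M = ennreal (k M) + ennreal (hr M)" for M
    using k0 hr0 by (simp add: k_def flip: ennreal_plus ennreal_indicator)
  have int_hr: "(\<integral>\<^sup>+M. \<phi> M * ennreal (hr M) \<partial>lborel) = (\<integral>\<^sup>+M. (\<Sum>i<4. \<phi> (M ** g i)) / 4 * indicator Q' M \<partial>lborel)"
    if [measurable]: "\<phi> \<in> borel_measurable borel" for \<phi> :: "real^3^3 \<Rightarrow> ennreal"
  proof -
    have "(\<integral>\<^sup>+M. \<phi> M * ennreal (hr M) \<partial>lborel) = (\<integral>\<^sup>+M. (\<Sum>i<4. \<phi> M * indicator Q' (M ** g (opposite i)) / 4) \<partial>lborel)"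
    proof (rule nn_integral_cong)
      fix M
      have "ennreal (indicator Q' x / 4) = indicator Q' x / 4" for x
        by (simp add: divide_ennreal[symmetric] del: divide_ennreal ennreal_numeral) (simp add: ennreal_indicator)
      then show "\<phi> M * ennreal (hr M) = (\<Sum>i<4. \<phi> M * indicator Q' (M ** g (opposite i)) / 4)"
        unfolding hr_def by (subst sum_ennreal[symmetric]) (simp_all add: sum_distrib_left ennreal_times_divide)
    qed
    also have "\<dots> = (\<Sum>i<4. \<integral>\<^sup>+M. \<phi> M * indicator Q' (M ** g (opposite i)) / 4 \<partial>lborel)"
      by (rule nn_integral_sum) measurable
    also have "\<dots> = (\<Sum>i<4. \<integral>\<^sup>+M. \<phi> (M ** g i) * indicator Q' M / 4 \<partial>lborel)"
    proof (rule sum.cong[OF refl])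
      fix i :: nat assume "i \<in> {..<4}"
      then have "M ** g i ** g (opposite i) = M" for M :: "real^3^3"
        using inv' by (simp flip: matrix_mul_assoc)
      then show "(\<integral>\<^sup>+M. \<phi> M * indicator Q' (M ** g (opposite i)) / 4 \<partial>lborel) = (\<integral>\<^sup>+M. \<phi> (M ** g i) * indicator Q' M / 4 \<partial>lborel)"
        using nn_integral_stretches[OF _ on l, of "\<lambda>M. \<phi> M * indicator Q' (M ** g (opposite i)) / 4" i] by (simp add: g_def)
    qed
    also have "\<dots> = (\<integral>\<^sup>+M. (\<Sum>i<4. \<phi> (M ** g i) * indicator Q' M / 4) \<partial>lborel)"
      by (rule nn_integral_sum[symmetric]) measurable
    also have "\<dots> = (\<integral>\<^sup>+M. (\<Sum>i<4. \<phi> (M ** g i)) / 4 * indicator Q' M \<partial>lborel)"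
      by (intro nn_integral_cong) (auto simp: indicator_def divide_ennreal_def sum_distrib_right)
    finally show ?thesis .
  qed
  define c where "c = ennreal (1 / V)"
  have cV: "c * ennreal V = 1" using V by (simp add: c_def flip: ennreal_mult)
  define \<mu> where "\<mu> = density lborel (\<lambda>M. c * ennreal (k M))"
  define \<nu> where "\<nu> = density lborel (\<lambda>M. c * indicator Q' M)"
  have "(\<integral>\<^sup>+M. ennreal (hr M) \<partial>lborel) = ennreal (V / 512)"
    using int_hr[of "\<lambda>_. 1"] by (simp add: eQ' sum_less_4)
  moreover have "ennreal V = (\<integral>\<^sup>+M. ennreal (k M) \<partial>lborel) + (\<integral>\<^sup>+M. ennreal (hr M) \<partial>lborel)"
    unfolding eQ[symmetric] by (subst nn_integral_add[symmetric]) (simp_all flip: khr)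
  ultimately have "(\<integral>\<^sup>+M. ennreal (k M) \<partial>lborel) = ennreal V - ennreal (V / 512)"
    by simp
  also have "\<dots> = ennreal (V * (511 / 512))"
    using V by (simp add: ennreal_minus)
  finally have int_k: "(\<integral>\<^sup>+M. ennreal (k M) \<partial>lborel) = ennreal (V * (511 / 512))" .
  show ?thesis
  proof
    show "sets \<mu> = sets borel" "sets \<nu> = sets borel" by (simp_all add: \<mu>_def \<nu>_def)
    show "emeasure \<mu> UNIV = ennreal (511 / 512)"
      using V by (simp add: \<mu>_def emeasure_density nn_integral_cmult int_k) (simp add: c_def flip: ennreal_mult)
    show "emeasure \<nu> UNIV = ennreal (1 / 512)"
      using V by (simp add: \<nu>_def emeasure_density nn_integral_cmult eQ') (simp add: c_def flip: ennreal_mult)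
    fix \<phi> :: "real^3^3 \<Rightarrow> ennreal" assume [measurable]: "\<phi> \<in> borel_measurable borel"
    have "(\<integral>\<^sup>+M. \<phi> M \<partial>uniform_measure lborel (cube A e)) = c * (\<integral>\<^sup>+M. \<phi> M * indicator Q M \<partial>lborel)"
      using V unfolding Q_def[symmetric]
      by (subst nn_integral_uniform_measure) (simp_all add: eQ divide_ennreal_def inverse_ennreal c_def inverse_eq_divide mult.commute)
    also have "(\<integral>\<^sup>+M. \<phi> M * indicator Q M \<partial>lborel) = (\<integral>\<^sup>+M. \<phi> M * ennreal (k M) \<partial>lborel) + (\<integral>\<^sup>+M. (\<Sum>i<4. \<phi> (M ** g i)) / 4 * indicator Q' M \<partial>lborel)"
      unfolding khr distrib_left int_hr[symmetric, OF \<open>\<phi> \<in> borel_measurable borel\<close>] by (rule nn_integral_add) measurable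
    also have "c * \<dots> = (\<integral>\<^sup>+M. \<phi> M \<partial>\<mu>) + (\<integral>\<^sup>+M. (\<Sum>i<4. \<phi> (M ** g i)) / 4 \<partial>\<nu>)"
      unfolding \<mu>_def \<nu>_def
      by (subst (1 2) nn_integral_density) (simp_all add: distrib_left mult_ac flip: nn_integral_cmult)
    finally show "(\<integral>\<^sup>+M. \<phi> M \<partial>uniform_measure lborel (cube A e)) = (\<integral>\<^sup>+M. \<phi> M \<partial>\<mu>) + (\<integral>\<^sup>+M. (\<Sum>i<4. \<phi> (M ** g i)) / 4 \<partial>\<nu>)" .
  qed
qed

text \<open>
  On the part \<open>\<mu>\<close> the energy is at most \<open>b\<close> times the mass, because a matrix acts isometrically
  between fibres. On \<open>\<nu>\<close> the average over the four stretches is taken first, inside the fibre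
  of the plane of \<open>u\<close>, \<open>v\<close>, and gains the factor \<open>r\<^sup>2\<close>.
\<close>

lemma fibre_transfer_orthonormal_le:
  assumes F: "flag_density F" and b: "\<And>u v. fibre_energy F u v \<le> b"
    and on: "orthonormal u v" and e: "0 < e" "e < 1" and A: "\<And>i j. \<bar>A $ i $ j\<bar> \<le> 1"
  shows "fibre_energy (transfer e A F) u v \<le> ennreal (1 - e\<^sup>2 / 8192000) * b"
proof -
  note [measurable] = measurable_action
  define d where "d = e / 40"
  have d: "0 < d" "d \<le> 1 / 40" using e by (simp_all add: d_def)
  define r where "r = 1 - d\<^sup>2 / 10"
  define g where "g = stretches (1 + d) u v"
  obtain \<mu> \<nu> :: "(real^3^3) measure" where
    sets: "sets \<mu> = sets borel" "sets \<nu> = sets borel"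
    and mass: "emeasure \<mu> UNIV = ennreal (511 / 512)" "emeasure \<nu> UNIV = ennreal (1 / 512)"
    and split: "\<And>\<phi>. \<phi> \<in> borel_measurable borel \<Longrightarrow>
      (\<integral>\<^sup>+M. \<phi> M \<partial>uniform_measure lborel (cube A e)) = (\<integral>\<^sup>+M. \<phi> M \<partial>\<mu>) + (\<integral>\<^sup>+M. (\<Sum>i<4. \<phi> (M ** g i)) / 4 \<partial>\<nu>)"
    using transfer_split[OF on e A] unfolding g_def d_def by metis
  note [measurable_cong] = sets
  have space: "space \<mu> = UNIV" "space \<nu> = UNIV"
    using sets by (simp_all add: sets_eq_imp_space_eq)
  interpret \<mu>: finite_measure \<mu> by standard (simp add: space mass)
  interpret \<nu>: finite_measure \<nu> by standard (simp add: space mass)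
  interpret p\<mu>: pair_sigma_finite lborel \<mu> ..
  interpret p\<nu>: pair_sigma_finite lborel \<nu> ..
  define \<phi> where "\<phi> t M = F (\<kappa> M *v (u + t *\<^sub>R v)) (\<kappa> M *v v)" for t :: real and M
  define \<psi> where "\<psi> t M = (\<Sum>i<4. \<phi> t (M ** g i)) / 4" for t M
  have [measurable]: "\<phi> t \<in> borel_measurable borel" for t
    unfolding \<phi>_def by (rule flag_density_measurable[OF F]) measurable
  then have [measurable]: "\<psi> t \<in> borel_measurable borel" for t
    unfolding \<psi>_def by measurable
  have \<phi>m: "(\<lambda>z. \<phi> (fst z) (snd z ** B)) \<in> borel_measurable (borel \<Otimes>\<^sub>M borel)" for B
    unfolding \<phi>_def by (rule flag_density_measurable[OF F]) measurable
  have \<phi>m1: "(\<lambda>z. \<phi> (fst z) (snd z)) \<in> borel_measurable (borel \<Otimes>\<^sub>M borel)"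
    using \<phi>m[of "mat 1"] by simp
  have \<psi>m: "(\<lambda>z. \<psi> (fst z) (snd z)) \<in> borel_measurable (borel \<Otimes>\<^sub>M borel)"
    unfolding \<psi>_def by (intro borel_measurable_divide_ennreal borel_measurable_sum \<phi>m) measurable
  have [measurable]: "(\<lambda>(t, M). (\<phi> t M)\<^sup>2) \<in> borel_measurable (lborel \<Otimes>\<^sub>M \<mu>)"
      "(\<lambda>(t, M). (\<psi> t M)\<^sup>2) \<in> borel_measurable (lborel \<Otimes>\<^sub>M \<nu>)"
    unfolding case_prod_unfold using borel_measurable_power_ennreal[OF \<phi>m1] borel_measurable_power_ennreal[OF \<psi>m]
    by (simp_all cong: measurable_cong_sets)
  have [measurable]: "(\<lambda>t. \<integral>\<^sup>+M. (\<phi> t M)\<^sup>2 \<partial>\<mu>) \<in> borel_measurable lborel" "(\<lambda>t. \<integral>\<^sup>+M. (\<psi> t M)\<^sup>2 \<partial>\<nu>) \<in> borel_measurable lborel"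
    by (intro \<mu>.borel_measurable_nn_integral \<nu>.borel_measurable_nn_integral; measurable)+
  have pt: "(transfer e A F (u + t *\<^sub>R v) v)\<^sup>2 \<le> (\<integral>\<^sup>+M. (\<phi> t M)\<^sup>2 \<partial>\<mu>) + (\<integral>\<^sup>+M. (\<psi> t M)\<^sup>2 \<partial>\<nu>)" for t
  proof -
    have "transfer e A F (u + t *\<^sub>R v) v = (\<integral>\<^sup>+M. \<phi> t M \<partial>\<mu>) + (\<integral>\<^sup>+M. \<psi> t M \<partial>\<nu>)"
      unfolding transfer_def \<phi>_def[symmetric] \<psi>_def by (rule split) measurable
    moreover have "(\<integral>\<^sup>+M. \<phi> t M \<partial>\<mu>)\<^sup>2 \<le> ennreal (511 / 512) * (\<integral>\<^sup>+M. (\<phi> t M)\<^sup>2 \<partial>\<mu>)"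
      using nn_integral_square_le[of "\<phi> t" \<mu>] by (simp add: space mass)
    moreover have "(\<integral>\<^sup>+M. \<psi> t M \<partial>\<nu>)\<^sup>2 \<le> ennreal (1 / 512) * (\<integral>\<^sup>+M. (\<psi> t M)\<^sup>2 \<partial>\<nu>)"
      using nn_integral_square_le[of "\<psi> t" \<nu>] by (simp add: space mass)
    ultimately show ?thesis
      by (simp only:) (rule square_sum_le_ennreal[where m = "511 / 512" and n = "1 / 512"], simp_all)
  qed
  have "fibre_energy (transfer e A F) u v \<le> (\<integral>\<^sup>+t. (\<integral>\<^sup>+M. (\<phi> t M)\<^sup>2 \<partial>\<mu>) + (\<integral>\<^sup>+M. (\<psi> t M)\<^sup>2 \<partial>\<nu>) \<partial>lborel)"
    unfolding fibre_energy_def by (intro nn_integral_mono pt)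
  also have "\<dots> = (\<integral>\<^sup>+t. \<integral>\<^sup>+M. (\<phi> t M)\<^sup>2 \<partial>\<mu> \<partial>lborel) + (\<integral>\<^sup>+t. \<integral>\<^sup>+M. (\<psi> t M)\<^sup>2 \<partial>\<nu> \<partial>lborel)"
    by (rule nn_integral_add) measurable
  also have "(\<integral>\<^sup>+t. \<integral>\<^sup>+M. (\<phi> t M)\<^sup>2 \<partial>\<mu> \<partial>lborel) = (\<integral>\<^sup>+M. \<integral>\<^sup>+t. (\<phi> t M)\<^sup>2 \<partial>lborel \<partial>\<mu>)"
    by (rule p\<mu>.Fubini'[symmetric]) measurable
  also have "(\<integral>\<^sup>+t. \<integral>\<^sup>+M. (\<psi> t M)\<^sup>2 \<partial>\<nu> \<partial>lborel) = (\<integral>\<^sup>+M. \<integral>\<^sup>+t. (\<psi> t M)\<^sup>2 \<partial>lborel \<partial>\<nu>)"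
    by (rule p\<nu>.Fubini'[symmetric]) measurable
  also have "(\<integral>\<^sup>+M. \<integral>\<^sup>+t. (\<phi> t M)\<^sup>2 \<partial>lborel \<partial>\<mu>) \<le> (\<integral>\<^sup>+M. b \<partial>\<mu>)"
  proof (rule nn_integral_mono)
    fix M
    have "(\<integral>\<^sup>+t. (\<phi> t M)\<^sup>2 \<partial>lborel) = fibre_energy F (\<kappa> M *v u) (\<kappa> M *v v)"
      by (simp add: \<phi>_def fibre_energy_def matrix_vector_right_distrib matrix_vector_mult_scaleR)
    then show "(\<integral>\<^sup>+t. (\<phi> t M)\<^sup>2 \<partial>lborel) \<le> b" using b by simp
  qed
  also have "(\<integral>\<^sup>+M. \<integral>\<^sup>+t. (\<psi> t M)\<^sup>2 \<partial>lborel \<partial>\<nu>) \<le> (\<integral>\<^sup>+M. ennreal (r\<^sup>2) * b \<partial>\<nu>)"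
  proof (rule nn_integral_mono)
    fix M
    let ?F = "\<lambda>x y. F (\<kappa> M *v x) (\<kappa> M *v y)"
    have "\<psi> t M = (\<Sum>i<4. ?F (g i *v (u + t *\<^sub>R v)) (g i *v v)) / 4" for t
      using action_stretches[OF on, of "1 + d" ?F t] d
      by (simp add: \<psi>_def \<phi>_def g_def action_mult flip: matrix_vector_mul_assoc)
    then have "(\<integral>\<^sup>+t. (\<psi> t M)\<^sup>2 \<partial>lborel) \<le> ennreal (r\<^sup>2) * fibre_energy ?F u v"
      using fibre_stretch_average_le[OF flag_density_matrix[OF F] on d, of "\<kappa> M"] by (simp add: g_def r_def)
    also have "fibre_energy ?F u v = fibre_energy F (\<kappa> M *v u) (\<kappa> M *v v)"
      by (simp add: fibre_energy_def matrix_vector_right_distrib matrix_vector_mult_scaleR)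
    also have "ennreal (r\<^sup>2) * \<dots> \<le> ennreal (r\<^sup>2) * b"
      by (intro mult_left_mono b) simp
    finally show "(\<integral>\<^sup>+t. (\<psi> t M)\<^sup>2 \<partial>lborel) \<le> ennreal (r\<^sup>2) * b" .
  qed
  also have "(\<integral>\<^sup>+M. b \<partial>\<mu>) + (\<integral>\<^sup>+M. ennreal (r\<^sup>2) * b \<partial>\<nu>) = ennreal (511 / 512 + r\<^sup>2 / 512) * b"
  proof -
    have "ennreal (511 / 512 + r\<^sup>2 / 512) = ennreal (511 / 512) + ennreal (r\<^sup>2) * ennreal (1 / 512)"
      by (simp flip: ennreal_mult)
    then show ?thesis
      by (simp only: nn_integral_const space mass distrib_right) (simp add: mult_ac)
  qed
  also have "\<dots> \<le> ennreal (1 - e\<^sup>2 / 8192000) * b"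
  proof (intro mult_right_mono ennreal_leI)
    have "d\<^sup>2 \<le> (1 / 40)\<^sup>2" using d by (intro power_mono) auto
    then have "r * r \<le> 1 * r"
      by (intro mult_right_mono) (simp_all add: r_def power2_eq_square)
    moreover have "d\<^sup>2 = e\<^sup>2 / 1600" by (simp add: d_def power_divide)
    ultimately show "511 / 512 + r\<^sup>2 / 512 \<le> 1 - e\<^sup>2 / 8192000"
      by (simp add: r_def power2_eq_square)
  qed simp
  finally show ?thesis by (simp add: add_mono)
qed

lemma fibre_transfer_le:
  assumes F: "flag_density F" and b: "\<And>u v. fibre_energy F u v \<le> b"
    and e: "0 < e" "e < 1" and A: "\<And>i j. \<bar>A $ i $ j\<bar> \<le> 1"
  shows "fibre_energy (transfer e A F) u v \<le> ennreal (1 - e\<^sup>2 / 8192000) * b"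
proof (cases "cross3 u v = 0")
  case True
  then show ?thesis using fibre_dependent[OF flag_density_transfer[OF F]] by simp
next
  case False
  then obtain p q where "orthonormal p q" "\<And>F. flag_density F \<Longrightarrow> fibre_energy F u v = fibre_energy F p q"
    using orthonormal_basis_of_plane by blast
  then show ?thesis
    using fibre_transfer_orthonormal_le[OF F b _ e A] flag_density_transfer[OF F] by metis
qed

text \<open>
  Lebesgue measure is invariant under right multiplication by the preimage under \<open>\<kappa>\<close> of the shear
  \<open>x \<mapsto> x + s y\<close>, which replaces \<open>x\<close> by \<open>x + s y\<close> in the integrand. Averaging over \<open>s\<close> in \<open>[0, 1]\<close> turns the pointwise value into an integral over
  part of the fibre. The cube of radius \<open>12\<close> contains all matrices that such a shear can bring into the
  original cube.
\<close>

lemma transfer_square_le: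
  assumes F: "flag_density F" and b: "\<And>u v. fibre_energy F u v \<le> b"
    and on: "orthonormal x y" and e: "0 < e" "e < 1" and A: "\<And>i j. \<bar>A $ i $ j\<bar> \<le> 1"
  shows "(transfer e A F x y)\<^sup>2 \<le> ennreal ((12 / e) ^ 18) * b"
proof -
  note [measurable] = measurable_action
  define Q where "Q = cube A e"
  define B where "B = cube 0 12"
  have [measurable]: "Q \<in> sets borel" "B \<in> sets borel" by (simp_all add: Q_def B_def)
  define V where "V = (2 * e) ^ 9"
  have V: "0 < V" using e by (simp add: V_def)
  have eQ: "emeasure lborel Q = ennreal V" and eB: "emeasure lborel B = ennreal (24 ^ 9)"
    using e emeasure_cube[of 12 0] by (simp_all add: Q_def B_def emeasure_cube V_def)
  obtain p q where pq: "orthonormal p q" "\<And>s. \<kappa> (shear s p q) *v x = x + s *\<^sub>R y" "\<And>s. \<kappa> (shear s p q) *v y = y"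
    using action_shear[OF on] by blast
  let ?I = "indicator {0..1} :: real \<Rightarrow> ennreal"
  define \<phi> where "\<phi> M = F (\<kappa> M *v x) (\<kappa> M *v y)" for M
  have m [measurable]: "(\<lambda>z. F (\<kappa> (snd z) *v (x + fst z *\<^sub>R y)) (\<kappa> (snd z) *v y)) \<in> borel_measurable (borel \<Otimes>\<^sub>M borel)"
    by (rule flag_density_measurable[OF F]) measurable
  have m2 [measurable]: "(\<lambda>s. F (\<kappa> M *v (x + s *\<^sub>R y)) (\<kappa> M *v y)) \<in> borel_measurable borel" for M
    by (rule flag_density_measurable[OF F]) measurable
  have m3 [measurable]: "(\<lambda>M. F (\<kappa> M *v (x + s *\<^sub>R y)) (\<kappa> M *v y)) \<in> borel_measurable borel" for s
    by (rule flag_density_measurable[OF F]) measurable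
  have m4 [measurable]: "\<phi> \<in> borel_measurable borel"
    unfolding \<phi>_def by (rule flag_density_measurable[OF F]) measurable
  have m5: "(\<lambda>z. ?I (snd z) * (indicator B (fst z) * F (\<kappa> (fst z) *v (x + snd z *\<^sub>R y)) (\<kappa> (fst z) *v y))) \<in> borel_measurable (borel \<Otimes>\<^sub>M borel)"
    by (intro borel_measurable_times_ennreal flag_density_measurable[OF F]) measurable
  define J where "J M = (\<integral>\<^sup>+s. ?I s * F (\<kappa> M *v (x + s *\<^sub>R y)) (\<kappa> M *v y) \<partial>lborel)" for M
  have [measurable]: "J \<in> borel_measurable borel"
  proof -
    have "(\<lambda>z. ?I (snd z) * F (\<kappa> (fst z) *v (x + snd z *\<^sub>R y)) (\<kappa> (fst z) *v y)) \<in> borel_measurable (borel \<Otimes>\<^sub>M lborel)"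
      by (intro borel_measurable_times_ennreal flag_density_measurable[OF F]) measurable
    then show ?thesis
      unfolding J_def[abs_def]
      by (intro sigma_finite_measure.borel_measurable_nn_integral sigma_finite_lborel) (simp add: case_prod_unfold)
  qed
  have shear: "(\<integral>\<^sup>+M. indicator Q M * \<phi> M \<partial>lborel) \<le> (\<integral>\<^sup>+M. indicator B M * F (\<kappa> M *v (x + s *\<^sub>R y)) (\<kappa> M *v y) \<partial>lborel)"
    if s: "s \<in> {0..1}" for s
  proof -
    have "(\<integral>\<^sup>+M. indicator Q M * \<phi> M \<partial>lborel) = (\<integral>\<^sup>+M. indicator Q (M ** shear s p q) * \<phi> (M ** shear s p q) \<partial>lborel)"
      using nn_integral_shear[OF _ pq(1), of "\<lambda>M. indicator Q M * \<phi> M" s] by simp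
    also have "\<dots> \<le> (\<integral>\<^sup>+M. indicator B M * F (\<kappa> M *v (x + s *\<^sub>R y)) (\<kappa> M *v y) \<partial>lborel)"
    proof (rule nn_integral_mono)
      fix M
      have "indicator Q (M ** shear s p q) \<le> (indicator B M :: ennreal)"
        using cube_shear[OF pq(1) e A, of s M] s by (auto simp: indicator_def Q_def B_def)
      then show "indicator Q (M ** shear s p q) * \<phi> (M ** shear s p q) \<le> indicator B M * F (\<kappa> M *v (x + s *\<^sub>R y)) (\<kappa> M *v y)"
        unfolding \<phi>_def action_mult by (simp add: pq mult_right_mono flip: matrix_vector_mul_assoc)
    qed
    finally show ?thesis .
  qed
  have "(\<integral>\<^sup>+M. indicator Q M * \<phi> M \<partial>lborel) = (\<integral>\<^sup>+s. ?I s * (\<integral>\<^sup>+M. indicator Q M * \<phi> M \<partial>lborel) \<partial>lborel)"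
    by (simp add: nn_integral_multc)
  also have "\<dots> \<le> (\<integral>\<^sup>+s. \<integral>\<^sup>+M. ?I s * (indicator B M * F (\<kappa> M *v (x + s *\<^sub>R y)) (\<kappa> M *v y)) \<partial>lborel \<partial>lborel)"
    using shear by (intro nn_integral_mono) (auto simp: indicator_def)
  also have "\<dots> = (\<integral>\<^sup>+M. \<integral>\<^sup>+s. ?I s * (indicator B M * F (\<kappa> M *v (x + s *\<^sub>R y)) (\<kappa> M *v y)) \<partial>lborel \<partial>lborel)"
    by (rule lborel_pair.Fubini') (use m5 in \<open>simp add: case_prod_unfold cong: measurable_cong_sets\<close>)
  also have "\<dots> = (\<integral>\<^sup>+M. indicator B M * J M \<partial>lborel)"
    unfolding J_def by (intro nn_integral_cong) (simp add: mult.left_commute nn_integral_cmult)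
  finally have le: "(\<integral>\<^sup>+M. indicator Q M * \<phi> M \<partial>lborel) \<le> (\<integral>\<^sup>+M. indicator B M * J M \<partial>lborel)" .
  have J: "(J M)\<^sup>2 \<le> b" for M
  proof -
    have "(J M)\<^sup>2 \<le> (\<integral>\<^sup>+s. (?I s)\<^sup>2 \<partial>lborel) * (\<integral>\<^sup>+s. (F (\<kappa> M *v (x + s *\<^sub>R y)) (\<kappa> M *v y))\<^sup>2 \<partial>lborel)"
      unfolding J_def by (rule Cauchy_Schwarz_nn_integral) simp_all
    also have "(\<integral>\<^sup>+s. (?I s)\<^sup>2 \<partial>lborel) = 1"
    proof -
      have "(?I s)\<^sup>2 = ?I s" for s by (simp add: indicator_def)
      then show ?thesis by simp
    qed
    also have "(\<integral>\<^sup>+s. (F (\<kappa> M *v (x + s *\<^sub>R y)) (\<kappa> M *v y))\<^sup>2 \<partial>lborel) = fibre_energy F (\<kappa> M *v x) (\<kappa> M *v y)"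
      by (simp add: fibre_energy_def matrix_vector_right_distrib matrix_vector_mult_scaleR)
    also have "1 * \<dots> \<le> b" using b by simp
    finally show ?thesis .
  qed
  have ind2: "(indicator B M :: ennreal)\<^sup>2 = indicator B M" for M by (simp add: indicator_def)
  have "(\<integral>\<^sup>+M. indicator B M * J M \<partial>lborel)\<^sup>2 = (\<integral>\<^sup>+M. indicator B M * (indicator B M * J M) \<partial>lborel)\<^sup>2"
    by (simp add: mult.assoc[symmetric] ind2[unfolded power2_eq_square])
  also have "\<dots> \<le> (\<integral>\<^sup>+M. (indicator B M)\<^sup>2 \<partial>lborel) * (\<integral>\<^sup>+M. (indicator B M * J M)\<^sup>2 \<partial>lborel)"
    by (rule Cauchy_Schwarz_nn_integral) simp_all
  also have "\<dots> \<le> (\<integral>\<^sup>+M. (indicator B M)\<^sup>2 \<partial>lborel) * (\<integral>\<^sup>+M. indicator B M * b \<partial>lborel)"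
    by (intro mult_left_mono nn_integral_mono) (auto simp: power_mult_distrib ind2 J mult_left_mono)
  also have "\<dots> = ennreal (24 ^ 9) * (ennreal (24 ^ 9) * b)"
    by (simp add: ind2 nn_integral_multc eB)
  finally have int: "(\<integral>\<^sup>+M. indicator B M * J M \<partial>lborel)\<^sup>2 \<le> ennreal (24 ^ 9) * (ennreal (24 ^ 9) * b)" .
  have "transfer e A F x y = ennreal (1 / V) * (\<integral>\<^sup>+M. indicator Q M * \<phi> M \<partial>lborel)"
    using V unfolding transfer_def Q_def[symmetric] \<phi>_def[symmetric]
    by (subst nn_integral_uniform_measure) (simp_all add: eQ divide_ennreal_def inverse_ennreal inverse_eq_divide mult.commute)
  also have "\<dots>\<^sup>2 \<le> (ennreal (1 / V) * (\<integral>\<^sup>+M. indicator B M * J M \<partial>lborel))\<^sup>2"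
    using le by (intro power_mono mult_left_mono) auto
  also have "\<dots> \<le> (ennreal (1 / V))\<^sup>2 * (ennreal (24 ^ 9) * (ennreal (24 ^ 9) * b))"
    unfolding power_mult_distrib using int by (rule mult_left_mono) simp
  also have "\<dots> = ennreal ((1 / V)\<^sup>2 * 24 ^ 18) * b"
    using V by (simp add: mult.assoc[symmetric] ennreal_power flip: ennreal_mult del: ennreal_numeral power_numeral)
  also have "(1 / V)\<^sup>2 * 24 ^ 18 = (12 / e) ^ 18"
    using e by (simp add: V_def field_simps power_mult_distrib flip: power_mult)
  finally show ?thesis .
qed

end

section \<open>The identity and the cofactor action\<close>

interpretation id_action: matrix_action "\<lambda>A. A"
proof
  fix u v :: "real^3" assume on: "orthonormal u v"
  have "\<forall>s. shear s v u *v u = u + s *\<^sub>R v \<and> shear s v u *v v = v"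
    by (simp add: shear_mult orthonormal_inner[OF on])
  then show "\<exists>p q. orthonormal p q \<and> (\<forall>s. shear s p q *v u = u + s *\<^sub>R v \<and> shear s p q *v v = v)"
    using orthonormal_commute[OF on] by blast
qed simp_all

lemma cross3_orthonormal:
  assumes "orthonormal u v"
  shows "cross3 v (cross3 u v) = u" "cross3 (cross3 u v) u = v"
    "u \<bullet> cross3 u v = 0" "v \<bullet> cross3 u v = 0"
proof -
  have "cross3 v (cross3 u v) = (v \<bullet> v) *\<^sub>R u - (u \<bullet> v) *\<^sub>R v"
    "cross3 (cross3 u v) u = (u \<bullet> u) *\<^sub>R v - (u \<bullet> v) *\<^sub>R u"
    by (simp_all add: cross3_simps forall_3)
  then show "cross3 v (cross3 u v) = u" "cross3 (cross3 u v) u = v"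
    by (simp_all add: orthonormal_inner[OF assms])
  show "u \<bullet> cross3 u v = 0" "v \<bullet> cross3 u v = 0"
    by (simp_all add: dot_cross_self)
qed

lemma cof_stretch_combination:
  assumes on: "orthonormal u v" and l: "l \<noteq> 0"
  shows "cof (stretch l u v) *v (a *\<^sub>R u + b *\<^sub>R v) = stretch l v u *v (a *\<^sub>R u + b *\<^sub>R v)"
proof -
  let ?w = "cross3 u v"
  have w: "stretch l u v *v ?w = ?w"
    by (simp add: stretch_mult cross3_orthonormal[OF on])
  have Su: "stretch l u v *v u = l *\<^sub>R u" and Sv: "stretch l u v *v v = (1 / l) *\<^sub>R v"
    using stretch_combination[OF on, of l 1 0] stretch_combination[OF on, of l 0 1] by simp_all
  have "cof (stretch l u v) *v u = cross3 ((1 / l) *\<^sub>R v) ?w"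
    using cof_cross[of "stretch l u v" v ?w] by (simp add: cross3_orthonormal[OF on] w Sv)
  moreover have "cof (stretch l u v) *v v = cross3 ?w (l *\<^sub>R u)"
    using cof_cross[of "stretch l u v" ?w u] by (simp add: cross3_orthonormal[OF on] w Su)
  ultimately show ?thesis
    using stretch_combination[OF orthonormal_commute[OF on], of l b a]
    by (simp add: matrix_vector_right_distrib matrix_vector_mult_scaleR cross_mult_left cross_mult_right
        cross3_orthonormal[OF on] add.commute mult.commute)
qed

lemma combination_diag:
  "a *\<^sub>R u + b *\<^sub>R v = ((a + b) / sqrt 2) *\<^sub>R diag_plus u v + ((a - b) / sqrt 2) *\<^sub>R diag_minus u v"
proof -
  have "(a + b) / sqrt 2 * (1 / sqrt 2) = (a + b) / 2" "(a - b) / sqrt 2 * (1 / sqrt 2) = (a - b) / 2" by simp_all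
  then show ?thesis
    unfolding diag_plus_def diag_minus_def scaleR_scaleR by (simp add: vec_eq_iff field_simps)
qed

text \<open>
  On the plane of \<open>u\<close>, \<open>v\<close> the cofactor matrix of a stretch is the inverse stretch, since the
  normal of the plane is fixed.
\<close>

lemma cof_stretches_combination:
  assumes on: "orthonormal u v" and l: "l \<noteq> 0" and i: "i < 4"
  shows "cof (stretches l u v i) *v (a *\<^sub>R u + b *\<^sub>R v) = stretches l u v (opposite i) *v (a *\<^sub>R u + b *\<^sub>R v)"
proof -
  note on' = orthonormal_diag[OF on]
  have "cof (stretch l v u) *v (a *\<^sub>R u + b *\<^sub>R v) = stretch l u v *v (a *\<^sub>R u + b *\<^sub>R v)"
    using cof_stretch_combination[OF orthonormal_commute[OF on] l, of b a] by (simp add: add.commute)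
  moreover have "cof (stretch l (diag_plus u v) (diag_minus u v)) *v (a *\<^sub>R u + b *\<^sub>R v) = stretch l (diag_minus u v) (diag_plus u v) *v (a *\<^sub>R u + b *\<^sub>R v)"
    unfolding combination_diag[of a u b v] by (rule cof_stretch_combination[OF on' l])
  moreover have "cof (stretch l (diag_minus u v) (diag_plus u v)) *v (a *\<^sub>R u + b *\<^sub>R v) = stretch l (diag_plus u v) (diag_minus u v) *v (a *\<^sub>R u + b *\<^sub>R v)"
    unfolding combination_diag[of a u b v] add.commute[of "_ *\<^sub>R diag_plus u v"]
    by (rule cof_stretch_combination[OF orthonormal_commute[OF on'] l])
  ultimately show ?thesis
    using less_4_cases[OF i] cof_stretch_combination[OF on l, of a b] by (auto simp: stretches_def opposite_def)
qed

interpretation cof_action: matrix_action cof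
proof
  fix u v :: "real^3" assume on: "orthonormal u v"
  show "(\<Sum>i<4. f (cof (stretches l u v i) *v (u + t *\<^sub>R v)) (cof (stretches l u v i) *v v) :: ennreal)
      = (\<Sum>i<4. f (stretches l u v i *v (u + t *\<^sub>R v)) (stretches l u v i *v v))" if "l \<noteq> 0" for l t f
  proof -
    have "(\<Sum>i<4. f (cof (stretches l u v i) *v (u + t *\<^sub>R v)) (cof (stretches l u v i) *v v))
      = (\<Sum>i<4. f (stretches l u v (opposite i) *v (u + t *\<^sub>R v)) (stretches l u v (opposite i) *v v))"
      using cof_stretches_combination[OF on that, of _ 1 t] cof_stretches_combination[OF on that, of _ 0 1]
      by (intro sum.cong) simp_all
    also have "\<dots> = (\<Sum>i<4. f (stretches l u v i *v (u + t *\<^sub>R v)) (stretches l u v i *v v))"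
      by (rule sum_opposite)
    finally show ?thesis .
  qed
  have on': "orthonormal (- u) v" using on by (simp add: orthonormal_def)
  let ?w = "cross3 u v"
  note on'' = orthonormal_inner[OF on] cross3_orthonormal[OF on]
  have "cof (shear s (- u) v) *v u = u + s *\<^sub>R v \<and> cof (shear s (- u) v) *v v = v" for s
  proof
    have "cof (shear s (- u) v) *v u = cross3 (v - s *\<^sub>R u) ?w"
      using cof_cross[of "shear s (- u) v" v ?w] by (simp add: shear_mult on'')
    also have "\<dots> = cross3 v ?w + s *\<^sub>R cross3 ?w u"
      by (simp add: Cross3.left_diff_distrib cross_mult_left cross_skew[of u ?w])
    finally show "cof (shear s (- u) v) *v u = u + s *\<^sub>R v" by (simp add: on'')
    show "cof (shear s (- u) v) *v v = v"
      using cof_cross[of "shear s (- u) v" ?w u] by (simp add: shear_mult on'')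
  qed
  then show "\<exists>p q. orthonormal p q \<and> (\<forall>s. cof (shear s p q) *v u = u + s *\<^sub>R v \<and> cof (shear s p q) *v v = v)"
    using on' by blast
qed (simp_all add: cof_mult)

text \<open>
  If a linear map sends an orthonormal pair to \<open>x\<close>, \<open>y\<close>, this is the square root of the derivative
  of the induced map on lines at the line of the first vector of the pair.
\<close>

definition root_contraction :: "real^3 \<Rightarrow> real^3 \<Rightarrow> ennreal"
  where "root_contraction x y = ennreal (sqrt (norm (cross3 x y)) / norm x)"

lemma flag_density_root_contraction: "flag_density root_contraction"
  unfolding flag_density_def
proof (intro conjI allI impI)
  have "continuous_on UNIV (\<lambda>p :: (real^3) \<times> (real^3). cross3 (fst p) (snd p))"
    by (intro continuous_on_cross continuous_intros)
  then have [measurable]: "(\<lambda>p :: (real^3) \<times> (real^3). cross3 (fst p) (snd p)) \<in> borel_measurable (borel \<Otimes>\<^sub>M borel)"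
    unfolding borel_prod by (rule borel_measurable_continuous_onI)
  show "(\<lambda>p. root_contraction (fst p) (snd p)) \<in> borel_measurable (borel \<Otimes>\<^sub>M borel)"
    unfolding root_contraction_def by measurable
  fix a b c :: real and x y :: "real^3"
  show "root_contraction x y = 0" if "cross3 x y = 0"
    using that by (simp add: root_contraction_def)
  assume "a \<noteq> 0" "c \<noteq> 0"
  have "sqrt (norm (cross3 (a *\<^sub>R x) (b *\<^sub>R x + c *\<^sub>R y))) / norm (a *\<^sub>R x) = sqrt \<bar>c / a\<bar> * (sqrt (norm (cross3 x y)) / norm x)"
  proof -
    define r where "r = sqrt \<bar>a\<bar>"
    have r: "r \<noteq> 0" using \<open>a \<noteq> 0\<close> by (simp add: r_def)
    have "sqrt (norm (cross3 (a *\<^sub>R x) (b *\<^sub>R x + c *\<^sub>R y))) = r * sqrt \<bar>c\<bar> * sqrt (norm (cross3 x y))"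
      by (simp add: cross_add_right cross_mult_left cross_mult_right real_sqrt_mult abs_mult r_def)
    moreover have "norm (a *\<^sub>R x) = (r * r) * norm x" by (simp add: r_def)
    moreover have "sqrt \<bar>c / a\<bar> = sqrt \<bar>c\<bar> / r" by (simp add: real_sqrt_divide abs_divide r_def)
    ultimately show ?thesis
      using r by (simp only:) (simp add: field_simps)
  qed
  then show "root_contraction (a *\<^sub>R x) (b *\<^sub>R x + c *\<^sub>R y) = ennreal (sqrt \<bar>c / a\<bar>) * root_contraction x y"
    unfolding root_contraction_def by (simp flip: ennreal_mult)
qed

text \<open>
  The number \<open>\<pi>\<close>, the energy of \<open>root_contraction\<close> on every plane.
\<close>

definition cauchy_mass :: ennreal
  where "cauchy_mass = (\<integral>\<^sup>+t. ennreal (inverse (1 + t\<^sup>2)) \<partial>lborel)"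

lemma cauchy_mass_finite: "cauchy_mass < \<infinity>"
proof -
  have "integrable lborel (\<lambda>t :: real. inverse (1 + t\<^sup>2))"
    using integrable_inverse_1_plus_square by (simp add: set_integrable_def)
  then have "(\<integral>\<^sup>+t. ennreal (norm (inverse (1 + t\<^sup>2 :: real))) \<partial>lborel) < \<infinity>"
    by (simp add: integrable_iff_bounded)
  then show ?thesis
    by (simp add: cauchy_mass_def add_nonneg_pos abs_of_nonneg)
qed

lemma fibre_root_contraction_le: "fibre_energy root_contraction u v \<le> cauchy_mass"
proof (cases "cross3 u v = 0")
  case True
  then show ?thesis using fibre_dependent[OF flag_density_root_contraction] by simp
next
  case False
  then obtain p q where on: "orthonormal p q" and eq: "fibre_energy root_contraction u v = fibre_energy root_contraction p q"
    using orthonormal_basis_of_plane flag_density_root_contraction by metis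
  have "(root_contraction (p + t *\<^sub>R q) q)\<^sup>2 = ennreal (inverse (1 + t\<^sup>2))" for t
  proof -
    have "(norm (cross3 p q))\<^sup>2 = 1"
      using norm_cross_dot[of p q] on by (simp add: orthonormal_def)
    then have "norm (cross3 p q) = 1" by (simp add: power2_eq_1_iff) (smt (verit) norm_ge_zero)
    moreover have "norm (p + t *\<^sub>R q) = sqrt (1 + t\<^sup>2)"
      using norm_orthonormal_combination[OF on, of 1 t] by simp
    ultimately show ?thesis
      by (simp add: root_contraction_def cross_add_left cross_mult_left ennreal_power power_divide inverse_eq_divide add_nonneg_nonneg)
  qed
  then show ?thesis
    unfolding eq by (simp add: fibre_energy_def cauchy_mass_def)
qed

section \<open>Products of independent noisy matrices\<close>

lemma nn_integral_affine_uniform_cube: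
  assumes e: "0 < e" and [measurable]: "\<phi> \<in> borel_measurable borel"
  shows "(\<integral>\<^sup>+X. \<phi> (A + e *\<^sub>R X) \<partial>uniform_measure lborel (cube 0 1)) = (\<integral>\<^sup>+M. \<phi> M \<partial>uniform_measure lborel (cube A e))"
proof -
  have ind: "indicator (cube A e) (A + e *\<^sub>R X) = (indicator (cube 0 1) X :: ennreal)" for X
  proof -
    have "\<bar>e * x\<bar> \<le> e \<longleftrightarrow> \<bar>x\<bar> \<le> 1" for x
      using e mult_le_cancel_left_pos[of e "\<bar>x\<bar>" 1] by (simp add: abs_mult)
    then show ?thesis by (simp add: indicator_def cube_def)
  qed
  have "(\<integral>\<^sup>+M. \<phi> M * indicator (cube A e) M \<partial>lborel)
    = ennreal (e ^ 9) * (\<integral>\<^sup>+X. \<phi> (A + e *\<^sub>R X) * indicator (cube 0 1) X \<partial>lborel)"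
    using e by (subst nn_integral_lborel_affine[of _ e A]) (simp_all add: ind)
  then have "(\<integral>\<^sup>+M. \<phi> M \<partial>uniform_measure lborel (cube A e))
    = ennreal (e ^ 9) * (\<integral>\<^sup>+X. \<phi> (A + e *\<^sub>R X) * indicator (cube 0 1) X \<partial>lborel) / ennreal ((2 * e) ^ 9)"
    using e by (subst nn_integral_uniform_measure) (simp_all add: emeasure_cube)
  also have "\<dots> = (ennreal (e ^ 9) / ennreal ((2 * e) ^ 9)) * (\<integral>\<^sup>+X. \<phi> (A + e *\<^sub>R X) * indicator (cube 0 1) X \<partial>lborel)"
    by (simp add: divide_ennreal_def mult_ac)
  also have "ennreal (e ^ 9) / ennreal ((2 * e) ^ 9) = inverse (ennreal (2 ^ 9))"
  proof -
    have "e ^ 9 / (2 * e) ^ 9 = inverse (2 ^ 9)"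
      using e by (simp add: power_mult_distrib field_simps)
    then show ?thesis
      using e by (subst divide_ennreal) (simp_all add: inverse_ennreal del: ennreal_numeral power_numeral)
  qed
  also have "\<dots> * (\<integral>\<^sup>+X. \<phi> (A + e *\<^sub>R X) * indicator (cube 0 1) X \<partial>lborel) = (\<integral>\<^sup>+X. \<phi> (A + e *\<^sub>R X) \<partial>uniform_measure lborel (cube 0 1))"
    using emeasure_cube[of 1 0] by (subst nn_integral_uniform_measure) (simp_all add: divide_ennreal_def mult.commute)
  finally show ?thesis ..
qed

lemma perturbed_product_cong:
  assumes "\<And>k. 1 \<le> k \<Longrightarrow> k \<le> n \<Longrightarrow> X k = Y k"
  shows "perturbed_product A e X n = perturbed_product A e Y n"
  using assms by (induction n) simp_all

lemma measurable_perturbed_product: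
  assumes "\<And>k. 1 \<le> k \<Longrightarrow> k \<le> n \<Longrightarrow> (\<lambda>\<omega>. X \<omega> k) \<in> borel_measurable N"
  shows "(\<lambda>\<omega>. perturbed_product A e (X \<omega>) n) \<in> borel_measurable N"
  using assms
proof (induction n)
  case (Suc n)
  then have [measurable]: "(\<lambda>\<omega>. perturbed_product A e (X \<omega>) n) \<in> borel_measurable N" "(\<lambda>\<omega>. X \<omega> (Suc n)) \<in> borel_measurable N"
    by simp_all
  show ?case by simp
qed simp

text \<open>
  The norm bound on the \<open>A\<^sub>n\<close> enters as a bound on their entries, which fits the cubes.
\<close>
locale noisy_products = prob_space M for M :: "'w measure" +
  fixes \<Xi> :: "nat \<Rightarrow> 'w \<Rightarrow> real^3^3" and e :: real and A :: "nat \<Rightarrow> real^3^3"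
  assumes iid: "iid_uniform_matrices M \<Xi>"
    and e: "0 < e" "e < 1"
    and A_entry: "\<And>n i j. 1 \<le> n \<Longrightarrow> \<bar>A n $ i $ j\<bar> \<le> 1"
begin

abbreviation P :: "nat \<Rightarrow> 'w \<Rightarrow> real^3^3"
  where "P n \<omega> \<equiv> perturbed_product A e (\<lambda>k. \<Xi> k \<omega>) n"

lemma indep: "indep_vars (\<lambda>_. borel) \<Xi> {1..}"
  using iid by (simp add: iid_uniform_matrices_def)

lemma measurable_noise [measurable]: "1 \<le> n \<Longrightarrow> \<Xi> n \<in> borel_measurable M"
  using indep by (auto simp: indep_vars_def)

lemma measurable_P [measurable]: "P n \<in> borel_measurable M"
  by (rule measurable_perturbed_product) simp

lemma distr_noise: "1 \<le> n \<Longrightarrow> distr M borel (\<Xi> n) = uniform_measure lborel (cube 0 1)"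
  using iid by (intro distr_uniform_entries) (auto simp: iid_uniform_matrices_def prob_space_axioms)

lemma indep_noise_product: "indep_var borel (\<Xi> (Suc n)) borel (P n)"
proof -
  have "indep_var (PiM {Suc n} (\<lambda>_. borel)) (\<lambda>\<omega>. restrict (\<lambda>k. \<Xi> k \<omega>) {Suc n})
      (PiM {1..n} (\<lambda>_. borel)) (\<lambda>\<omega>. restrict (\<lambda>k. \<Xi> k \<omega>) {1..n})"
    by (rule indep_var_restrict[OF indep]) auto
  then have "indep_var borel ((\<lambda>f. f (Suc n)) \<circ> (\<lambda>\<omega>. restrict (\<lambda>k. \<Xi> k \<omega>) {Suc n}))
      borel ((\<lambda>f. perturbed_product A e f n) \<circ> (\<lambda>\<omega>. restrict (\<lambda>k. \<Xi> k \<omega>) {1..n}))"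
    by (rule indep_var_compose) (auto intro!: measurable_perturbed_product)
  moreover have "(\<lambda>f. perturbed_product A e f n) \<circ> (\<lambda>\<omega>. restrict (\<lambda>k. \<Xi> k \<omega>) {1..n}) = P n"
    by (auto simp: fun_eq_iff intro!: perturbed_product_cong)
  moreover have "(\<lambda>f. f (Suc n)) \<circ> (\<lambda>\<omega>. restrict (\<lambda>k. \<Xi> k \<omega>) {Suc n}) = \<Xi> (Suc n)"
    by (auto simp: fun_eq_iff)
  ultimately show ?thesis by simp
qed

lemma nn_integral_noise:
  assumes "1 \<le> n" and [measurable]: "\<phi> \<in> borel_measurable borel"
  shows "(\<integral>\<^sup>+\<omega>. \<phi> (A n + e *\<^sub>R \<Xi> n \<omega>) \<partial>M) = (\<integral>\<^sup>+M. \<phi> M \<partial>uniform_measure lborel (cube (A n) e))"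
proof -
  have "(\<integral>\<^sup>+\<omega>. \<phi> (A n + e *\<^sub>R \<Xi> n \<omega>) \<partial>M) = (\<integral>\<^sup>+X. \<phi> (A n + e *\<^sub>R X) \<partial>distr M borel (\<Xi> n))"
    using assms(1) by (subst nn_integral_distr) auto
  then show ?thesis
    using assms e by (simp add: distr_noise nn_integral_affine_uniform_cube)
qed

lemma nn_integral_next_product:
  assumes h: "(\<lambda>z. h (fst z) (snd z)) \<in> borel_measurable (borel \<Otimes>\<^sub>M borel)"
  shows "(\<integral>\<^sup>+\<omega>. h (A (Suc n) + e *\<^sub>R \<Xi> (Suc n) \<omega>) (P n \<omega>) \<partial>M)
    = (\<integral>\<^sup>+\<omega>. (\<integral>\<^sup>+B. h B (P n \<omega>) \<partial>uniform_measure lborel (cube (A (Suc n)) e)) \<partial>M)"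
proof -
  let ?X = "distr M borel (\<Xi> (Suc n))" and ?Y = "distr M borel (P n)"
  interpret X: prob_space ?X by (rule prob_space_distr) simp
  interpret Y: prob_space ?Y by (rule prob_space_distr) simp
  interpret XY: pair_sigma_finite ?X ?Y ..
  have h': "(\<lambda>x. h (f x) (g x)) \<in> borel_measurable N"
    if [measurable]: "f \<in> borel_measurable N" "g \<in> borel_measurable N" for f g N
    using measurable_compose[OF _ h, of "\<lambda>x. (f x, g x)" N] by simp
  have m: "(\<lambda>z. h (A (Suc n) + e *\<^sub>R fst z) (snd z)) \<in> borel_measurable (?X \<Otimes>\<^sub>M ?Y)"
    by (rule h') measurable
  have m1: "(\<lambda>x. h x y) \<in> borel_measurable borel" for y
    by (rule h') measurable
  have m3: "(\<lambda>z. h (A (Suc n) + e *\<^sub>R snd z) (fst z)) \<in> borel_measurable (borel \<Otimes>\<^sub>M ?X)"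
    by (rule h') measurable
  have noise: "(\<integral>\<^sup>+x. h (A (Suc n) + e *\<^sub>R x) y \<partial>?X) = (\<integral>\<^sup>+B. h B y \<partial>uniform_measure lborel (cube (A (Suc n)) e))" for y
    using nn_integral_affine_uniform_cube[OF e(1) m1] by (simp add: distr_noise)
  have m2: "(\<lambda>z. h (A (Suc n) + e *\<^sub>R fst z) (snd z)) \<in> borel_measurable (borel \<Otimes>\<^sub>M borel)"
    by (rule h') measurable
  have "(\<integral>\<^sup>+\<omega>. h (A (Suc n) + e *\<^sub>R \<Xi> (Suc n) \<omega>) (P n \<omega>) \<partial>M)
    = (\<integral>\<^sup>+z. h (A (Suc n) + e *\<^sub>R fst z) (snd z) \<partial>distr M (borel \<Otimes>\<^sub>M borel) (\<lambda>\<omega>. (\<Xi> (Suc n) \<omega>, P n \<omega>)))"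
    using m2 by (subst nn_integral_distr) simp_all
  also have "\<dots> = (\<integral>\<^sup>+z. h (A (Suc n) + e *\<^sub>R fst z) (snd z) \<partial>(?X \<Otimes>\<^sub>M ?Y))"
    using indep_noise_product[of n] unfolding indep_var_distribution_eq by simp
  also have "\<dots> = (\<integral>\<^sup>+y. \<integral>\<^sup>+x. h (A (Suc n) + e *\<^sub>R x) y \<partial>?X \<partial>?Y)"
    using XY.nn_integral_snd[OF m] by simp
  also have "\<dots> = (\<integral>\<^sup>+y. (\<integral>\<^sup>+B. h B y \<partial>uniform_measure lborel (cube (A (Suc n)) e)) \<partial>?Y)"
    by (simp only: noise)
  also have "\<dots> = (\<integral>\<^sup>+\<omega>. (\<integral>\<^sup>+B. h B (P n \<omega>) \<partial>uniform_measure lborel (cube (A (Suc n)) e)) \<partial>M)"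
  proof (rule nn_integral_distr)
    have "(\<lambda>y. \<integral>\<^sup>+x. h (A (Suc n) + e *\<^sub>R x) y \<partial>?X) \<in> borel_measurable borel"
      using X.borel_measurable_nn_integral[of "\<lambda>y x. h (A (Suc n) + e *\<^sub>R x) y" borel] m3
      by (simp add: case_prod_unfold)
    then show "(\<lambda>y. \<integral>\<^sup>+B. h B y \<partial>uniform_measure lborel (cube (A (Suc n)) e)) \<in> borel_measurable ?Y"
      by (simp only: noise measurable_distr_eq1)
  qed simp
  finally show ?thesis .
qed

end

text \<open>
  The induction removes the last factor: by independence it replaces \<open>F\<close> by its transfer, whose energies
  are smaller by the contraction factor. The first factor is the one that remains, and it supplies
  the pointwise bound.
\<close>

lemma (in matrix_action) nn_integral_products_le:
  assumes "noisy_products M \<Xi> e A" and F: "flag_density F" and b: "\<And>u v. fibre_energy F u v \<le> b" and on: "orthonormal x y"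
  shows "(\<integral>\<^sup>+\<omega>. F (\<kappa> (perturbed_product A e (\<lambda>k. \<Xi> k \<omega>) (Suc n)) *v x) (\<kappa> (perturbed_product A e (\<lambda>k. \<Xi> k \<omega>) (Suc n)) *v y) \<partial>M)\<^sup>2
    \<le> ennreal ((12 / e) ^ 18) * (ennreal (1 - e\<^sup>2 / 8192000) ^ n * b)"
  using F b
proof (induction n arbitrary: F b)
  note [measurable] = measurable_action
  interpret noisy_products M \<Xi> e A by fact
  case 0
  have m: "(\<lambda>B. F (\<kappa> B *v x) (\<kappa> B *v y)) \<in> borel_measurable borel"
    by (rule flag_density_measurable[OF 0(1)]) measurable
  have "(\<integral>\<^sup>+\<omega>. F (\<kappa> (P (Suc 0) \<omega>) *v x) (\<kappa> (P (Suc 0) \<omega>) *v y) \<partial>M) = transfer e (A 1) F x y"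
    using nn_integral_noise[OF _ m, of 1] by (simp add: transfer_def)
  then show ?case
    using transfer_square_le[OF 0(1) 0(2) on e A_entry[of 1]] by simp
next
  note [measurable] = measurable_action
  interpret noisy_products M \<Xi> e A by fact
  case (Suc n)
  let ?n = "Suc (Suc n)"
  let ?h = "\<lambda>B C. F (\<kappa> (B ** C) *v x) (\<kappa> (B ** C) *v y)"
  have m: "(\<lambda>z. ?h (fst z) (snd z)) \<in> borel_measurable (borel \<Otimes>\<^sub>M borel)"
    by (rule flag_density_measurable[OF Suc.prems(1)]) measurable
  have "(\<integral>\<^sup>+\<omega>. F (\<kappa> (P ?n \<omega>) *v x) (\<kappa> (P ?n \<omega>) *v y) \<partial>M)
    = (\<integral>\<^sup>+\<omega>. transfer e (A ?n) F (\<kappa> (P (Suc n) \<omega>) *v x) (\<kappa> (P (Suc n) \<omega>) *v y) \<partial>M)"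
    using nn_integral_next_product[OF m, of "Suc n"]
    by (simp add: transfer_def action_mult flip: matrix_vector_mul_assoc del: perturbed_product.simps(2)
        add: perturbed_product.simps(2)[of A e _ "Suc n"])
  also have "\<dots>\<^sup>2 \<le> ennreal ((12 / e) ^ 18) * (ennreal (1 - e\<^sup>2 / 8192000) ^ n * (ennreal (1 - e\<^sup>2 / 8192000) * b))"
    by (intro Suc.IH flag_density_transfer fibre_transfer_le Suc.prems e A_entry) simp
  finally show ?case by (simp add: mult_ac)
qed

section \<open>Singular values\<close>

lemma det_mat_minus_3:
  fixes A :: "'a::comm_ring_1^3^3"
  shows "det (mat x - A) = x ^ 3 - (A$1$1 + A$2$2 + A$3$3) * x\<^sup>2
    + (A$1$1 * A$2$2 - A$1$2 * A$2$1 + (A$1$1 * A$3$3 - A$1$3 * A$3$1) + (A$2$2 * A$3$3 - A$2$3 * A$3$2)) * x - det A"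
  by (simp add: det_3 mat_def power2_eq_square power3_eq_cube algebra_simps)

lemma cubic_real_root:
  fixes t e D :: real
  assumes "0 \<le> t" "0 \<le> e" "0 \<le> D"
  obtains a where "a ^ 3 - t * a\<^sup>2 + e * a - D = 0"
proof -
  \<comment> \<open>At \<open>L\<close> the cubic is positive because \<open>L - t \<ge> 1 + D\<close>.\<close>
  define L where "L = 1 + t + D"
  let ?p = "\<lambda>x. x ^ 3 - t * x\<^sup>2 + e * x - D"
  have L: "1 \<le> L" using assms by (simp add: L_def)
  define X where "X = L\<^sup>2 * (1 + D)"
  define Y where "Y = e * L"
  have "?p L = X + Y - D"
    unfolding X_def Y_def by (simp add: L_def power2_eq_square power3_eq_cube algebra_simps)
  moreover have "1 + D \<le> X"
    using mult_right_mono[of 1 "L\<^sup>2" "1 + D"] L assms by (simp add: X_def one_le_power)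
  moreover have "0 \<le> Y" using assms L by (simp add: Y_def)
  ultimately have "0 \<le> ?p L" by linarith
  moreover have "?p 0 \<le> 0" using assms by simp
  moreover have "continuous_on {0..L} ?p" by (intro continuous_intros)
  ultimately obtain a where "?p a = 0"
    using IVT'[of ?p 0 0 L] L by auto
  then show ?thesis using that by blast
qed

text \<open>
  With an eigenvector \<open>u + \<i> v\<close>, symmetry of \<open>S\<close> gives \<open>Im z (|u|\<^sup>2 + |v|\<^sup>2) = 0\<close>.
\<close>

lemma symmetric_no_complex_eigenvalue:
  fixes S :: "real^3^3"
  assumes sym: "transpose S = S"
    and z: "det (mat z - (\<chi> i j. complex_of_real (S $ i $ j))) = 0"
  shows "Im z = 0"
proof -
  let ?S = "\<chi> i j. complex_of_real (S $ i $ j)"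
  have "\<not> invertible (mat z - ?S)"
    using z by (simp add: invertible_det_nz)
  then obtain w where w: "w \<noteq> 0" "(mat z - ?S) *v w = 0"
    by (metis invertible_left_inverse matrix_left_invertible_ker)
  define u where "u = (\<chi> i. Re (w $ i))"
  define v where "v = (\<chi> i. Im (w $ i))"
  have "((mat z - ?S) *v w) $ i = z * w $ i - (?S *v w) $ i" for i
    by (simp add: matrix_vector_mult_def mat_def left_diff_distrib sum_subtractf if_distrib[of "\<lambda>x. x * _"] cong: if_cong)
  then have eig: "(?S *v w) $ i = z * w $ i" for i
    using w(2) by (simp add: vec_eq_iff)
  have "(S *v u) $ i = Re ((?S *v w) $ i)" "(S *v v) $ i = Im ((?S *v w) $ i)" for i
    by (simp_all add: matrix_vector_mult_def u_def v_def)
  then have Su: "S *v u = Re z *\<^sub>R u - Im z *\<^sub>R v" and Sv: "S *v v = Re z *\<^sub>R v + Im z *\<^sub>R u"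
    by (simp_all add: vec_eq_iff eig u_def v_def)
  have "u \<bullet> (S *v v) = (S *v u) \<bullet> v"
    using sym by (metis dot_lmul_matrix transpose_matrix_vector)
  then have "Im z * (u \<bullet> u + v \<bullet> v) = 0"
    unfolding Su Sv by (simp add: inner_add_right inner_diff_left algebra_simps)
  moreover have "u \<bullet> u + v \<bullet> v \<noteq> 0"
  proof
    assume "u \<bullet> u + v \<bullet> v = 0"
    then have "u = 0" "v = 0"
      by (simp_all add: add_nonneg_eq_0_iff)
    then have "w = 0" by (simp add: u_def v_def vec_eq_iff complex_eq_iff)
    with w show False by simp
  qed
  ultimately show ?thesis by simp
qed

text \<open>
  The cubic has a real root by the intermediate value theorem; a negative discriminant of the
  remaining quadratic would produce a complex eigenvalue.
\<close>

lemma symmetric_charpoly_splits: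
  fixes S :: "real^3^3"
  assumes sym: "transpose S = S"
    and p: "\<And>x. det (mat x - S) = x ^ 3 - t * x\<^sup>2 + e * x - D"
    and nonneg: "0 \<le> t" "0 \<le> e" "0 \<le> D"
  obtains a b c where "t = a + b + c" "e = a * b + a * c + b * c" "D = a * b * c"
proof -
  obtain a where a: "a ^ 3 - t * a\<^sup>2 + e * a - D = 0"
    using cubic_real_root[OF nonneg] by blast
  define q1 where "q1 = a - t"
  define q0 where "q0 = e + a * q1"
  have D: "D = a * q0"
    using a by (simp add: q0_def q1_def power2_eq_square power3_eq_cube algebra_simps)
  have "0 \<le> q1\<^sup>2 - 4 * q0"
  proof (rule ccontr)
    assume neg: "\<not> 0 \<le> q1\<^sup>2 - 4 * q0"
    define r where "r = sqrt (4 * q0 - q1\<^sup>2) / 2"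
    have r: "r\<^sup>2 = q0 - q1\<^sup>2 / 4" "0 < r"
      using neg by (simp_all add: r_def power_divide)
    define z where "z = Complex (- q1 / 2) r"
    have zq: "z\<^sup>2 + of_real q1 * z + of_real q0 = 0"
      using r(1) by (simp add: z_def complex_eq_iff power2_eq_square field_simps)
    let ?S = "\<chi> i j. complex_of_real (S $ i $ j)"
    have coeffs: "S$1$1 + S$2$2 + S$3$3 = t"
      "S$1$1 * S$2$2 - S$1$2 * S$2$1 + (S$1$1 * S$3$3 - S$1$3 * S$3$1) + (S$2$2 * S$3$3 - S$2$3 * S$3$2) = e" "det S = D"
    proof -
      let ?t = "S$1$1 + S$2$2 + S$3$3"
      let ?e = "S$1$1 * S$2$2 - S$1$2 * S$2$1 + (S$1$1 * S$3$3 - S$1$3 * S$3$1) + (S$2$2 * S$3$3 - S$2$3 * S$3$2)"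
      have *: "x ^ 3 - ?t * x\<^sup>2 + ?e * x - det S = x ^ 3 - t * x\<^sup>2 + e * x - D" for x
        using p[of x] unfolding det_mat_minus_3 .
      show d: "det S = D" using *[of 0] by simp
      show "?t = t" "?e = e"
        using *[of 1] *[of "-1"] d by simp_all
    qed
    have "det ?S = of_real (det S)"
      by (simp add: det_3)
    then have "det (mat z - ?S) = z ^ 3 - of_real t * z\<^sup>2 + of_real e * z - of_real D"
      unfolding det_mat_minus_3 by (simp flip: coeffs)
    also have "\<dots> = (z - of_real a) * (z\<^sup>2 + of_real q1 * z + of_real q0)"
      unfolding D by (simp add: q0_def q1_def power2_eq_square power3_eq_cube algebra_simps)
    finally have "det (mat z - ?S) = 0" by (simp add: zq)
    then have "Im z = 0" by (rule symmetric_no_complex_eigenvalue[OF sym])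
    then show False using r by (simp add: z_def)
  qed
  then have s: "(sqrt (q1\<^sup>2 - 4 * q0))\<^sup>2 = q1\<^sup>2 - 4 * q0" by simp
  define b where "b = (- q1 + sqrt (q1\<^sup>2 - 4 * q0)) / 2"
  define c where "c = (- q1 - sqrt (q1\<^sup>2 - 4 * q0)) / 2"
  have bc: "b + c = - q1" "b * c = q0"
    using s by (simp_all add: b_def c_def power2_eq_square field_simps)
  show ?thesis
  proof (rule that[of a b c])
    show "t = a + b + c" using bc by (simp add: q1_def)
    have "a * b + a * c + b * c = a * (b + c) + b * c" by (simp add: algebra_simps)
    then show "e = a * b + a * c + b * c" unfolding bc by (simp add: q0_def)
    show "D = a * b * c" using D bc(2) by (simp add: mult.assoc)
  qed
qed

lemma sort_three:
  fixes a b c :: real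
  assumes "P a b c" "\<And>a b c. P a b c \<Longrightarrow> P b a c" "\<And>a b c. P a b c \<Longrightarrow> P a c b"
  obtains a' b' c' where "P a' b' c'" "b' \<le> a'" "c' \<le> b'"
  using assms by (metis linear)

lemma trace_gram: "trace (transpose M ** M) = (norm (M :: real^'n^'n))\<^sup>2"
  unfolding trace_def matrix_matrix_mult_def transpose_def norm_vec_def L2_set_def
  by (simp add: sum_nonneg power2_eq_square[symmetric]) (rule sum.swap)

lemma cof_transpose: "cof (transpose A) = transpose (cof A)"
  by (simp add: vec_eq_iff forall_3 cof_nth cross3_def vector_def transpose_def algebra_simps)

text \<open>
  The coefficients of the characteristic polynomial of \<open>M\<^sup>T M\<close> are the squares of \<open>|M|\<close>, \<open>|cof M|\<close> and
  \<open>det M\<close> up to sign, so these are the elementary symmetric functions of the squared singular values.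
\<close>

lemma singular_values_3:
  fixes M :: "real^3^3"
  obtains a b c where
    "0 \<le> c" "c \<le> b" "b \<le> a"
    "a + b + c = (norm M)\<^sup>2" "a * b + a * c + b * c = (norm (cof M))\<^sup>2" "a * b * c = (det M)\<^sup>2"
    "singular_values M = [sqrt a, sqrt b, sqrt c]"
proof -
  define S where "S = transpose M ** M"
  define t where "t = (norm M)\<^sup>2"
  define e where "e = (norm (cof M))\<^sup>2"
  define D where "D = (det M)\<^sup>2"
  have sym: "transpose S = S"
    by (simp add: S_def matrix_transpose_mul)
  have p: "det (mat x - S) = x ^ 3 - t * x\<^sup>2 + e * x - D" for x
  proof -
    have "S$1$1 + S$2$2 + S$3$3 = t"
      using trace_gram[of M] by (simp add: t_def S_def trace_def sum_3)
    moreover have "S$1$1 * S$2$2 - S$1$2 * S$2$1 + (S$1$1 * S$3$3 - S$1$3 * S$3$1) + (S$2$2 * S$3$3 - S$2$3 * S$3$2) = e"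
    proof -
      have "trace (cof S) = e"
        using trace_gram[of "cof M"] by (simp add: e_def S_def cof_mult cof_transpose)
      then show ?thesis
        by (simp add: trace_def sum_3 cof_nth cross3_def vector_def algebra_simps)
    qed
    moreover have "det S = D"
      by (simp add: S_def D_def det_mul power2_eq_square)
    ultimately show ?thesis unfolding det_mat_minus_3 by simp
  qed
  have nonneg: "0 \<le> t" "0 \<le> e" "0 \<le> D" by (simp_all add: t_def e_def D_def)
  obtain a b c where abc: "t = a + b + c \<and> e = a * b + a * c + b * c \<and> D = a * b * c" "b \<le> a" "c \<le> b"
  proof -
    obtain a b c where "t = a + b + c \<and> e = a * b + a * c + b * c \<and> D = a * b * c"
      using symmetric_charpoly_splits[OF sym p nonneg] by metis
    then show ?thesis
      by (rule sort_three[of "\<lambda>a b c. t = a + b + c \<and> e = a * b + a * c + b * c \<and> D = a * b * c"])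
        (use that in \<open>auto simp: algebra_simps\<close>)
  qed
  have "0 \<le> c"
  proof (rule ccontr)
    assume "\<not> 0 \<le> c"
    then have "c ^ 3 < 0" "t * c\<^sup>2 \<ge> 0" "e * c \<le> 0"
      using nonneg by (simp_all add: mult_nonneg_nonpos)
    moreover have "c ^ 3 - t * c\<^sup>2 + e * c - D = 0"
      using abc(1) by (simp add: power2_eq_square power3_eq_cube algebra_simps)
    ultimately show False using nonneg by linarith
  qed
  have "charpoly S = [:- a, 1:] * [:- b, 1:] * [:- c, 1:]"
  proof (rule poly_eq_poly_eq_iff[THEN iffD1], rule ext)
    show "poly (charpoly S) x = poly ([:- a, 1:] * [:- b, 1:] * [:- c, 1:]) x" for x
      using abc(1) unfolding poly_charpoly p by (simp add: power2_eq_square power3_eq_cube algebra_simps)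
  qed
  then have "proots (charpoly S) = {#a, b, c#}"
  proof -
    have "proots ([:- a, 1:] * [:- b, 1:] * [:- c, 1:]) = proots [:- a, 1:] + proots [:- b, 1:] + proots [:- c, 1:]"
    proof -
      have "[:- x, 1:] \<noteq> 0" for x :: real by simp
      then show ?thesis by (simp only: proots_mult mult_eq_0_iff simp_thms)
    qed
    then show ?thesis using \<open>charpoly S = _\<close> by simp
  qed
  then have "singular_values M = rev (sorted_list_of_multiset (mset [sqrt c, sqrt b, sqrt a]))"
    by (simp add: singular_values_def S_def add_mset_commute)
  also have "\<dots> = [sqrt a, sqrt b, sqrt c]"
    using abc by (simp only: sorted_list_of_multiset_mset) (simp add: sorted_sort_id)
  finally show ?thesis
    using that[of c b a] \<open>0 \<le> c\<close> abc by (simp add: t_def e_def D_def)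
qed

definition gap_ratio :: "real^3^3 \<Rightarrow> real"
  where "gap_ratio K = (norm K)\<^sup>2 / norm (cof K)"

text \<open>
  The matrix whose first gap is the \<open>j\<close>-th gap.
\<close>

definition gap_action :: "nat \<Rightarrow> real^3^3 \<Rightarrow> real^3^3"
  where "gap_action j = (if j = 1 then (\<lambda>M. M) else cof)"

lemma abs_ln_diff_le:
  fixes r q :: real
  assumes "0 < r" "0 < q" "r\<^sup>2 \<le> 9 * q\<^sup>2" "q\<^sup>2 \<le> 9 * r\<^sup>2"
  shows "\<bar>ln r - ln q\<bar> \<le> ln 3"
proof -
  have "r\<^sup>2 \<le> (3 * q)\<^sup>2" "q\<^sup>2 \<le> (3 * r)\<^sup>2" using assms by (simp_all add: power_mult_distrib)
  then have "r \<le> 3 * q" "q \<le> 3 * r" 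
    using assms by (auto intro: power2_le_imp_le)
  then have "ln r \<le> ln (3 * q)" "ln q \<le> ln (3 * r)" using assms by simp_all
  then show ?thesis using assms by (simp add: ln_mult abs_le_iff)
qed

text \<open>
  Each elementary symmetric function of \<open>a \<ge> b \<ge> c\<close> lies between its largest term and three
  times that term.
\<close>

lemma singular_value_ratio:
  fixes M :: "real^3^3"
  assumes M: "det M \<noteq> 0" and j: "j \<in> {1, 2}"
  shows "\<bar>ln (singular_value j M / singular_value (j + 1) M) - ln (gap_ratio (gap_action j M))\<bar> \<le> ln 3"
proof -
  obtain a b c where s: "0 \<le> c" "c \<le> b" "b \<le> a"
    "a + b + c = (norm M)\<^sup>2" "a * b + a * c + b * c = (norm (cof M))\<^sup>2" "a * b * c = (det M)\<^sup>2"
    and sv: "singular_values M = [sqrt a, sqrt b, sqrt c]"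
    by (rule singular_values_3[of M])
  have "a * b * c \<noteq> 0" using M s(6) by simp
  then have "a \<noteq> 0" "b \<noteq> 0" "c \<noteq> 0" by auto
  then have pos: "0 < a" "0 < b" "0 < c" using s(1-3) by linarith+
  define t where "t = (norm M)\<^sup>2"
  define e where "e = (norm (cof M))\<^sup>2"
  have t: "a \<le> t" "t \<le> 3 * a" using s pos unfolding t_def by linarith+
  have "a * c \<le> a * b" "b * c \<le> a * b" using s pos by (auto intro: mult_mono simp: mult.commute[of a b])
  then have e: "a * b \<le> e" "e \<le> 3 * (a * b)"
    using s pos mult_pos_pos[of a c] mult_pos_pos[of b c] unfolding e_def by linarith+
  have t0: "0 < t" and e0: "0 < e" using t e pos by (auto intro: less_le_trans mult_pos_pos)
  have M0: "0 < norm M" and cM0: "0 < norm (cof M)" using t0 e0 by (auto simp: t_def e_def)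
  show ?thesis
  proof (cases "j = 1")
    case True
    have "t\<^sup>2 \<le> (3 * a)\<^sup>2" "a\<^sup>2 \<le> t\<^sup>2" using t pos by (simp_all only: power_mono less_imp_le t0)
    moreover have q: "(gap_ratio M)\<^sup>2 = t\<^sup>2 / e"
      by (simp add: gap_ratio_def t_def e_def power_divide)
    ultimately
    have "a\<^sup>2 / (3 * (a * b)) \<le> (gap_ratio M)\<^sup>2" "(gap_ratio M)\<^sup>2 \<le> (3 * a)\<^sup>2 / (a * b)"
      using e e0 pos unfolding q by (auto intro!: frac_le)
    moreover have "a\<^sup>2 / (3 * (a * b)) = (a / b) / 3" "(3 * a)\<^sup>2 / (a * b) = 9 * (a / b)"
      using pos by (simp_all add: power2_eq_square)
    ultimately have "(sqrt a / sqrt b)\<^sup>2 \<le> 9 * (gap_ratio M)\<^sup>2" "(gap_ratio M)\<^sup>2 \<le> 9 * (sqrt a / sqrt b)\<^sup>2"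
      using pos zero_le_power2[of "gap_ratio M"] by (simp_all add: power_divide)
    then have "\<bar>ln (sqrt a / sqrt b) - ln (gap_ratio M)\<bar> \<le> ln 3"
      using pos M0 cM0 by (intro abs_ln_diff_le) (auto simp: gap_ratio_def)
    then show ?thesis using True by (simp add: singular_value_def sv gap_action_def)
  next
    case False
    with j have j: "j = 2" by simp
    have "e\<^sup>2 \<le> (3 * (a * b))\<^sup>2" "(a * b)\<^sup>2 \<le> e\<^sup>2" using e pos by (simp_all only: power_mono less_imp_le e0 mult_pos_pos)
    moreover have q: "(gap_ratio (cof M))\<^sup>2 = e\<^sup>2 / (a * b * c * t)"
      using s(6) by (simp add: gap_ratio_def t_def e_def cof_cof power_divide power_mult_distrib)
    moreover have "a * b * c * a \<le> a * b * c * t" "a * b * c * t \<le> a * b * c * (3 * a)" 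
      using t pos by (auto intro!: mult_left_mono)
    ultimately have "(a * b)\<^sup>2 / (a * b * c * (3 * a)) \<le> (gap_ratio (cof M))\<^sup>2" "(gap_ratio (cof M))\<^sup>2 \<le> (3 * (a * b))\<^sup>2 / (a * b * c * a)"
      using pos t0 unfolding q by (auto intro!: frac_le mult_pos_pos)
    moreover have "(a * b)\<^sup>2 / (a * b * c * (3 * a)) = (b / c) / 3" "(3 * (a * b))\<^sup>2 / (a * b * c * a) = 9 * (b / c)"
      using pos by (simp_all add: power2_eq_square)
    ultimately have "(sqrt b / sqrt c)\<^sup>2 \<le> 9 * (gap_ratio (cof M))\<^sup>2" "(gap_ratio (cof M))\<^sup>2 \<le> 9 * (sqrt b / sqrt c)\<^sup>2"
      using pos zero_le_power2[of "gap_ratio (cof M)"] by (simp_all add: power_divide)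
    then have "\<bar>ln (sqrt b / sqrt c) - ln (gap_ratio (cof M))\<bar> \<le> ln 3"
      using pos M0 cM0 M by (intro abs_ln_diff_le) (auto simp: gap_ratio_def cof_cof)
    then show ?thesis using j by (simp add: singular_value_def sv gap_action_def numeral_eq_Suc)
  qed
qed

section \<open>Almost sure decay\<close>

lemma measurable_det_3 [measurable]: "(det :: real^3^3 \<Rightarrow> real) \<in> borel_measurable borel"
  unfolding det_3[abs_def] by measurable

lemma finite_det_shift_zero: "finite {s. det (s *\<^sub>R mat 1 + M :: real^3^3) = 0}"
proof -
  define A where "A = - M"
  define t where "t = A$1$1 + A$2$2 + A$3$3"
  define e where "e = A$1$1 * A$2$2 - A$1$2 * A$2$1 + (A$1$1 * A$3$3 - A$1$3 * A$3$1) + (A$2$2 * A$3$3 - A$2$3 * A$3$2)"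
  define p where "p = [:- det A, e, - t, 1:]"
  have "det (s *\<^sub>R mat 1 + M) = poly p s" for s
  proof -
    have "s *\<^sub>R mat 1 + M = mat s - A" by (simp add: A_def vec_eq_iff mat_def)
    then have "det (s *\<^sub>R mat 1 + M) = det (mat s - A)" by (simp only:)
    also have "\<dots> = poly p s"
      unfolding det_mat_minus_3 by (simp add: p_def t_def e_def power2_eq_square power3_eq_cube algebra_simps)
    finally show ?thesis .
  qed
  moreover have "p \<noteq> 0" by (simp add: p_def)
  ultimately show ?thesis using poly_roots_finite[of p] by simp
qed

text \<open>
  By Fubini along the lines \<open>s \<mapsto> s 1 + M\<close>, each of which meets the set in the finitely many roots
  of a characteristic polynomial.
\<close>

lemma emeasure_det_zero: "emeasure lborel {M :: real^3^3. det M = 0} = 0"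
proof -
  define Z where "Z = {M :: real^3^3. det M = 0}"
  have [measurable]: "Z \<in> sets borel"
    unfolding Z_def by measurable
  have "emeasure lborel Z = (\<integral>\<^sup>+s. indicator {0..1::real} s * emeasure lborel Z \<partial>lborel)"
    by (simp add: nn_integral_multc)
  also have "\<dots> = (\<integral>\<^sup>+s. (\<integral>\<^sup>+M. indicator {0..1::real} s * indicator Z (s *\<^sub>R mat 1 + M) \<partial>lborel) \<partial>lborel)"
    by (simp add: nn_integral_cmult nn_integral_lborel_shift)
  also have "\<dots> = (\<integral>\<^sup>+M. (\<integral>\<^sup>+s. indicator {0..1::real} s * indicator Z (s *\<^sub>R mat 1 + M) \<partial>lborel) \<partial>lborel)"
    by (rule lborel_pair.Fubini') measurable
  also have "\<dots> = (\<integral>\<^sup>+M. 0 \<partial>(lborel :: (real^3^3) measure))"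
  proof (rule nn_integral_cong)
    fix M :: "real^3^3"
    have "AE s in lborel. s \<notin> {s. det (s *\<^sub>R mat 1 + M) = 0}"
      by (intro AE_not_in finite_imp_null_set_lborel finite_det_shift_zero)
    then have "AE s in lborel. indicator {0..1::real} s * indicator Z (s *\<^sub>R mat 1 + M) = (0 :: ennreal)"
      by (auto simp: Z_def)
    then show "(\<integral>\<^sup>+s. indicator {0..1::real} s * indicator Z (s *\<^sub>R mat 1 + M) \<partial>lborel) = 0"
      by (simp add: nn_integral_0_iff_AE)
  qed
  finally show ?thesis by (simp add: Z_def)
qed

lemma det_perturbed_product_nonzero:
  assumes "\<And>k. 1 \<le> k \<Longrightarrow> det (A k + e *\<^sub>R X k :: real^'n^'n) \<noteq> 0"
  shows "det (perturbed_product A e X n) \<noteq> 0"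
  using assms by (induction n) (simp_all add: det_mul)

context noisy_products
begin

lemma AE_factors_invertible: "AE \<omega> in M. \<forall>n\<ge>1. det (A n + e *\<^sub>R \<Xi> n \<omega>) \<noteq> 0"
proof -
  have "AE \<omega> in M. 1 \<le> n \<longrightarrow> det (A n + e *\<^sub>R \<Xi> n \<omega>) \<noteq> 0" for n
  proof (cases "1 \<le> n")
    case True
    let ?Z = "{M :: real^3^3. det M = 0}"
    have [measurable]: "?Z \<in> sets borel" by measurable
    have "(\<integral>\<^sup>+\<omega>. indicator ?Z (A n + e *\<^sub>R \<Xi> n \<omega>) \<partial>M) = emeasure (uniform_measure lborel (cube (A n) e)) ?Z"
      by (subst nn_integral_noise[OF True]) simp_all
    also have "\<dots> = emeasure lborel (cube (A n) e \<inter> ?Z) / emeasure lborel (cube (A n) e)"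
      by (subst emeasure_uniform_measure) simp_all
    also have "emeasure lborel (cube (A n) e \<inter> ?Z) = 0"
      using emeasure_mono[of "cube (A n) e \<inter> ?Z" ?Z lborel] emeasure_det_zero by simp
    finally have "(\<integral>\<^sup>+\<omega>. indicator ?Z (A n + e *\<^sub>R \<Xi> n \<omega>) \<partial>M) = 0" by simp
    moreover have "(\<lambda>\<omega>. indicator ?Z (A n + e *\<^sub>R \<Xi> n \<omega>) :: ennreal) \<in> borel_measurable M"
      using measurable_noise[OF True] by measurable
    ultimately have "AE \<omega> in M. indicator ?Z (A n + e *\<^sub>R \<Xi> n \<omega>) = (0 :: ennreal)"
      by (simp only: nn_integral_0_iff_AE)
    then show ?thesis by (auto simp: indicator_def)
  qed simp
  then have "AE \<omega> in M. \<forall>n. 1 \<le> n \<longrightarrow> det (A n + e *\<^sub>R \<Xi> n \<omega>) \<noteq> 0"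
    by (simp add: AE_all_countable)
  then show ?thesis by simp
qed

end

text \<open>
  The expectation of \<open>root_contraction\<close> is of order \<open>s\<^sup>n\<close>. Dividing by \<open>r\<^sup>n\<close> with \<open>r = sqrt s\<close> leaves a
  summable series of expectations, hence almost surely a convergent, in particular bounded, sequence.
\<close>

lemma (in matrix_action) AE_cross_decay:
  fixes \<Xi> :: "nat \<Rightarrow> 'w \<Rightarrow> real^3^3"
  assumes np: "noisy_products M \<Xi> e A" and on: "orthonormal x y"
  defines "s \<equiv> sqrt (1 - e\<^sup>2 / 8192000)"
  defines "K \<equiv> \<lambda>n \<omega>. \<kappa> (perturbed_product A e (\<lambda>k. \<Xi> k \<omega>) (Suc n))"
  shows "AE \<omega> in M. \<exists>C\<ge>0. \<forall>n. norm (cross3 (K n \<omega> *v x) (K n \<omega> *v y)) \<le> C * s ^ n * (norm (K n \<omega> *v x))\<^sup>2"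
proof -
  interpret noisy_products M \<Xi> e A by fact
  note [measurable] = measurable_action
  define k where "k = 1 - e\<^sup>2 / 8192000"
  have "e\<^sup>2 < 1\<^sup>2" using e by (intro power_strict_mono) auto
  then have k: "0 < k" "k < 1" using e by (simp_all add: k_def)
  have s: "0 < s" "s < 1" "s\<^sup>2 = k" using k by (simp_all add: s_def k_def[symmetric])
  define r where "r = sqrt s"
  have r: "0 < r" "r < 1" "r\<^sup>2 = s" using s by (simp_all add: r_def)
  define f where "f n \<omega> = root_contraction (K n \<omega> *v x) (K n \<omega> *v y)" for n \<omega>
  have [measurable]: "f n \<in> borel_measurable M" for n
    unfolding f_def K_def by (rule flag_density_measurable[OF flag_density_root_contraction]) measurable
  define c where "c = enn2real (ennreal ((12 / e) ^ 18) * cauchy_mass)"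
  have c: "ennreal c = ennreal ((12 / e) ^ 18) * cauchy_mass"
    using cauchy_mass_finite e by (simp add: c_def ennreal_mult_less_top)
  have c0: "0 \<le> c" by (simp add: c_def)
  have Ef: "(\<integral>\<^sup>+\<omega>. f n \<omega> \<partial>M) \<le> ennreal (sqrt c * s ^ n)" for n
  proof -
    have "(\<integral>\<^sup>+\<omega>. f n \<omega> \<partial>M)\<^sup>2 \<le> ennreal ((12 / e) ^ 18) * (ennreal k ^ n * cauchy_mass)"
      using nn_integral_products_le[OF np flag_density_root_contraction fibre_root_contraction_le on, of n]
      by (simp add: f_def K_def k_def)
    also have "\<dots> = ennreal (c * k ^ n)"
      using k c c0 by (simp add: ennreal_mult ennreal_power mult_ac)
    finally have le: "(\<integral>\<^sup>+\<omega>. f n \<omega> \<partial>M)\<^sup>2 \<le> ennreal (c * k ^ n)" .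
    then have "(\<integral>\<^sup>+\<omega>. f n \<omega> \<partial>M) \<noteq> \<top>" by (auto simp: power2_eq_square top_unique)
    then obtain a where a: "(\<integral>\<^sup>+\<omega>. f n \<omega> \<partial>M) = ennreal a" "0 \<le> a" by (metis ennreal_cases)
    then have "a\<^sup>2 \<le> c * k ^ n" using le c0 k by (simp add: ennreal_power)
    also have "\<dots> = (sqrt c * s ^ n)\<^sup>2"
    proof -
      have "(sqrt c)\<^sup>2 = c" using c0 by (rule real_sqrt_pow2)
      moreover have "(s ^ n)\<^sup>2 = k ^ n" by (metis s(3) power_mult mult.commute)
      ultimately show ?thesis by (simp only: power_mult_distrib)
    qed
    finally have "a \<le> sqrt c * s ^ n" by (rule power2_le_imp_le) (use c0 s in simp)
    then show ?thesis by (simp add: a ennreal_leI)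
  qed
  have "(\<integral>\<^sup>+\<omega>. (\<Sum>n. f n \<omega> * ennreal (1 / r ^ n)) \<partial>M) = (\<Sum>n. \<integral>\<^sup>+\<omega>. f n \<omega> * ennreal (1 / r ^ n) \<partial>M)"
    by (rule nn_integral_suminf) simp
  also have "\<dots> \<le> (\<Sum>n. ennreal (sqrt c * r ^ n))"
  proof (intro suminf_le summableI)
    fix n
    have "(\<integral>\<^sup>+\<omega>. f n \<omega> * ennreal (1 / r ^ n) \<partial>M) \<le> ennreal (sqrt c * s ^ n) * ennreal (1 / r ^ n)"
      by (simp add: nn_integral_multc Ef mult_right_mono)
    also have "\<dots> = ennreal (sqrt c * r ^ n)"
    proof -
      have "s ^ n = r ^ n * r ^ n" by (simp add: r(3)[symmetric] power2_eq_square power_mult_distrib)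
      then show ?thesis using c0 r by (simp flip: ennreal_mult)
    qed
    finally show "(\<integral>\<^sup>+\<omega>. f n \<omega> * ennreal (1 / r ^ n) \<partial>M) \<le> ennreal (sqrt c * r ^ n)" .
  qed
  also have "\<dots> = ennreal (\<Sum>n. sqrt c * r ^ n)"
    using c0 r by (intro suminf_ennreal2 summable_mult summable_geometric) auto
  also have "\<dots> < \<infinity>" by simp
  finally have "AE \<omega> in M. (\<Sum>n. f n \<omega> * ennreal (1 / r ^ n)) \<noteq> \<infinity>"
    by (intro nn_integral_PInf_AE) auto
  then show ?thesis
  proof eventually_elim
    case (elim \<omega>)
    then obtain S where S: "(\<Sum>n. f n \<omega> * ennreal (1 / r ^ n)) = ennreal S" "0 \<le> S"
      by (metis ennreal_cases infinity_ennreal_def)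
    have "norm (cross3 (K n \<omega> *v x) (K n \<omega> *v y)) \<le> S\<^sup>2 * s ^ n * (norm (K n \<omega> *v x))\<^sup>2" for n
    proof -
      let ?X = "K n \<omega> *v x" and ?Y = "K n \<omega> *v y"
      have "f n \<omega> * ennreal (1 / r ^ n) \<le> ennreal S"
        using sum_le_suminf[of "\<lambda>n. f n \<omega> * ennreal (1 / r ^ n)" "{n}"] S(1) by simp
      then have "ennreal (sqrt (norm (cross3 ?X ?Y)) / norm ?X * (1 / r ^ n)) \<le> ennreal S"
        using r by (simp add: f_def root_contraction_def flip: ennreal_mult)
      then have "sqrt (norm (cross3 ?X ?Y)) / norm ?X * (1 / r ^ n) \<le> S"
        using S(2) by simp
      then have *: "sqrt (norm (cross3 ?X ?Y)) / (norm ?X * r ^ n) \<le> S"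
        by simp
      have "sqrt (norm (cross3 ?X ?Y)) \<le> S * r ^ n * norm ?X"
      proof (cases "?X = 0")
        case False
        then have "0 < norm ?X * r ^ n" using r by simp
        then show ?thesis using * by (simp add: pos_divide_le_eq mult_ac)
      qed simp
      then have "(sqrt (norm (cross3 ?X ?Y)))\<^sup>2 \<le> (S * r ^ n * norm ?X)\<^sup>2"
        by (intro power_mono) auto
      also have "\<dots> = S\<^sup>2 * s ^ n * (norm ?X)\<^sup>2"
        by (simp add: r(3)[symmetric] power_mult_distrib flip: power_mult) (simp add: mult.commute)
      finally show ?thesis by simp
    qed
    then show ?case by (intro exI[of _ "S\<^sup>2"]) simp
  qed
qed

lemma norm_le_sum_columns: "norm (B :: real^3^3) \<le> norm (B *v axis 1 1) + norm (B *v axis 2 1) + norm (B *v axis 3 1)"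
proof -
  have "(norm B)\<^sup>2 = (norm (B *v axis 1 1))\<^sup>2 + (norm (B *v axis 2 1))\<^sup>2 + (norm (B *v axis 3 1))\<^sup>2"
    by (simp add: norm_vec_def L2_set_def matrix_vector_mult_basis column_def sum_3 sum_nonneg)
  also have "\<dots> \<le> (norm (B *v axis 1 1) + norm (B *v axis 2 1) + norm (B *v axis 3 1))\<^sup>2"
    by (simp add: power2_eq_square algebra_simps)
  finally show ?thesis by (rule power2_le_imp_le) simp
qed

text \<open>
  The columns of \<open>cof K\<close> are the cross products of the columns of \<open>K\<close>.
\<close>

lemma (in matrix_action) AE_cof_decay:
  fixes \<Xi> :: "nat \<Rightarrow> 'w \<Rightarrow> real^3^3"
  assumes np: "noisy_products M \<Xi> e A"
  defines "s \<equiv> sqrt (1 - e\<^sup>2 / 8192000)"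
  defines "K \<equiv> \<lambda>n \<omega>. \<kappa> (perturbed_product A e (\<lambda>k. \<Xi> k \<omega>) (Suc n))"
  shows "AE \<omega> in M. \<exists>C. \<forall>n. norm (cof (K n \<omega>)) \<le> C * s ^ n * (norm (K n \<omega>))\<^sup>2"
proof -
  interpret noisy_products M \<Xi> e A by fact
  have "e\<^sup>2 < 1\<^sup>2" using e by (intro power_strict_mono) auto
  then have s0: "0 \<le> s" by (simp add: s_def)
  have on: "orthonormal (axis 2 1) (axis 3 1)" "orthonormal (axis 3 1) (axis 1 1)" "orthonormal (axis 1 1) (axis 2 1)"
    by (simp_all add: orthonormal_def inner_axis_axis)
  have decay: "AE \<omega> in M. \<exists>C\<ge>0. \<forall>n. norm (cross3 (K n \<omega> *v x) (K n \<omega> *v y)) \<le> C * s ^ n * (norm (K n \<omega> *v x))\<^sup>2"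
    if "orthonormal x y" for x y
    unfolding K_def s_def by (rule AE_cross_decay[OF np that])
  show ?thesis
    using decay[OF on(1)] decay[OF on(2)] decay[OF on(3)]
  proof eventually_elim
    case (elim \<omega>)
    have bound: "norm (cross3 (K n \<omega> *v axis i 1) z) \<le> C * s ^ n * (norm (K n \<omega>))\<^sup>2"
      if "norm (cross3 (K n \<omega> *v axis i 1) z) \<le> C * s ^ n * (norm (K n \<omega> *v axis i 1))\<^sup>2" "0 \<le> C" for n i z C
    proof -
      have "norm (K n \<omega> *v axis i 1) \<le> norm (K n \<omega>)"
        using norm_matrix_vector_mult_le[of "K n \<omega>" "axis i 1"] by simp
      then have "C * s ^ n * (norm (K n \<omega> *v axis i 1))\<^sup>2 \<le> C * s ^ n * (norm (K n \<omega>))\<^sup>2"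
        using that(2) s0 by (intro mult_left_mono power_mono) auto
      with that(1) show ?thesis by linarith
    qed
    obtain C1 where C1: "0 \<le> C1"
      "\<And>n. norm (cross3 (K n \<omega> *v axis 2 1) (K n \<omega> *v axis 3 1)) \<le> C1 * s ^ n * (norm (K n \<omega> *v axis 2 1))\<^sup>2"
      using elim(1) by blast
    obtain C2 where C2: "0 \<le> C2"
      "\<And>n. norm (cross3 (K n \<omega> *v axis 3 1) (K n \<omega> *v axis 1 1)) \<le> C2 * s ^ n * (norm (K n \<omega> *v axis 3 1))\<^sup>2"
      using elim(2) by blast
    obtain C3 where C3: "0 \<le> C3"
      "\<And>n. norm (cross3 (K n \<omega> *v axis 1 1) (K n \<omega> *v axis 2 1)) \<le> C3 * s ^ n * (norm (K n \<omega> *v axis 1 1))\<^sup>2"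
      using elim(3) by blast
    have "norm (cof (K n \<omega>)) \<le> (C1 + C2 + C3) * s ^ n * (norm (K n \<omega>))\<^sup>2" for n
    proof -
      have "cof (K n \<omega>) *v axis 1 1 = cross3 (K n \<omega> *v axis 2 1) (K n \<omega> *v axis 3 1)"
        "cof (K n \<omega>) *v axis 2 1 = cross3 (K n \<omega> *v axis 3 1) (K n \<omega> *v axis 1 1)"
        "cof (K n \<omega>) *v axis 3 1 = cross3 (K n \<omega> *v axis 1 1) (K n \<omega> *v axis 2 1)"
        by (simp_all add: cross_basis flip: cof_cross)
      then show ?thesis
        using norm_le_sum_columns[of "cof (K n \<omega>)"] bound[OF C1(2)[of n] C1(1)] bound[OF C2(2)[of n] C2(1)] bound[OF C3(2)[of n] C3(1)]
        by (simp add: distrib_right)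
    qed
    then show ?case by blast
  qed
qed

section \<open>The growth rate of the gaps\<close>

text \<open>
  Almost every value of \<open>f\<close> is on the same side of each rational number, and rationals
  separate extended reals.
\<close>

lemma (in prob_space) AE_constant_of_zero_one:
  fixes f :: "'a \<Rightarrow> ereal"
  assumes [measurable]: "f \<in> borel_measurable M"
    and zo: "\<And>a. prob {\<omega> \<in> space M. f \<omega> \<le> a} = 0 \<or> prob {\<omega> \<in> space M. f \<omega> \<le> a} = 1"
  shows "\<exists>c. AE \<omega> in M. f \<omega> = c"
proof -
  let ?S = "\<lambda>a. {\<omega> \<in> space M. f \<omega> \<le> a}"
  have "AE \<omega> in M. f \<omega> \<le> ereal (real_of_rat r) \<longleftrightarrow> prob (?S (ereal (real_of_rat r))) = 1" for r
  proof (cases "prob (?S (ereal (real_of_rat r))) = 1")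
    case True
    then have "AE \<omega> in M. \<omega> \<in> ?S (ereal (real_of_rat r))"
      by (subst (asm) prob_eq_1) simp_all
    then show ?thesis using True by (auto elim: eventually_mono)
  next
    case False
    then have "prob (?S (ereal (real_of_rat r))) = 0" using zo by blast
    then have "AE \<omega> in M. \<omega> \<notin> ?S (ereal (real_of_rat r))"
      by (subst (asm) prob_eq_0) simp_all
    then show ?thesis using False by (auto elim!: AE_mp)
  qed
  then have ae: "AE \<omega> in M. \<forall>r. f \<omega> \<le> ereal (real_of_rat r) \<longleftrightarrow> prob (?S (ereal (real_of_rat r))) = 1"
    by (simp add: AE_all_countable)
  have "\<exists>\<omega>0. \<forall>r. f \<omega>0 \<le> ereal (real_of_rat r) \<longleftrightarrow> prob (?S (ereal (real_of_rat r))) = 1"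
  proof (rule ccontr)
    assume none: "\<nexists>\<omega>0. \<forall>r. f \<omega>0 \<le> ereal (real_of_rat r) \<longleftrightarrow> prob (?S (ereal (real_of_rat r))) = 1"
    have "AE \<omega> in M. False"
      using ae by (rule eventually_mono) (use none in blast)
    then show False by (simp add: AE_False)
  qed
  then obtain \<omega>0 where \<omega>0: "\<And>r. f \<omega>0 \<le> ereal (real_of_rat r) \<longleftrightarrow> prob (?S (ereal (real_of_rat r))) = 1"
    by blast
  from ae have "AE \<omega> in M. f \<omega> = f \<omega>0"
  proof eventually_elim
    case (elim \<omega>)
    then have iff: "f \<omega> \<le> ereal (real_of_rat r) \<longleftrightarrow> f \<omega>0 \<le> ereal (real_of_rat r)" for r
      using \<omega>0 by simp
    show ?case
    proof (rule antisym; rule leI; rule notI)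
      assume "f \<omega>0 < f \<omega>"
      from ereal_dense3[OF this] obtain r where "f \<omega>0 < ereal (real_of_rat r)" "ereal (real_of_rat r) < f \<omega>" by blast
      then show False using iff[of r] by (meson less_imp_le not_le)
    next
      assume "f \<omega> < f \<omega>0"
      from ereal_dense3[OF this] obtain r where "f \<omega> < ereal (real_of_rat r)" "ereal (real_of_rat r) < f \<omega>0" by blast
      then show False using iff[of r] by (meson less_imp_le not_le)
    qed
  qed
  then show ?thesis by blast
qed

lemma liminf_average_eq:
  fixes u v :: "nat \<Rightarrow> real"
  assumes "\<And>n. \<bar>v n - u n\<bar> \<le> C"
  shows "liminf (\<lambda>n. ereal (1 / real (m + n) * u n)) = liminf (\<lambda>n. ereal (1 / real (m + n) * v n))"
proof -
  have "(\<lambda>n. 1 / real (m + n) * (v n - u n)) \<longlonglongrightarrow> 0"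
  proof (rule Lim_null_comparison)
    show "\<forall>\<^sub>F n in sequentially. norm (1 / real (m + n) * (v n - u n)) \<le> C * (1 / real (m + n))"
    proof (rule always_eventually, rule allI)
      fix n
      show "norm (1 / real (m + n) * (v n - u n)) \<le> C * (1 / real (m + n))"
        unfolding norm_mult using mult_right_mono[OF assms[of n], of "1 / real (m + n)"] by (simp add: mult.commute)
    qed
    have "(\<lambda>n. 1 / real (n + m)) \<longlonglongrightarrow> 0"
      by (rule LIMSEQ_ignore_initial_segment[OF lim_1_over_n])
    from tendsto_mult_right_zero[OF this, of C]
    show "(\<lambda>n. C * (1 / real (m + n))) \<longlonglongrightarrow> 0" by (simp add: add.commute)
  qed
  then have "(\<lambda>n. ereal (1 / real (m + n) * (v n - u n))) \<longlonglongrightarrow> ereal 0"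
    by (rule tendsto_ereal)
  then have "liminf (\<lambda>n. ereal (1 / real (m + n) * (v n - u n)) + ereal (1 / real (m + n) * u n))
    = ereal 0 + liminf (\<lambda>n. ereal (1 / real (m + n) * u n))"
    by (rule ereal_liminf_lim_add) simp
  moreover have "ereal (1 / real (m + n) * (v n - u n)) + ereal (1 / real (m + n) * u n) = ereal (1 / real (m + n) * v n)" for n
    by (simp add: right_diff_distrib)
  ultimately show ?thesis by (simp add: zero_ereal_def[symmetric])
qed

lemma ln_norm_mult_diff_le:
  fixes K N N' :: "real^'n^'n"
  assumes K: "K \<noteq> 0" and N: "N ** N' = mat 1"
  shows "\<bar>ln (norm (K ** N)) - ln (norm K)\<bar> \<le> \<bar>ln (norm N)\<bar> + \<bar>ln (norm N')\<bar>"
proof -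
  have KNN: "K ** N ** N' = K" using N by (simp flip: matrix_mul_assoc)
  have nz: "K ** N \<noteq> 0"
  proof
    assume "K ** N = 0"
    with KNN K show False by simp
  qed
  have "N \<noteq> 0" using nz by auto
  have "N' \<noteq> 0" using KNN K by auto
  have "ln (norm (K ** N)) \<le> ln (norm K * norm N)"
    using norm_matrix_mult_le[of K N] nz K \<open>N \<noteq> 0\<close> by (subst ln_le_cancel_iff) simp_all
  then have 1: "ln (norm (K ** N)) \<le> ln (norm K) + ln (norm N)"
    using K \<open>N \<noteq> 0\<close> by (simp add: ln_mult)
  have "norm K \<le> norm (K ** N) * norm N'"
    using norm_matrix_mult_le[of "K ** N" N'] by (simp only: KNN)
  then have "ln (norm K) \<le> ln (norm (K ** N) * norm N')"
    using K nz \<open>N' \<noteq> 0\<close> by (subst ln_le_cancel_iff) simp_all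
  then have 2: "ln (norm K) \<le> ln (norm (K ** N)) + ln (norm N')"
    using nz \<open>N' \<noteq> 0\<close> by (simp add: ln_mult)
  show ?thesis using 1 2 by linarith
qed

lemma det_nonzero_right_inverse:
  fixes N :: "real^'n^'n"
  assumes "det N \<noteq> 0"
  obtains N' where "N ** N' = mat 1"
  using assms invertible_det_nz[of N] by (auto simp: invertible_def)

lemma det_cof_nonzero:
  assumes "det N \<noteq> 0"
  shows "det (cof N) \<noteq> 0"
proof -
  obtain N' where "N ** N' = mat 1" using det_nonzero_right_inverse[OF assms] .
  then have "cof N ** cof N' = mat 1" by (metis cof_mat1 cof_mult)
  then have "det (cof N) * det (cof N') = 1" by (metis det_I det_mul)
  then show ?thesis by auto
qed

lemma det_nonzero_imp_nonzero: "det (K :: real^3^3) \<noteq> 0 \<Longrightarrow> K \<noteq> 0"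
  by (auto simp: det_3)

lemma ln_gap_ratio:
  assumes "det K \<noteq> 0"
  shows "ln (gap_ratio K) = 2 * ln (norm K) - ln (norm (cof K))"
  using det_nonzero_imp_nonzero[OF assms] cof_nonzero[OF assms]
  by (simp add: gap_ratio_def ln_div ln_realpow)

lemma ln_gap_ratio_mult_bounded:
  fixes N :: "real^3^3"
  assumes N: "det N \<noteq> 0"
  obtains C where "\<And>K. det K \<noteq> 0 \<Longrightarrow> \<bar>ln (gap_ratio (K ** N)) - ln (gap_ratio K)\<bar> \<le> C"
proof -
  obtain N' where N': "N ** N' = mat 1" using det_nonzero_right_inverse[OF N] .
  then have cN: "cof N ** cof N' = mat 1" by (metis cof_mat1 cof_mult)
  have "\<bar>ln (gap_ratio (K ** N)) - ln (gap_ratio K)\<bar>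
    \<le> 2 * (\<bar>ln (norm N)\<bar> + \<bar>ln (norm N')\<bar>) + (\<bar>ln (norm (cof N))\<bar> + \<bar>ln (norm (cof N'))\<bar>)"
    if K: "det K \<noteq> 0" for K
  proof -
    have KN: "det (K ** N) \<noteq> 0" using K N by (simp add: det_mul)
    have combine: "\<bar>(2 * x' - y') - (2 * x - y)\<bar> \<le> 2 * p + q"
      if "\<bar>x' - x\<bar> \<le> p" "\<bar>y' - y\<bar> \<le> q" for x x' y y' p q :: real
      using that by linarith
    show ?thesis
      unfolding ln_gap_ratio[OF K] ln_gap_ratio[OF KN] cof_mult
      by (rule combine[OF ln_norm_mult_diff_le[OF det_nonzero_imp_nonzero[OF K] N'] ln_norm_mult_diff_le[OF cof_nonzero[OF K] cN]])
  qed
  then show ?thesis using that by blast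
qed

lemma gap_action_mult: "gap_action j (K ** N) = gap_action j K ** gap_action j N"
  by (simp add: gap_action_def cof_mult)

lemma det_gap_action_nonzero: "det N \<noteq> 0 \<Longrightarrow> det (gap_action j N) \<noteq> 0"
  by (simp add: gap_action_def det_cof_nonzero)

lemma measurable_gap [measurable]: "(\<lambda>N. ln (gap_ratio (gap_action j N))) \<in> borel_measurable borel"
  unfolding gap_ratio_def gap_action_def by (cases "j = 1") simp_all

lemma perturbed_product_add:
  "perturbed_product A e X (m + k) = perturbed_product (\<lambda>i. A (m + i)) e (\<lambda>i. X (m + i)) k ** perturbed_product A e X m"
  by (induction k) (simp_all add: matrix_mul_assoc)

context noisy_products
begin

text \<open>
  The growth rate of the gap with the first \<open>m\<close> factors removed, still divided by the total number of
  factors.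
\<close>

definition tail_gap :: "nat \<Rightarrow> nat \<Rightarrow> 'w \<Rightarrow> ereal"
  where "tail_gap j m \<omega> = liminf (\<lambda>k. ereal (1 / real (m + k) *
    ln (gap_ratio (gap_action j (perturbed_product (\<lambda>i. A (m + i)) e (\<lambda>i. \<Xi> (m + i) \<omega>) k)))))"

text \<open>
  Removing an invertible right factor changes the logarithm of the gap by a bounded amount.
\<close>

lemma tail_gap_eq:
  assumes inv: "\<forall>n\<ge>1. det (A n + e *\<^sub>R \<Xi> n \<omega>) \<noteq> 0"
  shows "tail_gap j m \<omega> = tail_gap j 0 \<omega>"
proof -
  define T where "T k = perturbed_product (\<lambda>i. A (m + i)) e (\<lambda>i. \<Xi> (m + i) \<omega>) k" for k
  \<comment> \<open>The product of all factors is the remaining one times this invertible matrix.\<close>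
  have "det (P m \<omega>) \<noteq> 0" by (rule det_perturbed_product_nonzero) (use inv in auto)
  then obtain C where C: "\<And>K. det K \<noteq> 0 \<Longrightarrow> \<bar>ln (gap_ratio (K ** gap_action j (P m \<omega>))) - ln (gap_ratio K)\<bar> \<le> C"
    using ln_gap_ratio_mult_bounded[OF det_gap_action_nonzero] by metis
  have "det (T k) \<noteq> 0" for k
    unfolding T_def by (rule det_perturbed_product_nonzero) (use inv in auto)
  then have "\<bar>ln (gap_ratio (gap_action j (P (m + k) \<omega>))) - ln (gap_ratio (gap_action j (T k)))\<bar> \<le> C" for k
    unfolding perturbed_product_add gap_action_mult T_def[symmetric] by (intro C det_gap_action_nonzero)
  from liminf_average_eq[OF this, of m]
  have "tail_gap j m \<omega> = liminf (\<lambda>k. ereal (1 / real (m + k) * ln (gap_ratio (gap_action j (P (m + k) \<omega>)))))"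
    by (simp add: tail_gap_def T_def)
  also have "\<dots> = liminf (\<lambda>k. ereal (1 / real k * ln (gap_ratio (gap_action j (P k \<omega>)))))"
    using liminf_shift_k[of "\<lambda>k. ereal (1 / real k * ln (gap_ratio (gap_action j (P k \<omega>))))" m] by (simp add: add.commute)
  finally show ?thesis by (simp add: tail_gap_def)
qed

lemma measurable_tail_gap:
  assumes "\<And>i. m < i \<Longrightarrow> \<Xi> i \<in> borel_measurable N"
  shows "tail_gap j m \<in> borel_measurable N"
proof -
  have [measurable]: "(\<lambda>\<omega>. perturbed_product (\<lambda>i. A (m + i)) e (\<lambda>i. \<Xi> (m + i) \<omega>) k) \<in> borel_measurable N" for k
    by (rule measurable_perturbed_product) (use assms in simp)
  show ?thesis unfolding tail_gap_def[abs_def] by measurable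
qed

definition noise_events :: "nat \<Rightarrow> 'w set set"
  where "noise_events i = sigma_sets (space M) {\<Xi> (Suc i) -` B \<inter> space M | B. B \<in> sets borel}"

lemma indep_noise_events: "indep_sets noise_events UNIV"
proof -
  let ?G = "\<lambda>i. sigma_sets (space M) {\<Xi> i -` B \<inter> space M | B. B \<in> sets borel}"
  have G: "indep_sets ?G {1..}"
    using indep by (simp add: indep_vars_def)
  show ?thesis
  proof (rule indep_setsI)
    show "noise_events i \<subseteq> events" for i
      using G unfolding indep_sets_def noise_events_def by auto
    fix B J assume J: "J \<noteq> {}" "finite J" "\<forall>i\<in>J. B i \<in> noise_events i"
    have "prob (\<Inter>i\<in>Suc ` J. B (i - 1)) = (\<Prod>i\<in>Suc ` J. prob (B (i - 1)))"
      by (rule indep_setsD[OF G]) (use J in \<open>auto simp: noise_events_def\<close>)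
    then show "prob (\<Inter>i\<in>J. B i) = (\<Prod>i\<in>J. prob (B i))"
      by (simp add: prod.reindex)
  qed
qed

text \<open>
  The rate itself is only almost surely a tail function. The inferior limit over the number \<open>m\<close> of removed factors
  is one everywhere, because it is not affected by dropping its first \<open>n\<close> terms.
\<close>

lemma tail_gap_zero_one:
  defines "f \<equiv> \<lambda>j \<omega>. liminf (\<lambda>m. tail_gap j m \<omega>)"
  shows "prob {\<omega> \<in> space M. f j \<omega> \<le> a} = 0 \<or> prob {\<omega> \<in> space M. f j \<omega> \<le> a} = 1"
proof (rule kolmogorov_0_1_law[of noise_events])
  show "sigma_algebra (space M) (noise_events i)" for i
    unfolding noise_events_def by (rule sigma_algebra_sigma_sets) auto
  show "indep_sets noise_events UNIV" by (rule indep_noise_events)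
  show "{\<omega> \<in> space M. f j \<omega> \<le> a} \<in> tail_events noise_events"
    unfolding tail_events_def
  proof (rule INT_I)
    fix n
    define N where "N = sigma (space M) (\<Union>(noise_events ` {n..}))"
    have sub: "\<Union>(noise_events ` {n..}) \<subseteq> Pow (space M)"
      unfolding noise_events_def by (auto dest: sigma_sets_into_sp[rotated])
    have sp: "space N = space M" and sets: "sets N = sigma_sets (space M) (\<Union>(noise_events ` {n..}))"
      using sub by (simp_all add: N_def)
    have m: "\<Xi> i \<in> borel_measurable N" if i: "n < i" for i
    proof (rule measurableI)
      fix B :: "(real^3^3) set" assume "B \<in> sets borel"
      then have "\<Xi> i -` B \<inter> space M \<in> noise_events (i - 1)"
        using i unfolding noise_events_def by (intro sigma_sets.Basic) auto
      moreover have "i - 1 \<in> {n..}" using i by auto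
      ultimately show "\<Xi> i -` B \<inter> space N \<in> sets N"
        unfolding sp sets by (intro sigma_sets.Basic) blast
    qed simp
    have [measurable]: "tail_gap j (m + n) \<in> borel_measurable N" for m
      by (rule measurable_tail_gap) (simp add: m)
    have "f j = (\<lambda>\<omega>. liminf (\<lambda>m. tail_gap j (m + n) \<omega>))"
      using liminf_shift_k[of "\<lambda>m. tail_gap j m _" n] by (auto simp: f_def)
    then have [measurable]: "f j \<in> borel_measurable N" by simp
    have "{\<omega> \<in> space N. f j \<omega> \<le> a} \<in> sets N" by measurable
    then show "{\<omega> \<in> space M. f j \<omega> \<le> a} \<in> sigma_sets (space M) (\<Union>(noise_events ` {n..}))"
      unfolding sp sets .
  qed
qed

lemma tail_gap_constant: "\<exists>c. AE \<omega> in M. tail_gap j 0 \<omega> = c"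
proof -
  let ?f = "\<lambda>\<omega>. liminf (\<lambda>m. tail_gap j m \<omega>)"
  have [measurable]: "tail_gap j m \<in> borel_measurable M" for m
    by (rule measurable_tail_gap) simp
  obtain c where "AE \<omega> in M. ?f \<omega> = c"
    using AE_constant_of_zero_one[of ?f] tail_gap_zero_one[of j] by auto
  then have "AE \<omega> in M. tail_gap j 0 \<omega> = c"
    using AE_factors_invertible
  proof eventually_elim
    case (elim \<omega>)
    have "(\<lambda>m. tail_gap j m \<omega>) = (\<lambda>m. tail_gap j 0 \<omega>)"
      by (rule ext) (rule tail_gap_eq[OF elim(2)])
    then have "?f \<omega> = tail_gap j 0 \<omega>" by (simp only: Liminf_const sequentially_bot not_False_eq_True)
    then show ?case using elim(1) by simp
  qed
  then show ?thesis by blast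
qed

lemma AE_gap_decay: "AE \<omega> in M. \<exists>C. \<forall>n. norm (cof (gap_action j (P (Suc n) \<omega>)))
    \<le> C * sqrt (1 - e\<^sup>2 / 8192000) ^ n * (norm (gap_action j (P (Suc n) \<omega>)))\<^sup>2"
proof -
  have "noisy_products M \<Xi> e A" by unfold_locales
  from id_action.AE_cof_decay[OF this] cof_action.AE_cof_decay[OF this]
  show ?thesis by (simp add: gap_action_def)
qed

lemma AE_tail_gap_ge: "AE \<omega> in M. ereal (e\<^sup>2 / 16384000) \<le> tail_gap j 0 \<omega>"
  using AE_gap_decay[of j] AE_factors_invertible
proof eventually_elim
  case (elim \<omega>)
  define K where "K n = gap_action j (P n \<omega>)" for n
  define k where "k = 1 - e\<^sup>2 / 8192000"
  define s where "s = sqrt k"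
  have "e\<^sup>2 < 1\<^sup>2" using e by (intro power_strict_mono) auto
  then have k: "0 < k" "k < 1" using e by (simp_all add: k_def)
  then have s: "0 < s" by (simp add: s_def)
  have "ln k \<le> k - 1" by (rule ln_le_minus_one[OF k(1)])
  then have ln_s: "ln s \<le> - (e\<^sup>2 / 16384000)"
    using k by (simp add: s_def ln_sqrt k_def)
  have detK: "det (K n) \<noteq> 0" for n
    unfolding K_def by (intro det_gap_action_nonzero det_perturbed_product_nonzero) (use elim(2) in auto)
  obtain C where C: "\<And>n. norm (cof (K (Suc n))) \<le> C * s ^ n * (norm (K (Suc n)))\<^sup>2"
    using elim(1) by (auto simp: K_def s_def k_def)
  have nK: "0 < norm (K n)" "0 < norm (cof (K n))" for n
    using det_nonzero_imp_nonzero[OF detK] cof_nonzero[OF detK] by simp_all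
  have "0 < C"
  proof -
    have "norm (cof (K 1)) \<le> C * (norm (K 1))\<^sup>2" using C[of 0] by simp
    with nK(2)[of 1] have "0 < C * (norm (K 1))\<^sup>2" by (rule less_le_trans)
    then show ?thesis using nK(1)[of 1] by (simp add: zero_less_mult_iff)
  qed
  define D where "D = \<bar>ln C\<bar> + \<bar>ln s\<bar>"
  have lower: "ln (gap_ratio (K n)) \<ge> real n * (e\<^sup>2 / 16384000) - D" if n: "1 \<le> n" for n
  proof -
    obtain i where i: "n = Suc i" using n by (cases n) auto
    have "ln (norm (cof (K n))) \<le> ln (C * s ^ i * (norm (K n))\<^sup>2)"
      using C[of i] nK[of n] \<open>0 < C\<close> s by (subst ln_le_cancel_iff) (simp_all add: i)
    also have "\<dots> = ln C + real i * ln s + 2 * ln (norm (K n))"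
      using nK[of n] \<open>0 < C\<close> s by (simp add: ln_mult ln_realpow)
    finally have "- ln C - real i * ln s \<le> ln (gap_ratio (K n))"
      using ln_gap_ratio[OF detK[of n]] by linarith
    moreover have "real n * (e\<^sup>2 / 16384000) \<le> real n * (- ln s)"
      using ln_s by (intro mult_left_mono) auto
    moreover have "real n * ln s = real i * ln s + ln s" by (simp add: i algebra_simps)
    moreover have "real n * (- ln s) = - (real n * ln s)" by simp
    ultimately show ?thesis unfolding D_def by linarith
  qed
  have "liminf (\<lambda>n. ereal (e\<^sup>2 / 16384000 - D * (1 / real n))) \<le> liminf (\<lambda>n. ereal (1 / real n * ln (gap_ratio (K n))))"
  proof (rule Liminf_mono)
    show "\<forall>\<^sub>F n in sequentially. ereal (e\<^sup>2 / 16384000 - D * (1 / real n)) \<le> ereal (1 / real n * ln (gap_ratio (K n)))"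
      using eventually_ge_at_top[of 1]
    proof eventually_elim
      case (elim n)
      have "(real n * (e\<^sup>2 / 16384000) - D) / real n \<le> ln (gap_ratio (K n)) / real n"
        using lower[OF elim] by (intro divide_right_mono) auto
      then show ?case using elim by (simp add: diff_divide_distrib)
    qed
  qed
  moreover have "(\<lambda>n. ereal (e\<^sup>2 / 16384000 - D * (1 / real n))) \<longlonglongrightarrow> ereal (e\<^sup>2 / 16384000 - D * 0)"
    by (intro tendsto_ereal tendsto_diff tendsto_mult tendsto_const lim_1_over_n)
  then have "liminf (\<lambda>n. ereal (e\<^sup>2 / 16384000 - D * (1 / real n))) = ereal (e\<^sup>2 / 16384000)"
    by (intro lim_imp_Liminf) simp_all
  ultimately show ?case by (simp add: tail_gap_def K_def)
qed

lemma singular_value_gap: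
  assumes j: "j \<in> {1, 2}"
  shows "\<exists>c :: ereal. ereal (e\<^sup>2 / 16384000) \<le> c \<and>
    (AE \<omega> in M. liminf (\<lambda>n. ereal (1 / real n *
      ln (singular_value j (P n \<omega>) / singular_value (j + 1) (P n \<omega>)))) = c)"
proof -
  obtain c where c: "AE \<omega> in M. tail_gap j 0 \<omega> = c" using tail_gap_constant by blast
  have "AE \<omega> in M. ereal (e\<^sup>2 / 16384000) \<le> c"
    using c AE_tail_gap_ge[of j] by eventually_elim simp
  then have ge: "ereal (e\<^sup>2 / 16384000) \<le> c"
    by (simp add: AE_const)
  have "AE \<omega> in M. liminf (\<lambda>n. ereal (1 / real n *
      ln (singular_value j (P n \<omega>) / singular_value (j + 1) (P n \<omega>)))) = c"
    using c AE_factors_invertible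
  proof eventually_elim
    case (elim \<omega>)
    have "det (P n \<omega>) \<noteq> 0" for n
      by (rule det_perturbed_product_nonzero) (use elim(2) in auto)
    from liminf_average_eq[OF singular_value_ratio[OF this j], of 0]
    show ?case using elim(1) by (simp add: tail_gap_def)
  qed
  with ge show ?thesis by blast
qed

end

lemma matrix_entry_le_onorm:
  fixes A :: "real^'n^'m"
  shows "\<bar>A $ i $ j\<bar> \<le> onorm (\<lambda>x. A *v x)"
proof -
  have "\<bar>A $ i $ j\<bar> = \<bar>(A *v axis j 1) $ i\<bar>"
    by (simp add: matrix_vector_mult_basis column_def)
  also have "\<dots> \<le> norm (A *v axis j 1)" by (rule component_le_norm_cart)
  also have "\<dots> \<le> onorm (\<lambda>x. A *v x) * norm (axis j 1 :: real^'n)"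
    by (rule onorm) (rule matrix_vector_mul_bounded_linear)
  finally show ?thesis by simp
qed

theorem theorem2:
  shows "\<exists>c3 :: real \<Rightarrow> real.
    (\<forall>\<epsilon>. 0 < \<epsilon> \<and> \<epsilon> < 1 \<longrightarrow> 0 < c3 \<epsilon>) \<and>
    (\<forall>(M :: 'w measure) (\<Xi> :: nat \<Rightarrow> 'w \<Rightarrow> real^3^3) (\<epsilon> :: real) (A :: nat \<Rightarrow> real^3^3) (j :: nat).
      prob_space M \<and> iid_uniform_matrices M \<Xi> \<and> 0 < \<epsilon> \<and> \<epsilon> < 1 \<and>
      (\<forall>n\<ge>1. onorm (\<lambda>x. A n *v x) \<le> 1) \<and> j \<in> {1, 2} \<longrightarrow>
      (\<exists>c :: ereal. ereal (c3 \<epsilon>) \<le> c \<and>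
        (AE \<omega> in M.
          liminf (\<lambda>n. ereal (1 / real n *
            ln (singular_value j (perturbed_product A \<epsilon> (\<lambda>k. \<Xi> k \<omega>) n) /
                singular_value (j + 1) (perturbed_product A \<epsilon> (\<lambda>k. \<Xi> k \<omega>) n)))) = c))) \<and>
    (\<forall>\<^sub>F \<epsilon> in at_right 0. exp (- (1 / \<epsilon> ^ 867)) < c3 \<epsilon>)"
proof (intro exI[of _ "\<lambda>\<epsilon>. \<epsilon>\<^sup>2 / 16384000"] conjI allI impI)
  fix M :: "'w measure" and \<Xi> :: "nat \<Rightarrow> 'w \<Rightarrow> real^3^3" and \<epsilon> :: real and A :: "nat \<Rightarrow> real^3^3" and j :: nat
  assume asm: "prob_space M \<and> iid_uniform_matrices M \<Xi> \<and> 0 < \<epsilon> \<and> \<epsilon> < 1 \<and>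
      (\<forall>n\<ge>1. onorm (\<lambda>x. A n *v x) \<le> 1) \<and> j \<in> {1, 2}"
  then interpret prob_space M by simp
  interpret noisy_products M \<Xi> \<epsilon> A
  proof
    show "\<bar>A n $ i $ k\<bar> \<le> 1" if "1 \<le> n" for n i k
      using asm that matrix_entry_le_onorm[of "A n" i k] by fastforce
  qed (use asm in auto)
  show "\<exists>c :: ereal. ereal (\<epsilon>\<^sup>2 / 16384000) \<le> c \<and>
        (AE \<omega> in M.
          liminf (\<lambda>n. ereal (1 / real n *
            ln (singular_value j (perturbed_product A \<epsilon> (\<lambda>k. \<Xi> k \<omega>) n) /
                singular_value (j + 1) (perturbed_product A \<epsilon> (\<lambda>k. \<Xi> k \<omega>) n)))) = c)"
    using asm by (intro singular_value_gap) simp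
next
  show "\<forall>\<^sub>F \<epsilon> in at_right 0. exp (- (1 / \<epsilon> ^ 867)) < \<epsilon>\<^sup>2 / (16384000 :: real)"
    unfolding eventually_at_right_field
  proof (intro exI[of _ "1 / 16384000"] conjI allI impI)
    fix \<epsilon> :: real assume \<epsilon>: "0 < \<epsilon>" "\<epsilon> < 1 / 16384000"
    have "1 / \<epsilon> ^ 867 < exp (1 / \<epsilon> ^ 867)"
      using exp_ge_add_one_self[of "1 / \<epsilon> ^ 867"] by linarith
    then have "inverse (exp (1 / \<epsilon> ^ 867)) < inverse (1 / \<epsilon> ^ 867)"
      using \<epsilon> by (intro less_imp_inverse_less) auto
    then have "exp (- (1 / \<epsilon> ^ 867)) < \<epsilon> ^ 867" by (simp add: exp_minus)
    also have "\<dots> \<le> \<epsilon> ^ 3" using \<epsilon> by (intro power_decreasing) auto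
    also have "\<dots> = \<epsilon>\<^sup>2 * \<epsilon>" by (simp add: power2_eq_square power3_eq_cube)
    also have "\<dots> \<le> \<epsilon>\<^sup>2 * (1 / 16384000)" using \<epsilon> by (intro mult_left_mono) auto
    finally show "exp (- (1 / \<epsilon> ^ 867)) < \<epsilon>\<^sup>2 / 16384000" by simp
  qed simp
qed simp

end
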